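(* Let $Y$ be a nontrivial real Banach space. Then the following statements are equivalent. (a) $Y$ has the Radon-Nikodým property. (b) $\mathrm{SNA}(\mathbb{R},Z)\cup \mathrm{Der}(\mathbb{R},Z)$ is dense in $\mathrm{Lip}_0(\mathbb{R},Z)$ for every renorming $Z$ of $Y$.
   Context: A renorming of $Y$ is the vector space $Y$ equipped with a norm equivalent to the original one. For real Banach spaces $X,Z$, $\mathrm{Lip}_0(X,Z)$ denotes the space of Lipschitz maps $f:X\to Z$ with $f(0)=0$, equipped with the Lipschitz norm $\|f\| = \sup\{\|f(p)-f(q)\|/\|p-q\| : p,q\in X,\ p\neq q\}$; density is with respect to this norm. $S_X$ denotes the unit sphere of $X$. $f\in \mathrm{Lip}_0(X,Z)$ strongly attains its norm, written $f\in \mathrm{SNA}(X,Z)$, if there exist $p\neq q$ in $X$ with $\|f\| = \|f(p)-f(q)\|/\|p-q\|$. $f\in \mathrm{Lip}_0(X,Z)$ attains its maximal derivative, written $f\in \mathrm{Der}(X,Z)$, if there exist $x\in X$ and $e\in S_X$ such that the (two-sided, norm) limit $f'(x,e) := \lim_{t\to 0} \frac{f(x+te)-f(x)}{t}\in Z$ exists and $\|f'(x,e)\| = \|f\|$. A Banach space $Y$ has the Radon-Nikodým property (RNP) if for every finite measure space $(\Omega,\Sigma,\mu)$ and every $\mu$-continuous $Y$-valued measure $G:\Sigma\to Y$ of bounded variation there exists $g\in L_1(\mu,Y)$ with $G(E)=\int_E g\,d\mu$ for all $E\in\Sigma$. *)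

theory Defs
  imports "HOL-Analysis.Analysis"
begin

section \<open>Bochner integral in an arbitrary Banach space\<close>

text \<open>
  The library's \<^const>\<open>has_bochner_integral\<close> is restricted to second-countable range types, i.e. to
  separable Banach spaces. The following is its definition verbatim, for a general normed space,
  with Borel measurability replaced by strong measurability. Convergence is required everywhere on
  the space rather than almost everywhere: every class in \<open>L\<^sub>1(\<mu>,Y)\<close> has such a representative, and
  with this choice the notion agrees exactly with the library's in the separable case.
\<close>

definition strongly_measurable :: "'w measure \<Rightarrow> ('w \<Rightarrow> 'y::real_normed_vector) \<Rightarrow> bool" where
  "strongly_measurable M f \<longleftrightarrow>
     (\<exists>s. (\<forall>i. simple_function M (s i)) \<and> (\<forall>x\<in>space M. (\<lambda>i. s i x) \<longlonglongrightarrow> f x))"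

definition has_Bochner_integral :: "'w measure \<Rightarrow> ('w \<Rightarrow> 'y::real_normed_vector) \<Rightarrow> 'y \<Rightarrow> bool" where
  "has_Bochner_integral M f y \<longleftrightarrow>
     strongly_measurable M f \<and>
     (\<exists>s. (\<forall>i. Bochner_Integration.simple_bochner_integrable M (s i)) \<and>
          (\<lambda>i. \<integral>\<^sup>+x. ennreal (norm (f x - s i x)) \<partial>M) \<longlonglongrightarrow> 0 \<and>
          (\<lambda>i. Bochner_Integration.simple_bochner_integral M (s i)) \<longlonglongrightarrow> y)"

lemma has_Bochner_integral_eq_has_bochner_integral:
  fixes f :: "'w \<Rightarrow> 'y::{real_normed_vector, second_countable_topology}"
  shows "has_Bochner_integral M f y \<longleftrightarrow> has_bochner_integral M f y"
proof -
  have "strongly_measurable M f \<longleftrightarrow> f \<in> borel_measurable M"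
  proof
    assume "strongly_measurable M f"
    then obtain s where s: "\<And>i. simple_function M (s i)"
        "\<And>x. x \<in> space M \<Longrightarrow> (\<lambda>i. s i x) \<longlonglongrightarrow> f x"
      unfolding strongly_measurable_def by blast
    show "f \<in> borel_measurable M"
      by (rule borel_measurable_LIMSEQ_metric[of s]) (use s in \<open>auto intro: borel_measurable_simple_function\<close>)
  next
    assume "f \<in> borel_measurable M"
    from borel_measurable_implies_sequence_metric[OF this, of 0]
    show "strongly_measurable M f"
      unfolding strongly_measurable_def by blast
  qed
  then show ?thesis
    unfolding has_Bochner_integral_def has_bochner_integral.simps by blast
qed

definition Bochner_integrable :: "'w measure \<Rightarrow> ('w \<Rightarrow> 'y::real_normed_vector) \<Rightarrow> bool" where
  "Bochner_integrable M f \<longleftrightarrow> (\<exists>y. has_Bochner_integral M f y)"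


section \<open>Vector measures and the Radon-Nikodym property\<close>

definition vector_measure :: "'w measure \<Rightarrow> ('w set \<Rightarrow> 'y::real_normed_vector) \<Rightarrow> bool" where
  "vector_measure M G \<longleftrightarrow>
     (\<forall>A. range A \<subseteq> sets M \<longrightarrow> disjoint_family A \<longrightarrow>
        (\<lambda>n::nat. G (A n)) sums G (\<Union>n. A n))"

definition continuous_wrt :: "'w measure \<Rightarrow> ('w set \<Rightarrow> 'y::real_normed_vector) \<Rightarrow> bool" where
  "continuous_wrt M G \<longleftrightarrow>
     (\<forall>\<epsilon>>0. \<exists>\<delta>>0. \<forall>E\<in>sets M. measure M E < \<delta> \<longrightarrow> norm (G E) < \<epsilon>)"

definition variation :: "'w measure \<Rightarrow> ('w set \<Rightarrow> 'y::real_normed_vector) \<Rightarrow> 'w set \<Rightarrow> ennreal" where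
  "variation M G E =
     (SUP P \<in> {P. finite P \<and> P \<subseteq> sets M \<and> disjoint P \<and> \<Union>P = E}. \<Sum>A\<in>P. ennreal (norm (G A)))"

text \<open>
  HOL cannot quantify over types inside a formula, so the type \<open>'w\<close> of the points of the underlying
  measure spaces is a parameter; the measure space itself (carrier, \<open>\<sigma>\<close>-algebra and measure) is
  arbitrary in it. The notion is meaningful only if \<open>'w\<close> has at least the cardinality of the continuum:
  all measures on a countable type are purely atomic, and then the property holds for every \<open>'y\<close>.
  Measure spaces over a smaller type \<open>'v\<close> are covered by embedding \<open>'v\<close> into \<open>'v + real\<close>.
\<close>

definition has_RNP :: "'w itself \<Rightarrow> 'y::banach itself \<Rightarrow> bool" where
  "has_RNP _ _ \<longleftrightarrow>
     (\<forall>(M :: 'w measure) (G :: 'w set \<Rightarrow> 'y).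
        finite_measure M \<longrightarrow> vector_measure M G \<longrightarrow> continuous_wrt M G \<longrightarrow>
        variation M G (space M) < \<infinity> \<longrightarrow>
        (\<exists>g. Bochner_integrable M g \<and>
             (\<forall>E\<in>sets M. has_Bochner_integral M (\<lambda>x. indicat_real E x *\<^sub>R g x) (G E))))"


section \<open>Renormings\<close>

text \<open>
  A renorming keeps the vector space and changes only the norm, so it is given by the new norm
  function \<open>N\<close>; in particular \<open>Lip\<^sub>0(X,Z)\<close> and the notions below are parametrised by the norm of \<open>Z\<close>.
\<close>

definition is_norm :: "('z::real_vector \<Rightarrow> real) \<Rightarrow> bool" where
  "is_norm N \<longleftrightarrow>
     (\<forall>x. N x = 0 \<longleftrightarrow> x = 0) \<and>
     (\<forall>c x. N (c *\<^sub>R x) = \<bar>c\<bar> * N x) \<and>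
     (\<forall>x y. N (x + y) \<le> N x + N y)"

definition renorming :: "('y::real_normed_vector \<Rightarrow> real) \<Rightarrow> bool" where
  "renorming N \<longleftrightarrow>
     is_norm N \<and> (\<exists>a>0. \<exists>b>0. \<forall>y. a * norm y \<le> N y \<and> N y \<le> b * norm y)"


section \<open>Lipschitz maps\<close>

text \<open>The class \<^class>\<open>perfect_space\<close> makes \<open>X\<close> nontrivial, so that the supremum below is over a nonempty set.\<close>

definition Lip0 :: "('z::real_vector \<Rightarrow> real) \<Rightarrow> ('x::{banach,perfect_space} \<Rightarrow> 'z) set" where
  "Lip0 N = {f. f 0 = 0 \<and> (\<exists>L. \<forall>p q. N (f p - f q) \<le> L * norm (p - q))}"

definition lip_norm :: "('z::real_vector \<Rightarrow> real) \<Rightarrow> ('x::{banach,perfect_space} \<Rightarrow> 'z) \<Rightarrow> real" where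
  "lip_norm N f = Sup {N (f p - f q) / norm (p - q) | p q. p \<noteq> q}"

definition SNA :: "('z::real_vector \<Rightarrow> real) \<Rightarrow> ('x::{banach,perfect_space} \<Rightarrow> 'z) set" where
  "SNA N = {f \<in> Lip0 N. \<exists>p q. p \<noteq> q \<and> lip_norm N f = N (f p - f q) / norm (p - q)}"

definition has_directional_derivative ::
    "('z::real_vector \<Rightarrow> real) \<Rightarrow> ('x::{banach,perfect_space} \<Rightarrow> 'z) \<Rightarrow> 'x \<Rightarrow> 'x \<Rightarrow> 'z \<Rightarrow> bool" where
  "has_directional_derivative N f x e d \<longleftrightarrow>
     ((\<lambda>t::real. N ((1 / t) *\<^sub>R (f (x + t *\<^sub>R e) - f x) - d)) \<longlongrightarrow> 0) (at 0)"

definition Der :: "('z::real_vector \<Rightarrow> real) \<Rightarrow> ('x::{banach,perfect_space} \<Rightarrow> 'z) set" where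
  "Der N = {f \<in> Lip0 N. \<exists>x e d. norm e = 1 \<and> has_directional_derivative N f x e d \<and> N d = lip_norm N f}"

definition dense_in_Lip0 ::
    "('z::real_vector \<Rightarrow> real) \<Rightarrow> ('x::{banach,perfect_space} \<Rightarrow> 'z) set \<Rightarrow> bool" where
  "dense_in_Lip0 N D \<longleftrightarrow>
     D \<subseteq> Lip0 N \<and> (\<forall>f\<in>Lip0 N. \<forall>\<epsilon>>0. \<exists>g\<in>D. lip_norm N (\<lambda>x. f x - g x) < \<epsilon>)"

end

theory Submission
  imports Defs
begin

text \<open>
  If \<open>Y\<close> has the RNP and \<open>f\<close> is Lipschitz, the vector measure with \<open>H {c<..d} = f d - f c\<close> is almost
  constant, \<open>H E \<approx> \<lambda>(E) w\<close>, on the subsets of some non-null set \<open>S\<close>, where \<open>N w\<close> can be taken close to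
  the Lipschitz constant \<open>L\<close> of \<open>f\<close>. Changing \<open>f'\<close> on \<open>S\<close> to the multiple of \<open>w\<close> of norm \<open>L\<close> moves \<open>f\<close> by
  little in \<open>Lip\<^sub>0\<close> and gives a map whose derivative at a density point of \<open>S\<close> is maximal.

  Conversely, density for the original norm alone suffices. A vector measure without Bochner density is, on
  some non-null set, nowhere almost constant, and a binary tree of subsets whose averages keep jumping by
  more than \<open>\<epsilon>\<close> is laid out along an interval: this gives a Lipschitz \<open>f\<close> whose slopes jump by more than
  \<open>\<epsilon>\<close> at every point and every scale. Composing \<open>f\<close> with a monotone map \<open>\<theta>\<close> that is constant on
  a dense family of intervals, but whose flat parts have small total length, excludes nearby maps from
  attaining their norm strongly (they are slow on a part of every interval); and where a nearby map has a
  maximal derivative, \<open>\<theta>\<close> must have slope close to 1, so the jumps of the slopes of \<open>f\<close> are still visible.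
\<close>

section \<open>Lebesgue density points\<close>

text \<open>In a tree built from arbitrary subsets with distant averages the cells around a point
  need not shrink: each step may split off a tiny piece, and along cells decreasing to a non-null
  set the averages converge, so only finitely many jumps remain. Hence every child is chosen to have
  at least half the largest measure possible. The same halving drives the exhaustion argument. In
  the other direction \<open>f\<close> has no derivative to start from. \<open>H\<close> is obtained
  as the limit of the integrals of the slopes of piecewise linear interpolations, which works in
  every Banach space; the RNP only supplies sets where \<open>H\<close> is almost constant. As the
  RNP concerns measures on \<open>'w\<close>, Lebesgue measure is first carried there by an
  injection of the reals. The value \<open>w\<close> is rescaled to norm exactly \<open>L\<close>
  because a larger one could raise the Lipschitz constant, and a smaller one would not be a maximal
  derivative.\<close>

text \<open>Lebesgue's density theorem by Vitali covering: disjoint balls that fill the bad set each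
  have a fraction \<open>\<eta>\<close> of their measure outside \<open>A\<close>, but lie in an
  open superset of \<open>A\<close> that has little measure to spare.\<close>

lemma density_point:
  fixes A :: "'a::euclidean_space set"
  assumes A: "A \<in> lmeasurable" and pos: "measure lebesgue A > 0"
  obtains x where "x \<in> A"
    "\<And>\<eta>. \<eta> > 0 \<Longrightarrow> \<exists>r0>0. \<forall>r. 0 < r \<and> r < r0 \<longrightarrow>
       measure lebesgue (cball x r - A) \<le> \<eta> * measure lebesgue (cball x r)"
proof -
  define Bad where "Bad \<eta> = {x\<in>A. \<forall>r0>0. \<exists>r. 0 < r \<and> r < r0 \<and>
    measure lebesgue (cball x r - A) > \<eta> * measure lebesgue (cball x r)}" for \<eta> :: real
  have neg: "negligible (Bad \<eta>)" if \<eta>: "\<eta> > 0" for \<eta>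
    unfolding negligible_outer_le
  proof (intro allI impI)
    fix e :: real assume e: "e > 0"
    have "A \<in> sets lebesgue" using A by (rule fmeasurableD)
    \<comment> \<open>The excess is \<open>e * \<eta>\<close> because the balls use it up at rate
      \<open>\<eta>\<close>; dividing leaves the required bound \<open>e\<close>.\<close>
    then obtain O' where O': "open O'" "A \<subseteq> O'" "(O' - A) \<in> lmeasurable" "emeasure lebesgue (O' - A) < ennreal (e * \<eta>)"
      using sets_lebesgue_outer_open[of A "e * \<eta>"] e \<eta> by auto
    have mO: "measure lebesgue (O' - A) \<le> e * \<eta>"
      using O'(4) e \<eta> emeasure_eq_measure2[OF O'(3)] by (simp add: ennreal_less_iff)
    define K where "K = {(x, r). x \<in> Bad \<eta> \<and> r > 0 \<and> cball x r \<subseteq> O' \<and>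
       measure lebesgue (cball x r - A) > \<eta> * measure lebesgue (cball x r)}"
    have cov: "\<exists>i. i \<in> K \<and> x \<in> cball (fst i) (snd i) \<and> snd i < d" if x: "x \<in> Bad \<eta>" and d: "d > 0" for x d
    proof -
      have "x \<in> O'" using x O'(2) by (auto simp: Bad_def)
      then obtain \<rho> where \<rho>: "\<rho> > 0" "cball x \<rho> \<subseteq> O'"
        using O'(1) open_contains_cball by blast
      obtain r where r: "0 < r" "r < min d \<rho>" "measure lebesgue (cball x r - A) > \<eta> * measure lebesgue (cball x r)"
      proof -
        have "0 < min d \<rho>" using d \<rho>(1) by simp
        then show ?thesis using x that unfolding Bad_def by blast
      qed
      have "cball x r \<subseteq> O'" using r(2) \<rho>(2) subset_cball[of r \<rho> x] by auto
      then have "(x, r) \<in> K" using r x by (auto simp: K_def)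
      with r show ?thesis by (intro exI[of _ "(x, r)"]) auto
    qed
    have rK: "\<And>i. i \<in> K \<Longrightarrow> 0 < snd i" by (auto simp: K_def)
    obtain C where C: "countable C" "C \<subseteq> K"
      "pairwise (\<lambda>i j. disjnt (cball (fst i) (snd i)) (cball (fst j) (snd j))) C"
      "negligible (Bad \<eta> - (\<Union>i \<in> C. cball (fst i) (snd i)))"
      using Vitali_covering_theorem_cballs[OF rK cov] by blast
    let ?B = "\<lambda>i. cball (fst i) (snd i) :: 'a set"
    \<comment> \<open>Finite subfamilies suffice: a common bound for them passes to the countable
      union.\<close>
    have fin: "measure lebesgue (\<Union>i\<in>D. ?B i) \<le> e" if D: "D \<subseteq> C" "finite D" for D
    proof -
      have dis: "disjoint_family_on ?B D"
        using C(3) D(1) unfolding disjoint_family_on_def pairwise_def disjnt_def by blast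
      have "\<eta> * measure lebesgue (\<Union>i\<in>D. ?B i) = (\<Sum>i\<in>D. \<eta> * measure lebesgue (?B i))"
        by (subst measure_finite_Union[OF D(2) _ dis])
           (use emeasure_lborel_cball_finite in \<open>auto simp: sum_distrib_left less_top\<close>)
      also have "\<dots> \<le> (\<Sum>i\<in>D. measure lebesgue (?B i - A))"
        using C(2) D(1) by (intro sum_mono) (force simp: K_def)
      also have "\<dots> = measure lebesgue (\<Union>i\<in>D. ?B i - A)"
      proof (rule measure_finite_Union[symmetric, OF D(2)])
        show "disjoint_family_on (\<lambda>i. ?B i - A) D"
          using dis unfolding disjoint_family_on_def by blast
        show "(\<lambda>i. ?B i - A) ` D \<subseteq> sets lebesgue"
          using fmeasurableD[OF A] by auto
        fix i show "emeasure lebesgue (?B i - A) \<noteq> \<infinity>"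
          using A fmeasurable.Diff[of "?B i" lebesgue A] fmeasurableD[OF A] lmeasurable_cball
          by (metis fmeasurableD2 infinity_ennreal_def)
      qed
      also have "\<dots> \<le> measure lebesgue (O' - A)"
      proof (rule measure_mono_fmeasurable[OF _ _ O'(3)])
        show "(\<Union>i\<in>D. ?B i - A) \<subseteq> O' - A" using C(2) D(1) by (force simp: K_def)
        show "(\<Union>i\<in>D. ?B i - A) \<in> sets lebesgue"
          using fmeasurableD[OF A] D(2) by (intro sets.finite_UN) auto
      qed
      also have "\<dots> \<le> \<eta> * e" using mO by (simp add: mult.commute)
      finally show ?thesis using \<eta> by simp
    qed
    define U where "U = (\<Union>i\<in>C. ?B i)"
    define Z where "Z = Bad \<eta> - U"
    have U: "U \<in> lmeasurable" "measure lebesgue U \<le> e"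
      unfolding U_def
      using fmeasurable_UN_bound[OF C(1), of ?B lebesgue e] measure_UN_bound[OF C(1), of ?B lebesgue e] fin
      by auto
    have Z: "Z \<in> null_sets lebesgue"
      using C(4) by (simp add: Z_def U_def negligible_iff_null_sets)
    have "U \<union> Z \<in> lmeasurable" "measure lebesgue (U \<union> Z) \<le> e"
      using U Z measure_Un_null_set[of U lebesgue Z] fmeasurableD[OF U(1)]
      by (auto intro!: fmeasurable.Un simp: fmeasurableI_null_sets)
    moreover have "Bad \<eta> \<subseteq> U \<union> Z" by (auto simp: Z_def)
    ultimately show "\<exists>T. Bad \<eta> \<subseteq> T \<and> T \<in> lmeasurable \<and> measure lebesgue T \<le> e"
      by blast
  qed
  \<comment> \<open>\<open>Bad\<close> grows as \<open>\<eta>\<close> decreases, so countably many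
    thresholds give one point that serves every \<open>\<eta>\<close>.\<close>
  have "negligible (\<Union>n. Bad (1 / real (Suc n)))"
    using neg by (intro negligible_countable_Union) auto
  moreover have "\<not> negligible A" using pos A by (auto simp: negligible_iff_measure)
  ultimately have "\<not> A \<subseteq> (\<Union>n. Bad (1 / real (Suc n)))"
    using negligible_subset by blast
  then obtain x where x: "x \<in> A" "\<And>n. x \<notin> Bad (1 / real (Suc n))" by blast
  show ?thesis
  proof (rule that[OF x(1)])
    fix \<eta> :: real assume "\<eta> > 0"
    then obtain n where n: "1 / real (Suc n) < \<eta>" using nat_approx_posE by blast
    have "\<exists>r0>0. \<forall>r. 0 < r \<and> r < r0 \<longrightarrow>
        measure lebesgue (cball x r - A) \<le> 1 / real (Suc n) * measure lebesgue (cball x r)"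
    proof (rule ccontr)
      assume "\<not> ?thesis"
      then have "x \<in> Bad (1 / real (Suc n))"
        using x(1) unfolding Bad_def mem_Collect_eq not_le[symmetric] by blast
      with x(2) show False by blast
    qed
    moreover have "1 / real (Suc n) * measure lebesgue (cball x r) \<le> \<eta> * measure lebesgue (cball x r)" for r
      using n by (intro mult_right_mono) auto
    ultimately show "\<exists>r0>0. \<forall>r. 0 < r \<and> r < r0 \<longrightarrow>
       measure lebesgue (cball x r - A) \<le> \<eta> * measure lebesgue (cball x r)"
      by (meson order_trans)
  qed
qed

section \<open>Exhaustion and vector measures\<close>

context finite_measure begin

text \<open>The supremum of the measures need not be attained; half of it always is exceeded, and
  that is enough for the limit arguments built on this selection.\<close>

lemma greedy_subset:
  assumes "E0 \<in> sets M" "E0 \<subseteq> B" "P E0"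
  obtains E where "E \<in> sets M" "E \<subseteq> B" "P E"
    "\<And>E'. E' \<in> sets M \<Longrightarrow> E' \<subseteq> B \<Longrightarrow> P E' \<Longrightarrow> measure M E' \<le> 2 * measure M E"
proof -
  define S where "S = measure M ` {E \<in> sets M. E \<subseteq> B \<and> P E}"
  have bdd: "bdd_above S" unfolding S_def bdd_above_def using bounded_measure by auto
  have ne: "S \<noteq> {}" using assms by (auto simp: S_def)
  have up: "measure M E \<le> Sup S" if "E \<in> sets M" "E \<subseteq> B" "P E" for E
    using that by (intro cSup_upper[OF _ bdd]) (auto simp: S_def)
  show ?thesis
  \<comment> \<open>With supremum zero, half of it is not strictly smaller; but then every candidate
    is null and \<open>E0\<close> itself will do.\<close>
  proof (cases "Sup S \<le> 0")
    case True
    show ?thesis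
      by (rule that[of E0]) (use assms up True in \<open>auto intro!: order_trans[OF up] simp: order_trans[OF True]\<close>)
  next
    case False
    then have "Sup S / 2 < Sup S" by simp
    then obtain s where "s \<in> S" "Sup S / 2 < s" using less_cSup_iff[OF ne bdd] by blast
    then obtain E where "E \<in> sets M" "E \<subseteq> B" "P E" "Sup S / 2 < measure M E" by (auto simp: S_def)
    then show ?thesis using up by (intro that[of E]) (auto intro: order_trans[OF up])
  qed
qed

lemma measure_disjoint_tendsto_0:
  assumes "range B \<subseteq> sets M" "disjoint_family B"
  shows "(\<lambda>n. measure M (B n)) \<longlonglongrightarrow> 0"
  using sums_summable[OF finite_measure_UNION[OF assms]] by (rule summable_LIMSEQ_zero)

text \<open>Remove a nearly largest \<open>P\<close>-subset again and again. A non-null remainder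
  would contain a non-null \<open>P\<close>-set that was available at every stage, so each removed
  piece would have at least half its measure, impossible for disjoint pieces. \<open>P {}\<close>
  keeps the selection possible at every stage.\<close>

lemma exhaustion:
  assumes A0: "A0 \<in> sets M" and P0: "P {}"
    and ex: "\<And>A. A \<in> sets M \<Longrightarrow> A \<subseteq> A0 \<Longrightarrow> measure M A > 0 \<Longrightarrow>
      \<exists>B\<in>sets M. B \<subseteq> A \<and> measure M B > 0 \<and> P B"
  obtains B :: "nat \<Rightarrow> 'a set" where "disjoint_family B" "\<And>i. B i \<in> sets M" "\<And>i. B i \<subseteq> A0"
    "\<And>i. P (B i)" "measure M (A0 - (\<Union>i. B i)) = 0"
proof -
  have "\<exists>E. E \<in> sets M \<and> E \<subseteq> A \<and> P E \<and>
     (\<forall>E'. E' \<in> sets M \<longrightarrow> E' \<subseteq> A \<longrightarrow> P E' \<longrightarrow> measure M E' \<le> 2 * measure M E)" for A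
    by (rule greedy_subset[of "{}" A P]) (use P0 in auto)
  then obtain sel where sel: "\<And>A. sel A \<in> sets M" "\<And>A. sel A \<subseteq> A" "\<And>A. P (sel A)"
    "\<And>A E'. E' \<in> sets M \<Longrightarrow> E' \<subseteq> A \<Longrightarrow> P E' \<Longrightarrow> measure M E' \<le> 2 * measure M (sel A)"
    by metis
  define R where "R = rec_nat A0 (\<lambda>_ A. A - sel A)"
  have R0: "R 0 = A0" and RS: "R (Suc n) = R n - sel (R n)" for n by (simp_all add: R_def)
  have Rdec: "R n \<subseteq> R m" if "m \<le> n" for m n
    using that by (induction n rule: dec_induct) (auto simp: RS)
  define B where "B n = sel (R n)" for n
  have "B m \<inter> B n = {}" if "m < n" for m n
    using Rdec[of "Suc m" n] that sel(2)[of "R n"] by (auto simp: RS B_def)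
  then have dis: "disjoint_family B"
    unfolding disjoint_family_on_def by (metis Int_commute linorder_neqE_nat)
  have BA: "B i \<subseteq> A0" for i using sel(2)[of "R i"] Rdec[of 0 i] by (auto simp: B_def R0)
  have Bs: "B i \<in> sets M" for i by (simp add: B_def sel)
  define Z where "Z = A0 - (\<Union>i. B i)"
  have ZR: "Z \<subseteq> R n" for n by (induction n) (auto simp: Z_def R0 RS B_def)
  have Zs: "Z \<in> sets M" unfolding Z_def using A0 Bs by auto
  have "measure M Z = 0"
  proof (rule ccontr)
    assume "measure M Z \<noteq> 0"
    then have "measure M Z > 0" by (simp add: zero_less_measure_iff)
    from ex[OF Zs _ this] obtain D where D: "D \<in> sets M" "D \<subseteq> Z" "measure M D > 0" "P D"
      by (auto simp: Z_def)
    have "measure M D / 2 \<le> measure M (B n)" for n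
      using sel(4)[OF D(1) order_trans[OF D(2) ZR[of n]] D(4)] by (simp add: B_def)
    moreover have "(\<lambda>n. measure M (B n)) \<longlonglongrightarrow> 0"
      using Bs dis by (intro measure_disjoint_tendsto_0) auto
    ultimately have "measure M D / 2 \<le> 0" by (intro LIMSEQ_le_const) auto
    with D(3) show False by simp
  qed
  then show ?thesis using that[of B] dis Bs BA sel(3) by (auto simp: Z_def B_def)
qed

end

section \<open>Vector measures vanishing on null sets, and their variation\<close>

locale continuous_vector_measure = finite_measure M
  for M :: "'w measure" and G :: "'w set \<Rightarrow> 'y::banach" +
  assumes vm: "vector_measure M G" and cont: "continuous_wrt M G"
begin

lemma sums_UN: "range A \<subseteq> sets M \<Longrightarrow> disjoint_family A \<Longrightarrow> (\<lambda>n::nat. G (A n)) sums G (\<Union>n. A n)"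
  using vm by (simp add: vector_measure_def)

lemma G_null:
  assumes "E \<in> sets M" "measure M E = 0" shows "G E = 0"
proof (rule ccontr)
  assume "G E \<noteq> 0"
  then have "norm (G E) > 0" by simp
  then obtain \<delta> where "\<delta> > 0" "\<forall>E'\<in>sets M. measure M E' < \<delta> \<longrightarrow> norm (G E') < norm (G E)"
    using cont unfolding continuous_wrt_def by blast
  with assms show False by force
qed

lemma G_empty [simp]: "G {} = 0" by (rule G_null) auto

lemma G_Un:
  assumes "A \<in> sets M" "B \<in> sets M" "A \<inter> B = {}" shows "G (A \<union> B) = G A + G B"
proof -
  define S where "S = (\<lambda>n::nat. if n = 0 then A else if n = 1 then B else {})"
  have "(\<lambda>n. G (S n)) sums G (\<Union>n. S n)"
    using assms by (intro sums_UN) (auto simp: S_def disjoint_family_on_def)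
  moreover have "(\<Union>n. S n) = A \<union> B"
    unfolding S_def by (auto split: if_splits)
  moreover have "(\<lambda>n. G (S n)) sums (\<Sum>n\<in>{0,1}. G (S n))" by (rule sums_finite) (auto simp: S_def)
  ultimately show ?thesis by (simp add: sums_iff S_def)
qed

lemma G_Diff:
  assumes "A \<in> sets M" "B \<in> sets M" "B \<subseteq> A" shows "G (A - B) = G A - G B"
  using G_Un[of "A - B" B] assms by (simp add: Un_absorb2 Int_commute Diff_disjoint algebra_simps)

text \<open>\<open>variation\<close> ranges over partitions of the whole space, so the family is
  completed by the set \<open>R\<close> of points that it misses.\<close>

lemma sum_norm_le_variation:
  assumes I: "finite I" "disjoint_family_on E I" "\<And>i. i \<in> I \<Longrightarrow> E i \<in> sets M"
  shows "ennreal (\<Sum>i\<in>I. norm (G (E i))) \<le> variation M G (space M)"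
proof -
  define R where "R = space M - (\<Union>i\<in>I. E i)"
  define P where "P = insert R (E ` I)"
  have Rs: "R \<in> sets M" unfolding R_def using I by auto
  have P: "finite P" "P \<subseteq> sets M" "\<Union>P = space M"
    using I Rs sets.sets_into_space by (auto simp: P_def R_def)
  have d: "disjoint P"
    unfolding disjoint_def
  proof (intro ballI impI)
    fix a b assume "a \<in> P" "b \<in> P" "a \<noteq> b"
    then show "a \<inter> b = {}"
      using disjoint_family_onD[OF I(2)] by (fastforce simp: P_def R_def)
  qed
  have "ennreal (\<Sum>i\<in>I. norm (G (E i))) = (\<Sum>i\<in>I. ennreal (norm (G (E i))))" by (simp add: sum_ennreal)
  also have "\<dots> = (\<Sum>A\<in>E ` I. ennreal (norm (G A)))"
  \<comment> \<open>An indexed family may repeat a set, but disjointness makes a repeated set empty,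
    and \<open>G {} = 0\<close>.\<close>
  proof (subst sum.reindex_nontrivial[OF I(1)])
    fix i j assume "i \<in> I" "j \<in> I" "i \<noteq> j" "E i = E j"
    then have "E i = {}" using I(2) by (auto simp: disjoint_family_on_def)
    then show "ennreal (norm (G (E i))) = 0" by simp
  qed simp
  also have "\<dots> \<le> (\<Sum>A\<in>P. ennreal (norm (G A)))"
    using I(1) by (intro sum_mono2) (auto simp: P_def)
  also have "\<dots> \<le> variation M G (space M)"
    unfolding variation_def using P d by (intro SUP_upper) auto
  finally show ?thesis .
qed

text \<open>Otherwise every non-null subset of \<open>A\<close> contains a non-null set on which the
  norm of \<open>G\<close> is at least \<open>C\<close> times the measure. Exhausting
  \<open>A\<close> by such sets produces more variation than there is.\<close>

lemma locally_bounded_average: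
  assumes V: "variation M G (space M) < \<infinity>" and A: "A \<in> sets M" "measure M A > 0"
  shows "\<exists>B\<in>sets M. \<exists>C. B \<subseteq> A \<and> measure M B > 0 \<and>
    (\<forall>E\<in>sets M. E \<subseteq> B \<longrightarrow> norm (G E) \<le> C * measure M E)"
proof (rule ccontr)
  assume neg: "\<not> ?thesis"
  define v where "v = enn2real (variation M G (space M))"
  have v: "variation M G (space M) = ennreal v" "v \<ge> 0" using V by (simp_all add: v_def)
  \<comment> \<open>Chosen so that \<open>C * measure M A = v + 1\<close>.\<close>
  define C where "C = (v + 1) / measure M A"
  have C: "C \<ge> 0" using v A by (simp add: C_def)
  define P where "P E \<longleftrightarrow> C * measure M E \<le> norm (G E)" for E
  have "\<exists>B\<in>sets M. B \<subseteq> D \<and> measure M B > 0 \<and> P B"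
    if D: "D \<in> sets M" "D \<subseteq> A" "measure M D > 0" for D
  proof -
    from neg D have "\<not> (\<forall>E\<in>sets M. E \<subseteq> D \<longrightarrow> norm (G E) \<le> C * measure M E)"
      by blast
    then obtain E where E: "E \<in> sets M" "E \<subseteq> D" "C * measure M E < norm (G E)" by (auto simp: not_le)
    \<comment> \<open>The strict inequality excludes null sets, on which \<open>G\<close>
      vanishes.\<close>
    then have "measure M E \<noteq> 0" using G_null by force
    then have "measure M E > 0" by (simp add: zero_less_measure_iff)
    with E show ?thesis by (auto simp: P_def)
  qed
  then obtain B :: "nat \<Rightarrow> 'w set" where B: "disjoint_family B" "\<And>i. B i \<in> sets M" "\<And>i. B i \<subseteq> A"
    "\<And>i. P (B i)" "measure M (A - (\<Union>i. B i)) = 0"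
    using exhaustion[OF A(1), of P] by (auto simp: P_def)
  have AB: "measure M (\<Union>i. B i) = measure M A"
  proof -
    have "(\<Union>i. B i) \<subseteq> A" using B(3) by blast
    then show ?thesis using finite_measure_Diff[OF A(1), of "\<Union>i. B i"] B(2,5) by auto
  qed
  have "(\<lambda>i. measure M (B i)) sums measure M A"
    using finite_measure_UNION[of B] B by (auto simp: AB)
  then have "(\<lambda>i. C * measure M (B i)) sums (C * measure M A)" by (rule sums_mult)
  moreover have "(\<Sum>i<n. C * measure M (B i)) \<le> v" for n
  proof -
    have "(\<Sum>i<n. C * measure M (B i)) \<le> (\<Sum>i<n. norm (G (B i)))"
      using B(4) by (intro sum_mono) (simp add: P_def)
    also have "ennreal \<dots> \<le> ennreal v"
      unfolding v(1)[symmetric] using B disjoint_family_on_mono[OF subset_UNIV B(1)]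
      by (intro sum_norm_le_variation) auto
    then have "(\<Sum>i<n. norm (G (B i))) \<le> v" using v(2) by simp
    finally show ?thesis .
  qed
  ultimately have "C * measure M A \<le> v"
    unfolding sums_def by (intro LIMSEQ_le_const2) auto
  then show False using A by (simp add: C_def)
qed

end

section \<open>Bochner densities\<close>

abbreviation sbi :: "'w measure \<Rightarrow> ('w \<Rightarrow> 'y::real_vector) \<Rightarrow> 'y" where
  "sbi \<equiv> Bochner_Integration.simple_bochner_integral"

lemma has_Bochner_integral_cong:
  assumes "\<And>x. x \<in> space M \<Longrightarrow> f x = g x"
  shows "has_Bochner_integral M f y \<longleftrightarrow> has_Bochner_integral M g y"
proof -
  have "strongly_measurable M f \<longleftrightarrow> strongly_measurable M g"
    unfolding strongly_measurable_def using assms by simp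
  moreover have "(\<integral>\<^sup>+x. ennreal (norm (f x - s x)) \<partial>M) = (\<integral>\<^sup>+x. ennreal (norm (g x - s x)) \<partial>M)" for s
    using assms by (intro nn_integral_cong) simp
  ultimately show ?thesis unfolding has_Bochner_integral_def by simp
qed

context finite_measure begin

lemma simple_bochner_integrable_iff:
  "Bochner_Integration.simple_bochner_integrable M f \<longleftrightarrow> simple_function M f"
  by (auto simp: Bochner_Integration.simple_bochner_integrable.simps)

lemma simple_function_indicator_scaleR:
  assumes "E \<in> sets M" "simple_function M s"
  shows "simple_function M (\<lambda>x. indicat_real E x *\<^sub>R s x)"
  using simple_function_compose2[of M "indicat_real E" s scaleR] assms by simp

lemma simple_function_diff':
  fixes s t :: "'a \<Rightarrow> 'b::real_vector"
  shows "simple_function M s \<Longrightarrow> simple_function M t \<Longrightarrow> simple_function M (\<lambda>x. s x - t x)"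
  by (rule simple_function_compose2)

lemma simple_bochner_integral_indicator:
  fixes y :: "'b::real_normed_vector"
  assumes "E \<in> sets M"
  shows "sbi M (\<lambda>x. indicat_real E x *\<^sub>R y) = measure M E *\<^sub>R y"
proof -
  have sf: "simple_function M (indicat_real E)" using assms by simp
  have "ennreal (sbi M (indicat_real E)) = ennreal (measure M E)"
    using assms sf
    by (subst Bochner_Integration.simple_bochner_integral_eq_nn_integral)
       (auto simp: simple_bochner_integrable_iff ennreal_indicator emeasure_eq_measure)
  then have "sbi M (indicat_real E) = measure M E"
    by (subst (asm) ennreal_inj) (auto intro!: Bochner_Integration.simple_bochner_integral_nonneg)
  moreover have "sbi M (\<lambda>x. indicat_real E x *\<^sub>R y) = sbi M (indicat_real E) *\<^sub>R y"
    using sf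
    by (intro Bochner_Integration.simple_bochner_integral_linear[where f="\<lambda>r. r *\<^sub>R y"])
       (auto simp: simple_bochner_integrable_iff scaleR_left_distrib intro!: linearI)
  ultimately show ?thesis by simp
qed

lemma simple_bochner_integral_dist_le:
  fixes s t :: "'a \<Rightarrow> 'b::real_normed_vector"
  assumes "simple_function M s" "simple_function M t"
  shows "ennreal (norm (sbi M s - sbi M t)) \<le> (\<integral>\<^sup>+x. ennreal (norm (s x - t x)) \<partial>M)"
proof -
  have st: "simple_function M (\<lambda>x. s x - t x)" by (rule simple_function_diff') fact+
  then have nst: "simple_function M (\<lambda>x. norm (s x - t x))" by (rule simple_function_compose1)
  have "sbi M s - sbi M t = sbi M (\<lambda>x. s x - t x)"
    using assms by (simp add: Bochner_Integration.simple_bochner_integral_diff simple_bochner_integrable_iff)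
  then have "norm (sbi M s - sbi M t) \<le> sbi M (\<lambda>x. norm (s x - t x))"
    using Bochner_Integration.simple_bochner_integral_norm_bound[of M "\<lambda>x. s x - t x"] st
    by (simp add: simple_bochner_integrable_iff)
  moreover have "ennreal (sbi M (\<lambda>x. norm (s x - t x))) = (\<integral>\<^sup>+x. ennreal (norm (s x - t x)) \<partial>M)"
    using nst by (intro Bochner_Integration.simple_bochner_integral_eq_nn_integral)
      (auto simp: simple_bochner_integrable_iff)
  ultimately show ?thesis by (metis ennreal_leI)
qed

lemma simple_bochner_integral_UN_const:
  fixes y :: "nat \<Rightarrow> 'b::real_normed_vector"
  assumes B: "\<And>i. B i \<in> sets M" and E: "E \<in> sets M"
  shows "simple_function M (\<lambda>x. \<Sum>i<k. indicat_real (B i) x *\<^sub>R y i)"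
    and "sbi M (\<lambda>x. indicat_real E x *\<^sub>R (\<Sum>i<k. indicat_real (B i) x *\<^sub>R y i)) =
      (\<Sum>i<k. measure M (E \<inter> B i) *\<^sub>R y i)"
proof -
  have sf: "simple_function M (\<lambda>x. indicat_real A x *\<^sub>R y i)" if "A \<in> sets M" for A i
    using that by (intro simple_function_indicator_scaleR) auto
  have sfs: "simple_function M (\<lambda>x. \<Sum>i<k. indicat_real (A i) x *\<^sub>R y i)" if "\<And>i. A i \<in> sets M" for A k
  proof (induction k)
    case (Suc k)
    then show ?case using sf[OF that] by (simp add: simple_function_compose2[where h="(+)"])
  qed simp
  show "simple_function M (\<lambda>x. \<Sum>i<k. indicat_real (B i) x *\<^sub>R y i)" by (rule sfs) fact
  have "sbi M (\<lambda>x. \<Sum>i<k. indicat_real (E \<inter> B i) x *\<^sub>R y i) = (\<Sum>i<k. measure M (E \<inter> B i) *\<^sub>R y i)"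
  proof (induction k)
    case 0
    show ?case by (auto simp: Bochner_Integration.simple_bochner_integral_def intro!: sum.neutral)
  next
    case (Suc k)
    then show ?case
      using sfs[of "\<lambda>i. E \<inter> B i" k] sf[of "E \<inter> B k" k] B E
      by (simp add: Bochner_Integration.simple_bochner_integral_add simple_bochner_integrable_iff
          simple_bochner_integral_indicator)
  qed
  then show "sbi M (\<lambda>x. indicat_real E x *\<^sub>R (\<Sum>i<k. indicat_real (B i) x *\<^sub>R y i)) =
      (\<Sum>i<k. measure M (E \<inter> B i) *\<^sub>R y i)"
    by (simp only: scaleR_sum_right scaleR_scaleR indicator_inter_arith)
qed

text \<open>On a level set \<open>t\<close> is constant, so norm and integral commute there. Thus
  integrals over disjoint sets, which are what a vector measure controls, recover the whole L1
  norm.\<close>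

lemma nn_integral_norm_simple:
  fixes t :: "'a \<Rightarrow> 'b::real_normed_vector"
  assumes t: "simple_function M t"
  shows "(\<integral>\<^sup>+x. ennreal (norm (t x)) \<partial>M) =
    ennreal (\<Sum>v\<in>t ` space M. norm (sbi M (\<lambda>x. indicat_real {x\<in>space M. t x = v} x *\<^sub>R t x)))"
proof -
  have nt: "simple_function M (\<lambda>x. norm (t x))" using t by (rule simple_function_compose1)
  have lev: "{x\<in>space M. t x = v} \<in> sets M" for v
    using simple_functionD(2)[OF t, of "{v}"] by (simp add: vimage_def Int_def conj_commute)
  have "(\<integral>\<^sup>+x. ennreal (norm (t x)) \<partial>M) = ennreal (sbi M (\<lambda>x. norm (t x)))"
    using nt by (intro Bochner_Integration.simple_bochner_integral_eq_nn_integral[symmetric])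
      (auto simp: simple_bochner_integrable_iff)
  also have "sbi M (\<lambda>x. norm (t x)) = (\<Sum>v\<in>t ` space M. measure M {x\<in>space M. t x = v} *\<^sub>R norm v)"
    using nt t by (intro Bochner_Integration.simple_bochner_integral_partition)
      (auto simp: simple_bochner_integrable_iff)
  also have "\<dots> = (\<Sum>v\<in>t ` space M. norm (sbi M (\<lambda>x. indicat_real {x\<in>space M. t x = v} x *\<^sub>R t x)))"
  proof (rule sum.cong[OF refl])
    fix v
    have "(\<lambda>x. indicat_real {x\<in>space M. t x = v} x *\<^sub>R t x) = (\<lambda>x. indicat_real {x\<in>space M. t x = v} x *\<^sub>R v)"
      by (auto simp: indicator_def)
    then show "measure M {x\<in>space M. t x = v} *\<^sub>R norm v =
        norm (sbi M (\<lambda>x. indicat_real {x\<in>space M. t x = v} x *\<^sub>R t x))"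
      by (simp add: simple_bochner_integral_indicator[OF lev])
  qed
  finally show ?thesis .
qed

end

section \<open>From local almost constancy to a Bochner density\<close>

context continuous_vector_measure begin

text \<open>Exhaust the space by sets \<open>B i\<close> on which \<open>G\<close> has almost
  constant density \<open>y i\<close>, and truncate the resulting countably valued function; finite
  variation makes the discarded tail small. The error is summed over disjoint families because the
  error on single sets would not control an L1 norm.\<close>

lemma approx_by_simple:
  assumes V: "variation M G (space M) < \<infinity>"
    and loc: "\<And>A \<epsilon>. A \<in> sets M \<Longrightarrow> measure M A > 0 \<Longrightarrow> \<epsilon> > 0 \<Longrightarrow>
      \<exists>B\<in>sets M. B \<subseteq> A \<and> measure M B > 0 \<and>
        (\<exists>y. \<forall>E\<in>sets M. E \<subseteq> B \<longrightarrow> norm (G E - measure M E *\<^sub>R y) \<le> \<epsilon> * measure M E)"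
    and \<epsilon>: "\<epsilon> > 0"
  obtains s where "simple_function M s"
    "\<And>(I::'i set) E. finite I \<Longrightarrow> disjoint_family_on E I \<Longrightarrow> (\<And>i. i \<in> I \<Longrightarrow> E i \<in> sets M) \<Longrightarrow>
      (\<Sum>i\<in>I. norm (G (E i) - sbi M (\<lambda>x. indicat_real (E i) x *\<^sub>R s x))) \<le> \<epsilon>"
proof -
  define \<mu> where "\<mu> = measure M (space M)"
  have \<mu>: "\<mu> \<ge> 0" by (simp add: \<mu>_def)
  \<comment> \<open>Half of \<open>\<epsilon>\<close> pays for the errors inside the
    \<open>B i\<close>, the other half for the tail; the \<open>+ 1\<close> guards against division
    by zero over a null space.\<close>
  define e where "e = \<epsilon> / (2 * (\<mu> + 1))"
  have e: "e > 0" using \<epsilon> \<mu> by (simp add: e_def)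
  have e\<mu>: "e * \<mu> \<le> \<epsilon> / 2" using \<epsilon> \<mu> by (simp add: e_def field_simps)
  define P where "P B \<longleftrightarrow> (\<exists>y. \<forall>E\<in>sets M. E \<subseteq> B \<longrightarrow> norm (G E - measure M E *\<^sub>R y) \<le> e * measure M E)" for B
  have "P {}" by (auto simp: P_def)
  moreover have "\<exists>B\<in>sets M. B \<subseteq> A \<and> measure M B > 0 \<and> P B" if "A \<in> sets M" "measure M A > 0" for A
    unfolding P_def using loc[OF that e] .
  ultimately obtain B :: "nat \<Rightarrow> 'w set" where B: "disjoint_family B" "\<And>i. B i \<in> sets M"
    "\<And>i. P (B i)" "measure M (space M - (\<Union>i. B i)) = 0"
    using exhaustion[of "space M" P, OF sets.top] by metis
  from B(3) obtain y where y: "\<And>i E. E \<in> sets M \<Longrightarrow> E \<subseteq> B i \<Longrightarrow>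
      norm (G E - measure M E *\<^sub>R y i) \<le> e * measure M E"
    unfolding P_def by metis
  have dis_lt: "disjoint_family_on B {..<n}" for n by (rule disjoint_family_on_mono[OF _ B(1)]) simp
  have sumB: "(\<Sum>i<n. measure M (B i)) \<le> \<mu>" for n
  proof -
    have "B ` {..<n} \<subseteq> sets M" using B(2) by blast
    then show ?thesis
      using finite_measure_finite_Union[of "{..<n}" B] dis_lt bounded_measure[of "\<Union>i<n. B i"]
      by (simp add: \<mu>_def)
  qed
  define v where "v = enn2real (variation M G (space M))"
  have v: "variation M G (space M) = ennreal v" "v \<ge> 0" using V by (simp_all add: v_def)
  \<comment> \<open>Each term is at most \<open>norm (G (B i)) + e * measure M (B i)\<close>; the
    first part is summable by finite variation, the second by finite measure.\<close>
  have summ: "summable (\<lambda>i. norm (y i) * measure M (B i))"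
  proof (rule summableI_nonneg_bounded)
    fix n
    have "ennreal (\<Sum>i<n. norm (G (B i))) \<le> ennreal v"
      unfolding v(1)[symmetric] using B(2) dis_lt by (intro sum_norm_le_variation) auto
    then have v2: "(\<Sum>i<n. norm (G (B i))) \<le> v" using v(2) by simp
    have "(\<Sum>i<n. norm (y i) * measure M (B i)) \<le> (\<Sum>i<n. norm (G (B i)) + e * measure M (B i))"
    proof (rule sum_mono)
      fix i
      have "norm (measure M (B i) *\<^sub>R y i) \<le> norm (G (B i)) + norm (G (B i) - measure M (B i) *\<^sub>R y i)"
        using norm_triangle_sub[of "measure M (B i) *\<^sub>R y i" "G (B i)"] by (simp add: norm_minus_commute)
      then show "norm (y i) * measure M (B i) \<le> norm (G (B i)) + e * measure M (B i)"
        using y[of "B i" i] B(2)[of i] by (simp add: mult.commute)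
    qed
    also have "\<dots> \<le> v + e * \<mu>"
      using v2 mult_left_mono[OF sumB[of n], of e] e by (simp add: sum.distrib sum_distrib_left)
    finally show "(\<Sum>i<n. norm (y i) * measure M (B i)) \<le> v + e * \<mu>" .
  qed simp
  then obtain k where k: "\<And>m n. m \<ge> k \<Longrightarrow> norm (\<Sum>i\<in>{m..<n}. norm (y i) * measure M (B i)) < \<epsilon> / 2"
    using \<epsilon> unfolding summable_Cauchy by (meson half_gt_zero)
  \<comment> \<open>\<open>z\<close> is \<open>y\<close> truncated at \<open>k\<close>, and
    \<open>c i\<close> is the resulting error rate on \<open>B i\<close>: from \<open>k\<close> on,
    the dropped value is charged in full.\<close>
  define z where "z i = (if i < k then y i else 0)" for i
  define c where "c i = e + (if i < k then 0 else norm (y i))" for i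
  have c: "c i \<ge> 0" for i using e by (simp add: c_def)
  have GB: "norm (G E - measure M E *\<^sub>R z i) \<le> c i * measure M E" if "E \<in> sets M" "E \<subseteq> B i" for E i
  proof (cases "i < k")
    case True
    then show ?thesis using y[OF that] by (simp add: z_def c_def)
  next
    case False
    have "norm (G E) \<le> norm (measure M E *\<^sub>R y i) + norm (G E - measure M E *\<^sub>R y i)"
      by (rule norm_triangle_sub)
    then show ?thesis using y[OF that] False by (simp add: z_def c_def algebra_simps)
  qed
  have sumc: "(\<Sum>i<n. c i * measure M (B i)) \<le> \<epsilon>" for n
  proof -
    have "(\<Sum>i<n. c i * measure M (B i)) =
       e * (\<Sum>i<n. measure M (B i)) + (\<Sum>i<n. if i < k then 0 else norm (y i) * measure M (B i))"
      unfolding sum_distrib_left sum.distrib[symmetric]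
      by (intro sum.cong) (auto simp: c_def algebra_simps)
    also have "(\<Sum>i<n. if i < k then 0 else norm (y i) * measure M (B i)) =
        (\<Sum>i\<in>{k..<n}. norm (y i) * measure M (B i))"
      by (intro sum.mono_neutral_cong_right) auto
    also have "e * (\<Sum>i<n. measure M (B i)) \<le> \<epsilon> / 2"
      using mult_left_mono[OF sumB[of n], of e] e e\<mu> by linarith
    also have "(\<Sum>i\<in>{k..<n}. norm (y i) * measure M (B i)) \<le> \<epsilon> / 2"
      using k[of k n] by simp
    finally show ?thesis by simp
  qed
  define s where "s x = (\<Sum>i<k. indicat_real (B i) x *\<^sub>R y i)" for x
  have int_s: "sbi M (\<lambda>x. indicat_real E x *\<^sub>R s x) = (\<Sum>i<k. measure M (E \<inter> B i) *\<^sub>R y i)"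
    if "E \<in> sets M" for E
    unfolding s_def using that B(2) by (rule simple_bochner_integral_UN_const(2)[rotated])
  have lim: "(\<lambda>n. \<Sum>i<n. G (E \<inter> B i) - measure M (E \<inter> B i) *\<^sub>R z i)
      \<longlonglongrightarrow> G E - sbi M (\<lambda>x. indicat_real E x *\<^sub>R s x)" if E: "E \<in> sets M" for E
  proof -
    have U: "E \<inter> (\<Union>i. B i) \<in> sets M" using E B(2) by auto
    have "measure M (E - (E \<inter> (\<Union>i. B i))) \<le> measure M (space M - (\<Union>i. B i))"
      using sets.sets_into_space[OF E] B(2) by (intro finite_measure_mono) auto
    then have "measure M (E - (E \<inter> (\<Union>i. B i))) = 0" using B(4) by (simp add: measure_le_0_iff)
    then have "G (E - (E \<inter> (\<Union>i. B i))) = 0" using E U by (intro G_null) auto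
    then have GE: "G E = G (\<Union>i. E \<inter> B i)" using G_Diff[OF E U] by simp
    have "(\<lambda>i. G (E \<inter> B i)) sums G E"
      unfolding GE using E B(1,2) by (intro sums_UN) (auto simp: disjoint_family_on_def)
    moreover have "(\<lambda>i. measure M (E \<inter> B i) *\<^sub>R z i) sums (\<Sum>i<k. measure M (E \<inter> B i) *\<^sub>R z i)"
      by (rule sums_finite) (auto simp: z_def)
    then have "(\<lambda>i. measure M (E \<inter> B i) *\<^sub>R z i) sums sbi M (\<lambda>x. indicat_real E x *\<^sub>R s x)"
      by (simp add: int_s[OF E] z_def)
    ultimately show ?thesis using sums_diff unfolding sums_def by blast
  qed
  show ?thesis
  proof (rule that[of s])
    show "simple_function M s"
      unfolding s_def by (rule simple_bochner_integral_UN_const(1)[OF B(2) sets.top])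
    fix I :: "'i set" and E
    assume I: "finite I" "disjoint_family_on E I" and Es: "\<And>i. i \<in> I \<Longrightarrow> E i \<in> sets M"
    show "(\<Sum>j\<in>I. norm (G (E j) - sbi M (\<lambda>x. indicat_real (E j) x *\<^sub>R s x))) \<le> \<epsilon>"
    \<comment> \<open>The error on \<open>E j\<close> is the limit of its errors on the first
      \<open>n\<close> pieces, so a bound for finite double sums, uniform in \<open>n\<close>, is
      enough.\<close>
    proof (rule LIMSEQ_le_const2)
      show "(\<lambda>n. \<Sum>j\<in>I. norm (\<Sum>i<n. G (E j \<inter> B i) - measure M (E j \<inter> B i) *\<^sub>R z i))
        \<longlonglongrightarrow> (\<Sum>j\<in>I. norm (G (E j) - sbi M (\<lambda>x. indicat_real (E j) x *\<^sub>R s x)))"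
        using lim Es by (intro tendsto_sum tendsto_norm) auto
      have "(\<Sum>j\<in>I. norm (\<Sum>i<n. G (E j \<inter> B i) - measure M (E j \<inter> B i) *\<^sub>R z i)) \<le> \<epsilon>" for n
      proof -
        have "(\<Sum>j\<in>I. norm (\<Sum>i<n. G (E j \<inter> B i) - measure M (E j \<inter> B i) *\<^sub>R z i))
           \<le> (\<Sum>j\<in>I. \<Sum>i<n. c i * measure M (E j \<inter> B i))"
          using Es B(2) by (intro sum_mono order_trans[OF norm_sum] GB) auto
        also have "\<dots> = (\<Sum>i<n. c i * (\<Sum>j\<in>I. measure M (E j \<inter> B i)))"
          by (subst sum.swap) (simp add: sum_distrib_left)
        also have "\<dots> \<le> (\<Sum>i<n. c i * measure M (B i))"
        proof (intro sum_mono mult_left_mono c)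
          fix i
          have "(\<Sum>j\<in>I. measure M (E j \<inter> B i)) = measure M (\<Union>j\<in>I. E j \<inter> B i)"
            using I Es B(2) by (intro finite_measure_finite_Union[symmetric]) (auto simp: disjoint_family_on_def)
          also have "\<dots> \<le> measure M (B i)"
            using B(2) by (intro finite_measure_mono) auto
          finally show "(\<Sum>j\<in>I. measure M (E j \<inter> B i)) \<le> measure M (B i)" .
        qed
        also have "\<dots> \<le> \<epsilon>" by (rule sumc)
        finally show ?thesis .
      qed
      then show "\<exists>N. \<forall>n\<ge>N. (\<Sum>j\<in>I. norm (\<Sum>i<n. G (E j \<inter> B i) - measure M (E j \<inter> B i) *\<^sub>R z i)) \<le> \<epsilon>"
        by blast
    qed
  qed
qed

text \<open>Applied to the level sets of \<open>s (Suc n) - s n\<close>, the hypothesis bounds the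
  L1 distance of consecutive approximants. With geometric errors they converge as in the proof that
  L1 is complete. The families are indexed by \<open>'y\<close> because level sets are named by
  their values.\<close>

lemma density_of_approx:
  assumes ap: "\<And>\<epsilon>. \<epsilon> > 0 \<Longrightarrow> \<exists>s. simple_function M s \<and>
    (\<forall>(I::'y set) E. finite I \<longrightarrow> disjoint_family_on E I \<longrightarrow> (\<forall>i\<in>I. E i \<in> sets M) \<longrightarrow>
      (\<Sum>i\<in>I. norm (G (E i) - sbi M (\<lambda>x. indicat_real (E i) x *\<^sub>R s x))) \<le> \<epsilon>)"
  shows "\<exists>g. Bochner_integrable M g \<and>
    (\<forall>E\<in>sets M. has_Bochner_integral M (\<lambda>x. indicat_real E x *\<^sub>R g x) (G E))"
proof -
  define q where "q n = (1 / 2 :: real) ^ n" for n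
  have q0: "q n > 0" for n by (simp add: q_def)
  define Q where "Q \<epsilon> s \<longleftrightarrow> simple_function M s \<and>
    (\<forall>(I::'y set) E. finite I \<longrightarrow> disjoint_family_on E I \<longrightarrow> (\<forall>i\<in>I. E i \<in> sets M) \<longrightarrow>
      (\<Sum>i\<in>I. norm (G (E i) - sbi M (\<lambda>x. indicat_real (E i) x *\<^sub>R s x))) \<le> \<epsilon>)" for \<epsilon> s
  have "\<forall>n. \<exists>s. Q (q n) s" using ap[OF q0] by (simp add: Q_def)
  then obtain s where Q: "\<And>n. Q (q n) (s n)" by metis
  have sf: "simple_function M (s n)" for n using Q by (simp add: Q_def)
  have s: "(\<Sum>i\<in>I. norm (G (E i) - sbi M (\<lambda>x. indicat_real (E i) x *\<^sub>R s n x))) \<le> q n"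
    if "finite I" "disjoint_family_on E I" "\<forall>i\<in>I. E i \<in> sets M" for n and I :: "'y set" and E
    using Q[of n] that by (simp add: Q_def)
  define d where "d n x = norm (s (Suc n) x - s n x)" for n x
  have sfd: "simple_function M (\<lambda>x. s (Suc n) x - s n x)" for n
    by (rule simple_function_diff'; rule sf)
  have dm [measurable]: "(\<lambda>x. d n x) \<in> borel_measurable M" for n
    unfolding d_def by (rule borel_measurable_simple_function, rule simple_function_compose1[OF sfd])
  have d_int: "(\<integral>\<^sup>+x. ennreal (d n x) \<partial>M) \<le> ennreal (2 * q n)" for n
  proof -
    define t where "t = (\<lambda>x. s (Suc n) x - s n x)"
    define L where "L v = {x\<in>space M. t x = v}" for v
    have L: "L v \<in> sets M" for v
      using simple_functionD(2)[OF sfd[of n], of "{v}"]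
      by (simp add: L_def t_def vimage_def Int_def conj_commute)
    have fin: "finite (t ` space M)" using simple_functionD(1)[OF sfd[of n]] by (simp add: t_def)
    have dL: "disjoint_family_on L (t ` space M)" by (auto simp: disjoint_family_on_def L_def)
    have "(\<integral>\<^sup>+x. ennreal (d n x) \<partial>M) =
       ennreal (\<Sum>v\<in>t ` space M. norm (sbi M (\<lambda>x. indicat_real (L v) x *\<^sub>R t x)))"
      using nn_integral_norm_simple[OF sfd[of n]] by (simp add: d_def t_def L_def)
    also have "(\<Sum>v\<in>t ` space M. norm (sbi M (\<lambda>x. indicat_real (L v) x *\<^sub>R t x))) \<le>
       (\<Sum>v\<in>t ` space M. norm (G (L v) - sbi M (\<lambda>x. indicat_real (L v) x *\<^sub>R s n x)) +
          norm (G (L v) - sbi M (\<lambda>x. indicat_real (L v) x *\<^sub>R s (Suc n) x)))"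
    proof (rule sum_mono)
      fix v
      have "sbi M (\<lambda>x. indicat_real (L v) x *\<^sub>R t x) =
        sbi M (\<lambda>x. indicat_real (L v) x *\<^sub>R s (Suc n) x) - sbi M (\<lambda>x. indicat_real (L v) x *\<^sub>R s n x)"
        unfolding t_def scaleR_diff_right
        by (intro Bochner_Integration.simple_bochner_integral_diff)
           (auto simp: simple_bochner_integrable_iff intro!: simple_function_indicator_scaleR L sf)
      then show "norm (sbi M (\<lambda>x. indicat_real (L v) x *\<^sub>R t x)) \<le>
          norm (G (L v) - sbi M (\<lambda>x. indicat_real (L v) x *\<^sub>R s n x)) +
          norm (G (L v) - sbi M (\<lambda>x. indicat_real (L v) x *\<^sub>R s (Suc n) x))"
        using norm_triangle_ineq4[of "G (L v) - sbi M (\<lambda>x. indicat_real (L v) x *\<^sub>R s n x)"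
           "G (L v) - sbi M (\<lambda>x. indicat_real (L v) x *\<^sub>R s (Suc n) x)"] by simp
    qed
    also have "\<dots> \<le> q n + q (Suc n)"
      unfolding sum.distrib using L by (intro add_mono s fin dL) auto
    also have "\<dots> \<le> 2 * q n" by (simp add: q_def)
    finally show ?thesis by (simp add: ennreal_leI)
  qed
  \<comment> \<open>A majorant of the distance from \<open>s n x\<close> to the limit: its integral
    bounds the L1 error, and being integrable it is finite almost everywhere.\<close>
  define T where "T n x = (\<Sum>i. ennreal (d (i + n) x))" for n x
  have Tm [measurable]: "T n \<in> borel_measurable M" for n unfolding T_def by measurable
  have T_int: "(\<integral>\<^sup>+x. T n x \<partial>M) \<le> ennreal (4 * q n)" for n
  proof -
    have "(\<integral>\<^sup>+x. T n x \<partial>M) = (\<Sum>i. \<integral>\<^sup>+x. ennreal (d (i + n) x) \<partial>M)"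
      unfolding T_def by (rule nn_integral_suminf) measurable
    also have "\<dots> \<le> (\<Sum>i. ennreal (2 * q (i + n)))"
      by (intro suminf_le d_int) auto
    also have "\<dots> = ennreal (4 * q n)"
    proof (rule sums_unique[symmetric], rule sums_ennreal[THEN iffD2])
      have "(\<lambda>i. (2 * q n) * (1 / 2) ^ i) sums ((2 * q n) * (1 / (1 - 1 / 2)))"
        by (intro sums_mult geometric_sums) simp
      then show "(\<lambda>i. 2 * q (i + n)) sums (4 * q n)"
        by (simp add: q_def power_add mult_ac)
    qed (auto simp: q_def)
    finally show ?thesis .
  qed
  define D where "D = {x\<in>space M. T 0 x \<noteq> \<infinity>}"
  have D [measurable]: "D \<in> sets M" unfolding D_def by measurable
  have "(\<integral>\<^sup>+x. T 0 x \<partial>M) \<noteq> \<infinity>" using T_int[of 0] by (auto simp: top_unique)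
  then have AED: "AE x in M. x \<in> D"
    using nn_integral_PInf_AE[OF Tm] AE_space by (auto simp: D_def elim: eventually_mono)
  \<comment> \<open>Strong measurability demands convergence at every point, so the limit is
    replaced by 0 off \<open>D\<close>; the approximants are cut off there as well.\<close>
  define g where "g x = (if x \<in> D then lim (\<lambda>n. s n x) else 0)" for x
  have conv: "(\<lambda>n. s n x) \<longlonglongrightarrow> g x" and tail: "ennreal (norm (g x - s n x)) \<le> T n x" if x: "x \<in> D" for x n
  proof -
    have sm: "summable (\<lambda>i. d i x)"
      using x by (intro summable_suminf_not_top) (auto simp: D_def T_def d_def)
    then have sm': "summable (\<lambda>i. s (Suc i) x - s i x)"
      unfolding d_def by (rule summable_norm_cancel)
    then have "(\<lambda>n. (\<Sum>i<n. s (Suc i) x - s i x) + s 0 x) \<longlonglongrightarrow> (\<Sum>i. s (Suc i) x - s i x) + s 0 x"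
      by (intro tendsto_intros summable_LIMSEQ)
    moreover have "(\<Sum>i<n. s (Suc i) x - s i x) + s 0 x = s n x" for n
      by (simp add: sum_lessThan_telescope[of "\<lambda>i. s i x"])
    ultimately have "convergent (\<lambda>n. s n x)" by (auto simp: convergent_def)
    then show cv: "(\<lambda>n. s n x) \<longlonglongrightarrow> g x" using x by (simp add: g_def convergent_LIMSEQ_iff)
    have "(\<lambda>i. s (Suc (i + n)) x - s (i + n) x) sums (g x - s (0 + n) x)"
      using telescope_sums[of "\<lambda>i. s (i + n) x"] LIMSEQ_ignore_initial_segment[OF cv] by simp
    then have "g x - s n x = (\<Sum>i. s (Suc (i + n)) x - s (i + n) x)" by (simp add: sums_iff)
    also have "norm \<dots> \<le> (\<Sum>i. d (i + n) x)"
      unfolding d_def using summable_ignore_initial_segment[OF sm, of n]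
      by (intro summable_norm) (simp add: d_def)
    finally have "ennreal (norm (g x - s n x)) \<le> ennreal (\<Sum>i. d (i + n) x)" by (rule ennreal_leI)
    also have "\<dots> = T n x"
      unfolding T_def using summable_ignore_initial_segment[OF sm, of n]
      by (intro suminf_ennreal2[symmetric]) (auto simp: d_def)
    finally show "ennreal (norm (g x - s n x)) \<le> T n x" .
  qed
  have main: "has_Bochner_integral M (\<lambda>x. indicat_real E x *\<^sub>R g x) (G E)" if E: "E \<in> sets M" for E
    unfolding has_Bochner_integral_def
  proof (intro conjI exI allI)
    show "strongly_measurable M (\<lambda>x. indicat_real E x *\<^sub>R g x)"
      unfolding strongly_measurable_def
    proof (intro exI conjI allI ballI)
      show "simple_function M (\<lambda>x. indicat_real E x *\<^sub>R indicat_real D x *\<^sub>R s i x)" for i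
        by (intro simple_function_indicator_scaleR E D sf)
      show "(\<lambda>i. indicat_real E x *\<^sub>R indicat_real D x *\<^sub>R s i x) \<longlonglongrightarrow> indicat_real E x *\<^sub>R g x" for x
        using conv[of x] by (cases "x \<in> D") (auto simp: g_def intro!: tendsto_intros)
    qed
    show "Bochner_Integration.simple_bochner_integrable M (\<lambda>x. indicat_real E x *\<^sub>R s i x)" for i
      by (simp add: simple_bochner_integrable_iff simple_function_indicator_scaleR E sf)
    show "(\<lambda>i. \<integral>\<^sup>+x. ennreal (norm (indicat_real E x *\<^sub>R g x - indicat_real E x *\<^sub>R s i x)) \<partial>M) \<longlonglongrightarrow> 0"
    proof (rule tendsto_sandwich[of "\<lambda>_. 0" _ _ "\<lambda>i. ennreal (4 * q i)"])
      have "(\<integral>\<^sup>+x. ennreal (norm (indicat_real E x *\<^sub>R g x - indicat_real E x *\<^sub>R s i x)) \<partial>M) \<le> ennreal (4 * q i)" for i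
      proof -
        have "(\<integral>\<^sup>+x. ennreal (norm (indicat_real E x *\<^sub>R g x - indicat_real E x *\<^sub>R s i x)) \<partial>M) \<le> (\<integral>\<^sup>+x. T i x \<partial>M)"
        proof (rule nn_integral_mono_AE, use AED in eventually_elim)
          fix x assume "x \<in> D"
          then show "ennreal (norm (indicat_real E x *\<^sub>R g x - indicat_real E x *\<^sub>R s i x)) \<le> T i x"
            using tail[of x i] by (cases "x \<in> E") auto
        qed
        then show ?thesis using T_int[of i] by (rule order_trans)
      qed
      then show "\<forall>\<^sub>F i in sequentially.
        (\<integral>\<^sup>+x. ennreal (norm (indicat_real E x *\<^sub>R g x - indicat_real E x *\<^sub>R s i x)) \<partial>M) \<le> ennreal (4 * q i)"
        by simp
      have "(\<lambda>i. ennreal (4 * q i)) \<longlonglongrightarrow> ennreal (4 * 0)"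
        unfolding q_def by (intro tendsto_intros LIMSEQ_power_zero) auto
      then show "(\<lambda>i. ennreal (4 * q i)) \<longlonglongrightarrow> 0" by simp
    qed auto
    show "(\<lambda>i. sbi M (\<lambda>x. indicat_real E x *\<^sub>R s i x)) \<longlonglongrightarrow> G E"
    proof (rule LIM_zero_cancel, rule Lim_null_comparison)
      show "\<forall>\<^sub>F i in sequentially. norm (sbi M (\<lambda>x. indicat_real E x *\<^sub>R s i x) - G E) \<le> q i"
        \<comment> \<open>A family with one member turns the summed error into the error on
          \<open>E\<close>.\<close>
        using s[of "{0}" "\<lambda>_. E"] E by (auto simp: norm_minus_commute disjoint_family_on_def)
      show "q \<longlonglongrightarrow> 0" unfolding q_def by (intro LIMSEQ_power_zero) auto
    qed
  qed
  have "has_Bochner_integral M g (G (space M))"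
    using main[of "space M"] has_Bochner_integral_cong[of M "\<lambda>x. indicat_real (space M) x *\<^sub>R g x" g] by simp
  then show ?thesis using main unfolding Bochner_integrable_def by blast
qed

end

section \<open>Bushes and nowhere differentiable Lipschitz maps\<close>

text \<open>The failure of local almost constancy, inside a set where averages are bounded. Since
  \<open>osc\<close> holds for every \<open>y\<close>, it can be applied to the current average at
  each node of the tree.\<close>

locale bush = continuous_vector_measure M G
  for M :: "'w measure" and G :: "'w set \<Rightarrow> 'y::banach" +
  fixes A :: "'w set" and C \<epsilon> :: real
  assumes A: "A \<in> sets M" "measure M A > 0"
    and bound: "\<And>E. E \<in> sets M \<Longrightarrow> E \<subseteq> A \<Longrightarrow> norm (G E) \<le> C * measure M E"
    and \<epsilon>: "\<epsilon> > 0"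
    and osc: "\<And>B y. B \<in> sets M \<Longrightarrow> B \<subseteq> A \<Longrightarrow> measure M B > 0 \<Longrightarrow>
      \<exists>E\<in>sets M. E \<subseteq> B \<and> \<epsilon> * measure M E < norm (G E - measure M E *\<^sub>R y)"
begin

definition avg :: "'w set \<Rightarrow> 'y" where "avg B = (1 / measure M B) *\<^sub>R G B"

definition far :: "'w set \<Rightarrow> 'w set \<Rightarrow> bool" where
  "far B E \<longleftrightarrow> \<epsilon> * measure M E < norm (G E - measure M E *\<^sub>R avg B)"

text \<open>The factor 2 is what \<open>greedy_subset\<close> delivers, and this near-maximality
  will force the cells to shrink. Below a null \<open>B\<close> an arbitrary measurable subset is
  taken, so that the tree never stops.\<close>

definition child :: "'w set \<Rightarrow> 'w set" where
  "child B = (SOME E. E \<in> sets M \<and> E \<subseteq> B \<and> (measure M B > 0 \<longrightarrow> far B E \<and>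
     (\<forall>E'\<in>sets M. E' \<subseteq> B \<longrightarrow> far B E' \<longrightarrow> measure M E' \<le> 2 * measure M E)))"

lemma child:
  assumes "B \<in> sets M" "B \<subseteq> A"
  shows "child B \<in> sets M" "child B \<subseteq> B" "measure M B > 0 \<Longrightarrow> far B (child B)"
    "\<And>E'. measure M B > 0 \<Longrightarrow> E' \<in> sets M \<Longrightarrow> E' \<subseteq> B \<Longrightarrow> far B E' \<Longrightarrow> measure M E' \<le> 2 * measure M (child B)"
proof -
  have "\<exists>E. E \<in> sets M \<and> E \<subseteq> B \<and> (measure M B > 0 \<longrightarrow> far B E \<and>
     (\<forall>E'\<in>sets M. E' \<subseteq> B \<longrightarrow> far B E' \<longrightarrow> measure M E' \<le> 2 * measure M E))"
  proof (cases "measure M B > 0")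
    case True
    then obtain E0 where "E0 \<in> sets M" "E0 \<subseteq> B" "far B E0"
      using osc[OF assms, of "avg B"] by (auto simp: far_def)
    then obtain E where "E \<in> sets M" "E \<subseteq> B" "far B E"
      "\<And>E'. E' \<in> sets M \<Longrightarrow> E' \<subseteq> B \<Longrightarrow> far B E' \<Longrightarrow> measure M E' \<le> 2 * measure M E"
      using greedy_subset[of E0 B "far B"] by metis
    then show ?thesis by blast
  qed auto
  from someI_ex[OF this, folded child_def]
  show "child B \<in> sets M" "child B \<subseteq> B" "measure M B > 0 \<Longrightarrow> far B (child B)"
    "\<And>E'. measure M B > 0 \<Longrightarrow> E' \<in> sets M \<Longrightarrow> E' \<subseteq> B \<Longrightarrow> far B E' \<Longrightarrow> measure M E' \<le> 2 * measure M (child B)"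
    by auto
qed

lemma far_pos: "far B E \<Longrightarrow> E \<in> sets M \<Longrightarrow> measure M E > 0"
  using G_null[of E] by (auto simp: far_def zero_less_measure_iff)

lemma measure_diff_child:
  assumes "B \<in> sets M" "B \<subseteq> A"
  shows "measure M (B - child B) = measure M B - measure M (child B)"
  using child[OF assms] assms by (intro finite_measure_Diff) auto

lemma G_diff_child:
  assumes "B \<in> sets M" "B \<subseteq> A"
  shows "G (B - child B) = G B - G (child B)"
  using child[OF assms] assms by (intro G_Diff) auto

primrec node :: "bool list \<Rightarrow> 'w set \<Rightarrow> 'w set" where
  "node [] B = B"
| "node (b # w) B = node w (if b then child B else B - child B)"

text \<open>Laying the leaves of the tree side by side turns the node \<open>w\<close> below \<open>B\<close> into an interval of
  length \<open>\<mu> (node w B)\<close>; \<open>pos e w B\<close> is its left (\<open>e = False\<close>) or right (\<open>e = True\<close>) endpoint, and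
  \<open>val e w B\<close> is the value of the Lipschitz function there.\<close>

primrec pos :: "bool \<Rightarrow> bool list \<Rightarrow> 'w set \<Rightarrow> real" where
  "pos e [] B = (if e then measure M B else 0)"
| "pos e (b # w) B = (if b then pos e w (child B) else measure M (child B) + pos e w (B - child B))"

primrec val :: "bool \<Rightarrow> bool list \<Rightarrow> 'w set \<Rightarrow> 'y" where
  "val e [] B = (if e then G B else 0)"
| "val e (b # w) B = (if b then val e w (child B) else G (child B) + val e w (B - child B))"

lemma C_nonneg: "C \<ge> 0"
proof -
  have "0 \<le> C * measure M A" using bound[OF A(1) subset_refl] norm_ge_zero[of "G A"] by linarith
  then show ?thesis using A(2) by (simp add: zero_le_mult_iff)
qed

text \<open>Both ends are needed: a comparison across a split measures the left point from the right
  end of its half and the right point from the left end of its half.\<close>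

lemma pos_val_bounds:
  assumes "B \<in> sets M" "B \<subseteq> A"
  shows "0 \<le> pos e w B \<and> pos e w B \<le> measure M B \<and> norm (val e w B) \<le> C * pos e w B \<and>
    norm (G B - val e w B) \<le> C * (measure M B - pos e w B)"
  using assms
proof (induction w arbitrary: B)
  case Nil
  then show ?case using bound[of B] by simp
next
  case (Cons b w)
  note c = child[OF Cons.prems] and d = measure_diff_child[OF Cons.prems] G_diff_child[OF Cons.prems]
  have bc: "norm (G (child B)) \<le> C * measure M (child B)"
    "norm (G (B - child B)) \<le> C * (measure M B - measure M (child B))"
    using bound[of "child B"] bound[of "B - child B"] c Cons.prems d by auto
  show ?case
  proof (cases b)
    case True
    have IH: "0 \<le> pos e w (child B)" "pos e w (child B) \<le> measure M (child B)"
        "norm (val e w (child B)) \<le> C * pos e w (child B)"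
        "norm (G (child B) - val e w (child B)) \<le> C * (measure M (child B) - pos e w (child B))"
      using Cons.IH[of "child B"] c Cons.prems by auto
    have "G B - val e w (child B) = (G (child B) - val e w (child B)) + G (B - child B)" using d by simp
    then have "norm (G B - val e w (child B)) \<le> C * (measure M B - pos e w (child B))"
      using norm_triangle_ineq[of "G (child B) - val e w (child B)" "G (B - child B)"] IH bc
      by (simp add: algebra_simps)
    moreover have "measure M (child B) \<le> measure M B" using c Cons.prems by (intro finite_measure_mono)
    ultimately show ?thesis using IH True by simp
  next
    case False
    have IH: "0 \<le> pos e w (B - child B)" "pos e w (B - child B) \<le> measure M (B - child B)"
        "norm (val e w (B - child B)) \<le> C * pos e w (B - child B)"
        "norm (G (B - child B) - val e w (B - child B)) \<le> C * (measure M (B - child B) - pos e w (B - child B))"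
      using Cons.IH[of "B - child B"] c Cons.prems by auto
    then show ?thesis
      using norm_triangle_ineq[of "G (child B)" "val e w (B - child B)"] bc d False
      by (simp add: algebra_simps)
  qed
qed

text \<open>Follow both words until they part, then go through the common endpoint of the two
  halves, where the value is \<open>G (child B)\<close>; distances add there because the halves lie
  in order. In particular, equal positions carry equal values.\<close>

lemma val_lipschitz:
  assumes "B \<in> sets M" "B \<subseteq> A"
  shows "norm (val e w B - val e' w' B) \<le> C * \<bar>pos e w B - pos e' w' B\<bar>"
  using assms
proof (induction w arbitrary: w' B)
  case Nil
  then show ?case using pos_val_bounds[OF Nil, of e' w'] by (cases e) auto
next
  case (Cons b w)
  note c = child[OF Cons.prems] and d = measure_diff_child[OF Cons.prems] G_diff_child[OF Cons.prems]
  have cB: "child B \<in> sets M" "child B \<subseteq> A" "B - child B \<in> sets M" "B - child B \<subseteq> A"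
    using c Cons.prems by auto
  show ?case
  proof (cases w')
    case Nil
    then show ?thesis using pos_val_bounds[OF Cons.prems, of e "b # w"]
      by (cases e') (auto simp: norm_minus_commute)
  next
    case (Cons b' v)
    consider "b" "b'" | "\<not> b" "\<not> b'" | "b" "\<not> b'" | "\<not> b" "b'" by blast
    then show ?thesis
    proof cases
      case 1
      then show ?thesis using Cons Cons.IH[OF cB(1,2), of v] by simp
    next
      case 2
      then show ?thesis using Cons Cons.IH[OF cB(3,4), of v] by simp
    next
      case 3
      have "norm (val e w (child B) - (G (child B) + val e' v (B - child B))) \<le>
          norm (G (child B) - val e w (child B)) + norm (val e' v (B - child B))"
        using norm_triangle_ineq[of "G (child B) - val e w (child B)" "val e' v (B - child B)"]
        by (simp add: norm_minus_commute algebra_simps)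
      also have "\<dots> \<le> C * (measure M (child B) + pos e' v (B - child B) - pos e w (child B))"
        using pos_val_bounds[OF cB(1,2), of e w] pos_val_bounds[OF cB(3,4), of e' v] by (simp add: algebra_simps)
      finally show ?thesis
        using 3 Cons pos_val_bounds[OF cB(1,2), of e w] pos_val_bounds[OF cB(3,4), of e' v] by simp
    next
      case 4
      have "norm (G (child B) + val e w (B - child B) - val e' v (child B)) \<le>
          norm (G (child B) - val e' v (child B)) + norm (val e w (B - child B))"
        using norm_triangle_ineq[of "G (child B) - val e' v (child B)" "val e w (B - child B)"]
        by (simp add: algebra_simps)
      also have "\<dots> \<le> C * (measure M (child B) + pos e w (B - child B) - pos e' v (child B))"
        using pos_val_bounds[OF cB(1,2), of e' v] pos_val_bounds[OF cB(3,4), of e w] by (simp add: algebra_simps)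
      finally show ?thesis
        using 4 Cons pos_val_bounds[OF cB(1,2), of e' v] pos_val_bounds[OF cB(3,4), of e w] by simp
    qed
  qed
qed

text \<open>Dividing the last two identities, the slope over the interval of a non-null node is the
  average of that node.\<close>

lemma node:
  assumes "B \<in> sets M" "B \<subseteq> A"
  shows "node w B \<in> sets M \<and> node w B \<subseteq> B \<and>
    pos True w B = pos False w B + measure M (node w B) \<and> val True w B = val False w B + G (node w B)"
  using assms
proof (induction w arbitrary: B)
  case (Cons b w)
  have c: "child B \<in> sets M" "child B \<subseteq> A" "B - child B \<in> sets M" "B - child B \<subseteq> A" "child B \<subseteq> B"
    using child[OF Cons.prems] Cons.prems by auto
  show ?case
  proof (cases b)
    case True
    then show ?thesis using Cons.IH[OF c(1,2)] c(5) by auto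
  next
    case False
    then show ?thesis using Cons.IH[OF c(3,4)] by auto
  qed
qed simp

text \<open>The recursions for \<open>node\<close> and \<open>pos\<close> peel words at the root,
  whereas the path of a point grows at the leaf.\<close>

lemma node_snoc:
  assumes "B \<in> sets M" "B \<subseteq> A"
  shows "node (w @ [b]) B = (if b then child (node w B) else node w B - child (node w B)) \<and>
    pos False (w @ [b]) B = pos False w B + (if b then 0 else measure M (child (node w B)))"
  using assms
proof (induction w arbitrary: B)
  case (Cons a w)
  have c: "child B \<in> sets M" "child B \<subseteq> A" "B - child B \<in> sets M" "B - child B \<subseteq> A"
    using child[OF Cons.prems] Cons.prems by auto
  show ?case
  proof (cases a)
    case True
    then show ?thesis using Cons.IH[OF c(1,2)] by simp
  next
    case False
    then show ?thesis using Cons.IH[OF c(3,4)] by simp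
  qed
qed simp

text \<open>Binary search for \<open>x\<close>. The strict comparison makes the intervals closed on
  the left and open on the right.\<close>

primrec branch :: "real \<Rightarrow> nat \<Rightarrow> bool list" where
  "branch x 0 = []"
| "branch x (Suc n) = branch x n @ [x < pos False (branch x n) A + measure M (child (node (branch x n) A))]"

abbreviation cell :: "real \<Rightarrow> nat \<Rightarrow> 'w set" where "cell x n \<equiv> node (branch x n) A"

lemmas nodeA = node[OF A(1) subset_refl] and node_snocA = node_snoc[OF A(1) subset_refl]

lemma cell: "cell x n \<in> sets M" "cell x n \<subseteq> A"
  using nodeA by auto

lemma branch_bounds:
  assumes "0 \<le> x" "x < measure M A"
  shows "pos False (branch x n) A \<le> x \<and> x < pos True (branch x n) A"
proof (induction n)
  case 0
  then show ?case using assms by simp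
next
  case (Suc n)
  define b where "b = (x < pos False (branch x n) A + measure M (child (cell x n)))"
  have S: "branch x (Suc n) = branch x n @ [b]" by (simp add: b_def)
  note s = node_snocA[of "branch x n" b]
  show ?case
    using Suc nodeA[of "branch x n"] nodeA[of "branch x n @ [b]"] s measure_diff_child[OF cell, of x n]
    unfolding S by (cases b) (auto simp: b_def)
qed

lemma cell_pos: "0 \<le> x \<Longrightarrow> x < measure M A \<Longrightarrow> measure M (cell x n) > 0"
  using branch_bounds[of x n] nodeA[of "branch x n"] by simp

lemma cell_Suc:
  "cell x (Suc n) = (if x < pos False (branch x n) A + measure M (child (cell x n))
     then child (cell x n) else cell x n - child (cell x n))"
  using node_snocA by simp

lemma decseq_cell: "decseq (cell x)"
  unfolding decseq_Suc_iff using cell_Suc child(2)[OF cell] by auto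

lemma avg_child:
  assumes "B \<in> sets M" "B \<subseteq> A" "measure M B > 0"
  shows "\<epsilon> < norm (avg (child B) - avg B)"
proof -
  note c = child[OF assms(1,2)]
  have p: "measure M (child B) > 0" using far_pos[OF c(3)[OF assms(3)] c(1)] .
  have "G (child B) - measure M (child B) *\<^sub>R avg B = measure M (child B) *\<^sub>R (avg (child B) - avg B)"
    using p by (simp add: avg_def scaleR_diff_right)
  then have "\<epsilon> * measure M (child B) < measure M (child B) * norm (avg (child B) - avg B)"
    using c(3)[OF assms(3)] by (simp add: far_def)
  then show ?thesis using p by (simp add: mult.commute)
qed

text \<open>If the intersection \<open>R\<close> were non-null, the averages of the cells would
  converge to \<open>avg R\<close>, so from some stage on the path enters no child. Each child that
  it avoids has at least half the measure of a fixed far subset \<open>E\<close> of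
  \<open>R\<close>, and the cells cannot go on losing that much.\<close>

lemma cell_tendsto_0:
  assumes x: "0 \<le> x" "x < measure M A"
  shows "(\<lambda>n. measure M (cell x n)) \<longlonglongrightarrow> 0"
proof -
  define R where "R = (\<Inter>n. cell x n)"
  have Rc: "R \<subseteq> cell x n" for n by (auto simp: R_def)
  have Rs: "R \<in> sets M" "R \<subseteq> A" "\<And>n. R \<subseteq> cell x n"
    using cell Rc unfolding R_def by (auto intro!: sets.countable_INT' order_trans[OF Rc[of 0, unfolded R_def]])
  have lim: "(\<lambda>n. measure M (cell x n)) \<longlonglongrightarrow> measure M R"
    unfolding R_def using cell decseq_cell by (intro finite_Lim_measure_decseq) auto
  have "measure M R = 0"
  proof (rule ccontr)
    assume "measure M R \<noteq> 0"
    then have R0: "measure M R > 0" by (simp add: zero_less_measure_iff)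
    \<comment> \<open>The bound of \<open>G\<close> by the measure makes it continuous along the
      decreasing cells.\<close>
    have "(\<lambda>n. G (cell x n)) \<longlonglongrightarrow> G R"
    proof (rule LIM_zero_cancel, rule Lim_null_comparison)
      show "\<forall>\<^sub>F n in sequentially. norm (G (cell x n) - G R) \<le> C * (measure M (cell x n) - measure M R)"
      proof (intro always_eventually allI)
        fix n
        have "norm (G (cell x n - R)) \<le> C * measure M (cell x n - R)"
          using cell[of x n] Rs by (intro bound) auto
        then show "norm (G (cell x n) - G R) \<le> C * (measure M (cell x n) - measure M R)"
          using cell[of x n] Rs by (simp add: G_Diff finite_measure_Diff)
      qed
      show "(\<lambda>n. C * (measure M (cell x n) - measure M R)) \<longlonglongrightarrow> 0"
        using tendsto_mult[OF tendsto_const[of C] tendsto_diff[OF lim tendsto_const[of "measure M R"]]] by simp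
    qed
    then have av: "(\<lambda>n. avg (cell x n)) \<longlonglongrightarrow> avg R"
      unfolding avg_def using lim R0 by (intro tendsto_intros) auto
    obtain E where E: "E \<in> sets M" "E \<subseteq> R" "\<epsilon> * measure M E < norm (G E - measure M E *\<^sub>R avg R)"
      using osc[OF Rs(1,2) R0, of "avg R"] by blast
    have Ep: "measure M E > 0" using far_pos[of R E] E by (simp add: far_def)
    \<comment> \<open>Being far is a strict inequality, so it persists when \<open>avg R\<close> is
      replaced by the averages of late cells.\<close>
    have "(\<lambda>n. norm (G E - measure M E *\<^sub>R avg (cell x n))) \<longlonglongrightarrow> norm (G E - measure M E *\<^sub>R avg R)"
      by (intro tendsto_intros av)
    then have e1: "\<forall>\<^sub>F n in sequentially. far (cell x n) E"
      unfolding far_def using order_tendstoD(1)[OF _ E(3)] by blast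
    have "(\<lambda>n. norm (avg (cell x (Suc n)) - avg (cell x n))) \<longlonglongrightarrow> norm (avg R - avg R)"
      by (intro tendsto_intros av LIMSEQ_Suc)
    then have e2: "\<forall>\<^sub>F n in sequentially. norm (avg (cell x (Suc n)) - avg (cell x n)) < \<epsilon>"
      using order_tendstoD(2)[of _ 0 sequentially \<epsilon>] \<epsilon> by simp
    have "(\<lambda>n. measure M (cell x n) - measure M (cell x (Suc n))) \<longlonglongrightarrow> measure M R - measure M R"
      by (intro tendsto_intros lim LIMSEQ_Suc)
    from order_tendstoD(2)[OF this, of "measure M E / 2"]
    have e3: "\<forall>\<^sub>F n in sequentially. measure M (cell x n) - measure M (cell x (Suc n)) < measure M E / 2"
      using Ep by (simp del: branch.simps)
    have "\<forall>\<^sub>F n in sequentially. False"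
      using e1 e2 e3
    proof eventually_elim
      fix n
      assume far: "far (cell x n) E" and near: "norm (avg (cell x (Suc n)) - avg (cell x n)) < \<epsilon>"
        and small: "measure M (cell x n) - measure M (cell x (Suc n)) < measure M E / 2"
      have "cell x (Suc n) \<noteq> child (cell x n)"
        using near avg_child[OF cell cell_pos[OF x], of n] by auto
      then have S: "cell x (Suc n) = cell x n - child (cell x n)" using cell_Suc by metis
      have "measure M E \<le> 2 * measure M (child (cell x n))"
        using child(4)[OF cell cell_pos[OF x] E(1) _ far] E(2) Rs(3)[of n] by auto
      then show False using small unfolding S measure_diff_child[OF cell] by simp
    qed
    then show False by simp
  qed
  with lim show ?thesis by simp
qed

text \<open>A path that turns right forever keeps its right endpoint. Since the cells shrink, this
  endpoint could not lie beyond \<open>x\<close>, yet the intervals are open on the right.\<close>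

lemma infinitely_many_children:
  assumes x: "0 \<le> x" "x < measure M A"
  shows "\<exists>n\<ge>N. cell x (Suc n) = child (cell x n)"
proof (rule ccontr)
  assume "\<not> ?thesis"
  then have neg: "\<not> x < pos False (branch x n) A + measure M (child (cell x n))" if "n \<ge> N" for n
    using that cell_Suc[of x n] by presburger
  have const: "pos True (branch x n) A = pos True (branch x N) A" if "n \<ge> N" for n
    using that
  proof (induction n rule: dec_induct)
    case (step n)
    have "branch x (Suc n) = branch x n @ [False]" using neg[OF step(1)] by simp
    then show ?case
      using step.IH nodeA[of "branch x n"] nodeA[of "branch x n @ [False]"] node_snocA[of "branch x n" False]
        measure_diff_child[OF cell, of x n] by simp
  qed simp
  have "pos True (branch x N) A \<le> x + measure M (cell x n)" if "n \<ge> N" for n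
    using branch_bounds[OF x, of n] nodeA[of "branch x n"] const[OF that] by linarith
  moreover have "(\<lambda>n. x + measure M (cell x n)) \<longlonglongrightarrow> x + 0"
    by (intro tendsto_intros cell_tendsto_0[OF x])
  ultimately have "pos True (branch x N) A \<le> x + 0" by (intro LIMSEQ_le_const) auto
  with branch_bounds[OF x, of N] show False by simp
qed

text \<open>Prescribe the values at all interval endpoints and extend. Whenever the path of
  \<open>x\<close> enters a child, the intervals of the cell and of its child both contain
  \<open>x\<close>, and their slopes are the two averages, which are more than
  \<open>\<epsilon>\<close> apart; this happens at arbitrarily small scales.\<close>

lemma ex_nowhere_differentiable:
  obtains f :: "real \<Rightarrow> 'y" where "C-lipschitz_on UNIV f" "f 0 = 0"
    "\<And>x. x \<le> 0 \<Longrightarrow> f x = f 0" "\<And>x. x \<ge> measure M A \<Longrightarrow> f x = f (measure M A)"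
    "\<And>x \<eta>. 0 \<le> x \<Longrightarrow> x < measure M A \<Longrightarrow> \<eta> > 0 \<Longrightarrow>
      \<exists>a b a' b'. a \<le> x \<and> x < b \<and> b < a + \<eta> \<and> a' \<le> x \<and> x < b' \<and> b' < a' + \<eta> \<and>
        \<epsilon> < norm ((1 / (b - a)) *\<^sub>R (f b - f a) - (1 / (b' - a')) *\<^sub>R (f b' - f a'))"
proof -
  define S where "S = range (\<lambda>(e, w). pos e w A)"
  define f0 where "f0 p = (case (SOME (e, w). pos e w A = p) of (e, w) \<Rightarrow> val e w A)" for p
  \<comment> \<open>One point has many addresses \<open>(e, w)\<close>; by the Lipschitz estimate at
    distance zero the choice among them does not matter.\<close>
  have f0: "f0 (pos e w A) = val e w A" for e w
  proof -
    obtain e' w' where ew: "(SOME (e', w'). pos e' w' A = pos e w A) = (e', w')" by fastforce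
    have "case (SOME (e', w'). pos e' w' A = pos e w A) of (e', w') \<Rightarrow> pos e' w' A = pos e w A"
      by (rule someI[of _ "(e, w)"]) simp
    then have "pos e' w' A = pos e w A" by (simp add: ew)
    then show ?thesis using val_lipschitz[OF A(1) subset_refl, of e' w' e w] by (simp add: f0_def ew)
  qed
  have "C-lipschitz_on S f0"
  proof (rule lipschitz_onI[OF _ C_nonneg])
    fix p q assume "p \<in> S" "q \<in> S"
    then obtain e w e' w' where "p = pos e w A" "q = pos e' w' A" by (auto simp: S_def)
    then show "dist (f0 p) (f0 q) \<le> C * dist p q"
      using val_lipschitz[OF A(1) subset_refl, of e w e' w'] by (simp add: f0 dist_norm)
  qed
  from lipschitz_extend_closure[OF this]
  obtain f1 where f1: "C-lipschitz_on (closure S) f1" "\<And>p. p \<in> S \<Longrightarrow> f1 p = f0 p"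
    by blast
  have S: "pos e w A \<in> S" for e w
    unfolding S_def by (rule range_eqI[of _ _ "(e, w)"]) simp
  have f1v: "f1 (pos e w A) = val e w A" for e w
    using f1(2)[OF S] f0 by simp
  \<comment> \<open>Endpoints are dense: the left end of a cell of \<open>x\<close> is within the
    measure of that cell.\<close>
  have cl: "x \<in> closure S" if "0 \<le> x" "x \<le> measure M A" for x
  proof (cases "x = measure M A")
    case True
    then have "x \<in> S" using S[of True "[]"] by simp
    then show ?thesis using closure_subset by blast
  next
    case False
    with that have x: "0 \<le> x" "x < measure M A" by auto
    have "(\<lambda>n. pos False (branch x n) A) \<longlonglongrightarrow> x"
    proof (rule LIM_zero_cancel, rule Lim_null_comparison[OF _ cell_tendsto_0[OF x]])
      show "\<forall>\<^sub>F n in sequentially. norm (pos False (branch x n) A - x) \<le> measure M (cell x n)"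
      proof (intro always_eventually allI)
        fix n show "norm (pos False (branch x n) A - x) \<le> measure M (cell x n)"
          using branch_bounds[OF x, of n] nodeA[of "branch x n"] by simp
      qed
    qed
    then show ?thesis unfolding closure_sequential
      by (intro exI[of _ "\<lambda>n. pos False (branch x n) A"] conjI)
         (auto intro: S)
  qed
  \<comment> \<open>The nearest-point projection to the interval; as it does not increase distances,
    the constant extension keeps the Lipschitz constant.\<close>
  define clamp where "clamp x = max 0 (min (measure M A) x)" for x :: real
  have clamp: "0 \<le> clamp x" "clamp x \<le> measure M A" for x using A(2) by (auto simp: clamp_def)
  define f where "f x = f1 (clamp x)" for x
  have f_pos: "f (pos e w A) = val e w A" for e w
    using pos_val_bounds[OF A(1) subset_refl, of e w] by (simp add: f_def clamp_def f1v)
  show ?thesis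
  proof (rule that[of f])
    show "C-lipschitz_on UNIV f"
    proof (rule lipschitz_onI[OF _ C_nonneg])
      fix x y :: real
      have "dist (f x) (f y) \<le> C * dist (clamp x) (clamp y)"
        unfolding f_def using f1(1) cl clamp by (auto dest: lipschitz_onD)
      also have "dist (clamp x) (clamp y) \<le> dist x y" by (auto simp: clamp_def dist_real_def)
      finally show "dist (f x) (f y) \<le> C * dist x y" using C_nonneg by (simp add: mult_left_mono)
    qed
    show "f 0 = 0" using f_pos[of False "[]"] by simp
    show "f x = f 0" if "x \<le> 0" for x using that A(2) by (simp add: f_def clamp_def)
    show "f x = f (measure M A)" if "x \<ge> measure M A" for x using that by (simp add: f_def clamp_def)
    fix x \<eta> :: real assume x: "0 \<le> x" "x < measure M A" and \<eta>: "\<eta> > 0"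
    obtain N where N: "\<And>n. n \<ge> N \<Longrightarrow> measure M (cell x n) < \<eta>"
      using order_tendstoD(2)[OF cell_tendsto_0[OF x] \<eta>] by (auto simp: eventually_sequentially)
    obtain n where n: "n \<ge> N" "cell x (Suc n) = child (cell x n)"
      using infinitely_many_children[OF x] by blast
    define a b where "a = (\<lambda>n. pos False (branch x n) A)" and "b = (\<lambda>n. pos True (branch x n) A)"
    have ab: "a n \<le> x" "x < b n" "b n - a n = measure M (cell x n)" for n
      using branch_bounds[OF x, of n] nodeA[of "branch x n"] by (auto simp: a_def b_def)
    have fab: "f (b n) - f (a n) = G (cell x n)" for n
    proof -
      have "f (b n) - f (a n) = val True (branch x n) A - val False (branch x n) A"
        by (simp only: a_def b_def f_pos)
      then show ?thesis using nodeA[of "branch x n"] by simp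
    qed
    have sl: "(1 / (b n - a n)) *\<^sub>R (f (b n) - f (a n)) = avg (cell x n)" for n
      unfolding ab(3) fab avg_def ..
    have jump: "\<epsilon> < norm ((1 / (b (Suc n) - a (Suc n))) *\<^sub>R (f (b (Suc n)) - f (a (Suc n))) -
        (1 / (b n - a n)) *\<^sub>R (f (b n) - f (a n)))"
      unfolding sl n(2) by (rule avg_child[OF cell cell_pos[OF x]])
    have small: "b n < a n + \<eta>" "b (Suc n) < a (Suc n) + \<eta>"
      using N[of n] N[of "Suc n"] n(1) ab(3)[of n] ab(3)[of "Suc n"] by simp_all
    show "\<exists>a b a' b'. a \<le> x \<and> x < b \<and> b < a + \<eta> \<and> a' \<le> x \<and> x < b' \<and> b' < a' + \<eta> \<and>
        \<epsilon> < norm ((1 / (b - a)) *\<^sub>R (f b - f a) - (1 / (b' - a')) *\<^sub>R (f b' - f a'))"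
      by (rule exI[of _ "a (Suc n)"], rule exI[of _ "b (Suc n)"], rule exI[of _ "a n"], rule exI[of _ "b n"])
         (intro conjI ab small jump)
  qed
qed

end

section \<open>Lipschitz maps on the line\<close>

lemma is_norm_facts:
  assumes "is_norm N"
  shows is_norm_zero: "N 0 = 0"
    and is_norm_scaleR: "N (c *\<^sub>R x) = \<bar>c\<bar> * N x"
    and is_norm_triangle: "N (x + y) \<le> N x + N y"
    and is_norm_commute: "N (x - y) = N (y - x)"
    and is_norm_nonneg: "N x \<ge> 0"
    and is_norm_triangle_diff: "N (x - y) \<le> N x + N y"
    and is_norm_triangle_sub: "N x \<le> N y + N (x - y)"
proof -
  show z: "N 0 = 0" and sc: "N (c *\<^sub>R x) = \<bar>c\<bar> * N x" and tr: "N (x + y) \<le> N x + N y" for c x y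
    using assms by (auto simp: is_norm_def)
  have m: "N (- x) = N x" for x using sc[of "-1" x] by simp
  show "N (x - y) = N (y - x)" using m[of "x - y"] by simp
  show "N x \<ge> 0" using tr[of x "- x"] by (simp add: z m)
  show "N (x - y) \<le> N x + N y" using tr[of x "- y"] by (simp add: m)
  show "N x \<le> N y + N (x - y)" using tr[of y "x - y"] by simp
qed

lemma is_norm_norm: "is_norm norm"
  by (auto simp: is_norm_def norm_triangle_ineq)

lemma renorming_norm: "renorming norm"
  unfolding renorming_def using is_norm_norm by (auto intro!: exI[of _ "1::real"])

context
  fixes N :: "'z::real_vector \<Rightarrow> real"
  assumes N: "is_norm N"
begin

lemma Lip0_I:
  fixes f :: "real \<Rightarrow> 'z"
  assumes "f 0 = 0" "\<And>p q. p < q \<Longrightarrow> N (f q - f p) \<le> K * (q - p)"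
  shows "f \<in> Lip0 N"
proof -
  have "N (f p - f q) \<le> K * norm (p - q)" for p q
    using assms(2)[of p q] assms(2)[of q p] is_norm_commute[OF N, of "f p" "f q"] is_norm_zero[OF N]
    by (cases p q rule: linorder_cases) auto
  then show ?thesis using assms(1) by (auto simp: Lip0_def)
qed

lemma lip_norm_bound:
  fixes f :: "real \<Rightarrow> 'z"
  assumes "f \<in> Lip0 N"
  shows "N (f p - f q) \<le> lip_norm N f * \<bar>p - q\<bar>"
proof (cases "p = q")
  case True
  then show ?thesis using is_norm_zero[OF N] by simp
next
  case False
  obtain K where K: "\<And>p q. N (f p - f q) \<le> K * norm (p - q)" using assms by (auto simp: Lip0_def)
  have "N (f p - f q) / norm (p - q) \<le> lip_norm N f"
    unfolding lip_norm_def
  proof (rule cSup_upper)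
    show "bdd_above {N (f p - f q) / norm (p - q) | p q. p \<noteq> q}"
      using K by (intro bdd_aboveI[of _ K]) (auto simp: divide_le_eq)
  qed (use False in auto)
  then show ?thesis using False by (simp add: divide_le_eq)
qed

lemma lip_norm_le:
  fixes f :: "real \<Rightarrow> 'z"
  assumes "\<And>p q. p < q \<Longrightarrow> N (f q - f p) \<le> K * (q - p)"
  shows "lip_norm N f \<le> K"
  unfolding lip_norm_def
proof (rule cSup_least)
  show "{N (f p - f q) / norm (p - q) |p q. p \<noteq> q} \<noteq> {}"
    using zero_neq_one[where 'a=real] by blast
  fix r assume "r \<in> {N (f p - f q) / norm (p - q) |p q. p \<noteq> q}"
  then obtain p q where "p \<noteq> q" "r = N (f p - f q) / norm (p - q)" by blast
  then show "r \<le> K"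
    using assms[of p q] assms[of q p] is_norm_commute[OF N, of "f p" "f q"]
    by (cases p q rule: linorder_cases) (auto simp: divide_le_eq)
qed

lemma lip_norm_gt:
  fixes f :: "real \<Rightarrow> 'z"
  assumes "t < lip_norm N f"
  obtains p q where "p < q" "t * (q - p) < N (f q - f p)"
  using lip_norm_le[of f t] assms by (meson leD le_less_linear)

lemma lip_norm_nonneg:
  fixes f :: "real \<Rightarrow> 'z"
  assumes "f \<in> Lip0 N" shows "lip_norm N f \<ge> 0"
  using lip_norm_bound[OF assms, of 1 0] is_norm_nonneg[OF N, of "f 1 - f 0"] by simp

lemma Lip0_diff:
  fixes f g :: "real \<Rightarrow> 'z"
  assumes "f \<in> Lip0 N" "g \<in> Lip0 N"
  shows "(\<lambda>x. f x - g x) \<in> Lip0 N"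
proof (rule Lip0_I)
  show "f 0 - g 0 = 0" using assms by (simp add: Lip0_def)
  fix p q :: real assume "p < q"
  then show "N ((f q - g q) - (f p - g p)) \<le> (lip_norm N f + lip_norm N g) * (q - p)"
    using lip_norm_bound[OF assms(1), of q p] lip_norm_bound[OF assms(2), of q p]
      is_norm_triangle_diff[OF N, of "f q - f p" "g q - g p"]
    by (simp add: algebra_simps)
qed

end

section \<open>Reparametrisation by a monotone map with dense flat pieces\<close>

lemma tiny_dense_open:
  assumes "\<eta> > 0"
  obtains U :: "real set" where "open U" "emeasure lborel U \<le> ennreal \<eta>"
    "\<And>p q. p < q \<Longrightarrow> \<exists>c d. p < c \<and> c < d \<and> d < q \<and> {c..d} \<subseteq> U"
proof -
  \<comment> \<open>The lengths \<open>2 * r n\<close> form a geometric series with sum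
    \<open>\<eta>\<close>; the intervals are centred at the rationals.\<close>
  define r where "r n = \<eta> * (1 / 2) ^ (n + 2)" for n :: nat
  have r: "r n > 0" for n using assms by (simp add: r_def)
  define z where "z n = real_of_rat (from_nat n)" for n
  define I where "I n = {z n - r n <..< z n + r n}" for n
  define U where "U = (\<Union>n. I n)"
  have "emeasure lborel U \<le> (\<Sum>n. emeasure lborel (I n))"
    unfolding U_def by (rule emeasure_subadditive_countably) (auto simp: I_def)
  also have "\<dots> = (\<Sum>n. ennreal (2 * r n))"
    using r by (intro suminf_cong) (simp add: I_def less_imp_le)
  also have "\<dots> = ennreal \<eta>"
  proof (rule sums_unique[symmetric], rule sums_ennreal[THEN iffD2])
    have "(\<lambda>n. (\<eta> / 2) * (1 / 2) ^ n) sums ((\<eta> / 2) * (1 / (1 - 1 / 2)))"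
      by (intro sums_mult geometric_sums) simp
    then show "(\<lambda>n. 2 * r n) sums \<eta>" by (simp add: r_def)
  qed (use r assms in \<open>auto simp: less_imp_le\<close>)
  finally have "emeasure lborel U \<le> ennreal \<eta>" .
  moreover have "\<exists>c d. p < c \<and> c < d \<and> d < q \<and> {c..d} \<subseteq> U" if pq: "p < q" for p q
  proof -
    obtain w where w: "p < real_of_rat w" "real_of_rat w < q" using of_rat_dense[OF pq] by blast
    define n where "n = to_nat w"
    have zn: "z n = real_of_rat w" by (simp add: z_def n_def)
    define d where "d = min ((z n + q) / 2) (z n + r n / 2)"
    have d: "z n < d" "d < q" "d < z n + r n" using w r[of n] by (auto simp: d_def zn min_less_iff_disj)
    then have "{z n..d} \<subseteq> I n" using r[of n] by (auto simp: I_def)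
    then have "{z n..d} \<subseteq> U" by (auto simp: U_def)
    then show ?thesis using d w zn by auto
  qed
  moreover have "open U" by (auto simp: U_def I_def)
  ultimately show ?thesis using that by blast
qed

text \<open>Travel along the line without counting a small dense open set \<open>U\<close>:
  \<open>\<theta>\<close> subtracts the length of \<open>U\<close> passed so far. It stands still on
  \<open>U\<close>, has speed at most 1 and never lags by more than \<open>\<eta>\<close>.\<close>

lemma mono_map_dense_flats:
  assumes \<eta>: "\<eta> > 0"
  obtains \<theta> :: "real \<Rightarrow> real" where "mono \<theta>" "\<And>x y. x \<le> y \<Longrightarrow> \<theta> y - \<theta> x \<le> y - x"
    "\<And>x. \<theta> x \<le> x" "\<And>x. x - \<eta> \<le> \<theta> x" "continuous_on UNIV \<theta>"
    "\<And>p q. p < q \<Longrightarrow> \<exists>c d. p < c \<and> c < d \<and> d < q \<and> \<theta> c = \<theta> d"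
proof -
  obtain U :: "real set" where U: "open U" "emeasure lborel U \<le> ennreal \<eta>"
    "\<And>p q. p < q \<Longrightarrow> \<exists>c d. p < c \<and> c < d \<and> d < q \<and> {c..d} \<subseteq> U"
    using tiny_dense_open[OF \<eta>] by blast
  have Ub: "U \<in> sets borel" using U(1) by simp
  have fin: "U \<inter> S \<in> fmeasurable lborel" if "S \<in> sets borel" for S
  proof (rule fmeasurableI2[of U])
    show "U \<in> fmeasurable lborel"
      using U(2) Ub by (intro fmeasurableI) (auto simp: order_le_less_trans[OF _ ennreal_less_top])
  qed (use Ub that in auto)
  define \<theta> where "\<theta> x = x - measure lborel (U \<inter> {..x})" for x
  have inc: "\<theta> y - \<theta> x = (y - x) - measure lborel (U \<inter> {x<..y})" if "x \<le> y" for x y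
  proof -
    have "U \<inter> {..y} = (U \<inter> {..x}) \<union> (U \<inter> {x<..y})" using that by auto
    moreover have "measure lborel ((U \<inter> {..x}) \<union> (U \<inter> {x<..y})) =
        measure lborel (U \<inter> {..x}) + measure lborel (U \<inter> {x<..y})"
      using fin[of "{..x}"] fin[of "{x<..y}"] by (intro measure_Union) (auto simp: fmeasurable_def)
    ultimately show ?thesis by (simp add: \<theta>_def)
  qed
  have le: "measure lborel (U \<inter> {x<..y}) \<le> y - x" if "x \<le> y" for x y
  proof -
    have "measure lborel (U \<inter> {x<..y}) \<le> measure lborel {x<..y}"
      using Ub that by (intro measure_mono_fmeasurable) (auto simp: fmeasurable_def)
    then show ?thesis using that by simp
  qed
  have lip: "\<theta> y - \<theta> x \<le> y - x" if "x \<le> y" for x y using inc[OF that] by simp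
  have mono: "\<theta> x \<le> \<theta> y" if "x \<le> y" for x y using inc[OF that] le[OF that] by simp
  show ?thesis
  proof (rule that[of \<theta>])
    show "mono \<theta>" using mono by (auto intro: monoI)
    show "\<theta> y - \<theta> x \<le> y - x" if "x \<le> y" for x y by (rule lip[OF that])
    show "\<theta> x \<le> x" for x by (simp add: \<theta>_def)
    show "x - \<eta> \<le> \<theta> x" for x
    proof -
      have "emeasure lborel (U \<inter> {..x}) \<le> ennreal \<eta>"
        using Ub by (intro order_trans[OF emeasure_mono U(2)]) auto
      then have "measure lborel (U \<inter> {..x}) \<le> \<eta>"
        using \<eta> unfolding measure_def by (simp add: enn2real_leI)
      then show ?thesis by (simp add: \<theta>_def)
    qed
    have "1-lipschitz_on UNIV \<theta>"
    proof (rule lipschitz_onI)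
      fix x y :: real
      show "dist (\<theta> x) (\<theta> y) \<le> 1 * dist x y"
        using lip[of x y] lip[of y x] mono[of x y] mono[of y x] by (cases "x \<le> y") (auto simp: dist_real_def)
    qed simp
    then show "continuous_on UNIV \<theta>" by (rule lipschitz_on_continuous_on)
    fix p q :: real assume "p < q"
    then obtain c d where cd: "p < c" "c < d" "d < q" "{c..d} \<subseteq> U" using U(3) by blast
    have "U \<inter> {c<..d} = {c<..d}" using cd(4) by auto
    then have "\<theta> c = \<theta> d" using inc[of c d] cd(2) by simp
    then show "\<exists>c d. p < c \<and> c < d \<and> d < q \<and> \<theta> c = \<theta> d" using cd by blast
  qed
qed

text \<open>A unit vector of the line is 1 or -1, so \<open>e *\<^sub>R d\<close> is the ordinary
  derivative. On intervals containing \<open>x\<close> the errors at the two endpoints add up to a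
  multiple of the full length, which is what a comparison of slopes requires.\<close>

lemma directional_derivative_real:
  fixes g :: "real \<Rightarrow> 'z::real_normed_vector"
  assumes D: "has_directional_derivative norm g x e d" and e: "norm e = 1" and \<kappa>: "\<kappa> > 0"
  obtains \<rho> where "\<rho> > 0"
    "\<And>a b. x - \<rho> < a \<Longrightarrow> a \<le> x \<Longrightarrow> x \<le> b \<Longrightarrow> b < x + \<rho> \<Longrightarrow>
      norm (g b - g a - (b - a) *\<^sub>R (e *\<^sub>R d)) \<le> \<kappa> * (b - a)"
proof -
  have "\<forall>\<^sub>F t in at 0. norm (norm ((1 / t) *\<^sub>R (g (x + t *\<^sub>R e) - g x) - d)) < \<kappa>"
    using tendstoD[OF D[unfolded has_directional_derivative_def] \<kappa>] by simp
  then obtain \<rho> where \<rho>: "\<rho> > 0"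
    "\<And>t. t \<noteq> 0 \<Longrightarrow> \<bar>t\<bar> < \<rho> \<Longrightarrow> norm ((1 / t) *\<^sub>R (g (x + t * e) - g x) - d) < \<kappa>"
    by (auto simp: eventually_at dist_real_def)
  have ee: "e * e = 1" "\<bar>e\<bar> = 1" using e by (auto simp: abs_if split: if_splits)
  have pt: "norm (g (x + s) - g x - s *\<^sub>R (e *\<^sub>R d)) \<le> \<kappa> * \<bar>s\<bar>" if "\<bar>s\<bar> < \<rho>" for s
  proof (cases "s = 0")
    case False
    define t where "t = s * e"
    have t: "t \<noteq> 0" "\<bar>t\<bar> < \<rho>" "\<bar>t\<bar> = \<bar>s\<bar>" "t * e = s"
      using False ee that by (auto simp: t_def abs_mult mult.assoc)
    have "g (x + s) - g x - s *\<^sub>R (e *\<^sub>R d) = t *\<^sub>R ((1 / t) *\<^sub>R (g (x + t * e) - g x) - d)"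
      using t(1) ee by (simp add: scaleR_diff_right t(4)) (simp add: t_def)
    then have "norm (g (x + s) - g x - s *\<^sub>R (e *\<^sub>R d)) =
        \<bar>t\<bar> * norm ((1 / t) *\<^sub>R (g (x + t * e) - g x) - d)" by (simp only: norm_scaleR)
    also have "\<dots> \<le> \<bar>t\<bar> * \<kappa>" using \<rho>(2)[OF t(1,2)] by (intro mult_left_mono) auto
    finally show ?thesis using t(3) by (simp add: mult.commute)
  qed simp
  show ?thesis
  proof (rule that[OF \<rho>(1)])
    fix a b assume ab: "x - \<rho> < a" "a \<le> x" "x \<le> b" "b < x + \<rho>"
    have "g b - g a - (b - a) *\<^sub>R (e *\<^sub>R d) =
      (g (x + (b - x)) - g x - (b - x) *\<^sub>R (e *\<^sub>R d)) - (g (x + (a - x)) - g x - (a - x) *\<^sub>R (e *\<^sub>R d))"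
      by (simp add: algebra_simps)
    also have "norm \<dots> \<le> \<kappa> * \<bar>b - x\<bar> + \<kappa> * \<bar>a - x\<bar>"
      using ab by (intro order_trans[OF norm_triangle_ineq4] add_mono pt) auto
    also have "\<dots> = \<kappa> * (b - a)" using ab by (simp add: algebra_simps)
    finally show "norm (g b - g a - (b - a) *\<^sub>R (e *\<^sub>R d)) \<le> \<kappa> * (b - a)" .
  qed
qed

text \<open>A map \<open>g\<close> within \<open>\<delta>\<close> of the reparametrised map
  \<open>h\<close> has Lipschitz constant between \<open>L - 3 * \<delta>\<close> and
  \<open>L + \<delta>\<close>. Strong attainment fails on a flat piece of \<open>\<theta>\<close>; a
  maximal derivative at \<open>x\<close> would bring all short slopes of \<open>f\<close> around
  \<open>\<theta> x\<close> within \<open>24 * \<delta>\<close> of one vector.\<close>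

lemma not_dense_of_nowhere_differentiable:
  fixes f :: "real \<Rightarrow> 'y::banach"
  assumes lip: "C-lipschitz_on UNIV f" and f0: "f 0 = 0" and \<epsilon>: "\<epsilon> > 0" and m: "m > 0"
    and left: "\<And>x. x \<le> 0 \<Longrightarrow> f x = f 0" and right: "\<And>x. x \<ge> m \<Longrightarrow> f x = f m"
    and jump: "\<And>x \<eta>. 0 \<le> x \<Longrightarrow> x < m \<Longrightarrow> \<eta> > 0 \<Longrightarrow>
      \<exists>a b a' b'. a \<le> x \<and> x < b \<and> b < a + \<eta> \<and> a' \<le> x \<and> x < b' \<and> b' < a' + \<eta> \<and>
        \<epsilon> < norm ((1 / (b - a)) *\<^sub>R (f b - f a) - (1 / (b' - a')) *\<^sub>R (f b' - f a'))"
  shows "\<not> dense_in_Lip0 norm (SNA norm \<union> Der norm :: (real \<Rightarrow> 'y) set)"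
proof
  assume dense: "dense_in_Lip0 norm (SNA norm \<union> Der norm :: (real \<Rightarrow> 'y) set)"
  note nn = is_norm_norm
  have "f \<in> Lip0 norm"
  proof (rule Lip0_I[OF nn, where K=C])
    fix p q :: real assume "p < q"
    then show "norm (f q - f p) \<le> C * (q - p)"
      using lipschitz_onD[OF lip, of q p] by (simp add: dist_norm)
  qed (rule f0)
  define L where "L = lip_norm norm f"
  have fL: "norm (f b - f a) \<le> L * (b - a)" if "a \<le> b" for a b
    using lip_norm_bound[OF nn \<open>f \<in> Lip0 norm\<close>, of b a] that by (simp add: L_def)
  have slope: "norm ((1 / (b - a)) *\<^sub>R (f b - f a)) \<le> L" if "a < b" for a b
    using fL[of a b] that by (simp add: divide_le_eq)
  \<comment> \<open>Two slopes within \<open>24 * \<delta>\<close> of one vector differ by at most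
    \<open>48 * \<delta>\<close>, which has to be less than \<open>\<epsilon>\<close>.\<close>
  define \<delta> where "\<delta> = \<epsilon> / 50"
  have \<delta>: "\<delta> > 0" using \<epsilon> by (simp add: \<delta>_def)
  \<comment> \<open>Two slopes of norm at most \<open>L\<close> differ by more than
    \<open>\<epsilon> = 50 * \<delta>\<close>.\<close>
  have L: "L > 25 * \<delta>"
  proof -
    obtain a b a' b' where "a \<le> 0" "0 < b" "a' \<le> 0" "0 < b'"
      "\<epsilon> < norm ((1 / (b - a)) *\<^sub>R (f b - f a) - (1 / (b' - a')) *\<^sub>R (f b' - f a'))"
      using jump[of 0 1] m by auto
    moreover have "norm ((1 / (b - a)) *\<^sub>R (f b - f a) - (1 / (b' - a')) *\<^sub>R (f b' - f a')) \<le> L + L"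
      using calculation by (intro order_trans[OF norm_triangle_ineq4] add_mono slope) auto
    ultimately show ?thesis by (simp add: \<delta>_def)
  qed
  obtain p q where pq: "p < q" "(L - \<delta>) * (q - p) < norm (f q - f p)"
    using lip_norm_gt[OF nn, of "L - \<delta>" f] \<delta> by (auto simp: L_def)
  \<comment> \<open>The lag of \<open>\<theta>\<close> stretches the interval from \<open>p\<close>
    to \<open>q\<close> by at most \<open>\<eta>\<close>; this value makes the loss of slope one
    further \<open>\<delta>\<close>.\<close>
  define \<eta> where "\<eta> = \<delta> * (q - p) / L"
  have \<eta>: "\<eta> > 0" "L * \<eta> = \<delta> * (q - p)" using \<delta> pq L by (auto simp: \<eta>_def)
  obtain \<theta> :: "real \<Rightarrow> real" where th: "mono \<theta>" "\<And>x y. x \<le> y \<Longrightarrow> \<theta> y - \<theta> x \<le> y - x"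
    "\<And>x. \<theta> x \<le> x" "\<And>x. x - \<eta> \<le> \<theta> x" "continuous_on UNIV \<theta>"
    "\<And>p q. p < q \<Longrightarrow> \<exists>c d. p < c \<and> c < d \<and> d < q \<and> \<theta> c = \<theta> d"
    using mono_map_dense_flats[OF \<eta>(1)] by metis
  have th_mono: "\<theta> x \<le> \<theta> y" if "x \<le> y" for x y using monoD[OF th(1) that] .
  have ivt: "\<exists>x. a \<le> x \<and> x \<le> b \<and> \<theta> x = y" if "\<theta> a \<le> y" "y \<le> \<theta> b" "a \<le> b" for a b y
    using IVT'[of \<theta> a y b] that continuous_on_subset[OF th(5)] by blast
  define h where "h x = f (\<theta> x) - f (\<theta> 0)" for x
  have hL: "norm (h b - h a) \<le> L * (b - a)" if "a \<le> b" for a b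
  proof -
    have "norm (h b - h a) \<le> L * (\<theta> b - \<theta> a)" using fL[OF th_mono[OF that]] by (simp add: h_def)
    also have "\<dots> \<le> L * (b - a)" using th(2)[OF that] L \<delta> by (intro mult_left_mono) auto
    finally show ?thesis .
  qed
  have h: "h \<in> Lip0 norm"
  proof (rule Lip0_I[OF nn, where K=L])
    show "h 0 = 0" by (simp add: h_def)
    show "norm (h q - h p) \<le> L * (q - p)" if "p < q" for p q using hL that by simp
  qed
  have Lh: "lip_norm norm h \<le> L" using hL by (intro lip_norm_le[OF nn]) auto
  have Lh2: "L - 2 * \<delta> \<le> lip_norm norm h"
  proof -
    obtain p' where p': "p \<le> p'" "\<theta> p' = p"
      using ivt[of p p "p + \<eta>"] th(3)[of p] th(4)[of "p + \<eta>"] \<eta> by auto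
    obtain q' where q': "q' \<le> q + \<eta>" "\<theta> q' = q"
      using ivt[of q q "q + \<eta>"] th(3)[of q] th(4)[of "q + \<eta>"] \<eta> by auto
    have "p' < q'" using p' q' pq(1) th_mono[of q' p'] by (meson leD le_less_linear)
    have "(L - 2 * \<delta>) * (q' - p') \<le> (L - 2 * \<delta>) * (q - p + \<eta>)"
      using p' q' L \<delta> by (intro mult_left_mono) auto
    also have "\<dots> \<le> (L - \<delta>) * (q - p)"
      using \<eta> \<delta> pq(1) mult_pos_pos[OF \<delta> \<eta>(1)] by (simp add: algebra_simps)
    also have "\<dots> \<le> norm (h q' - h p')" using pq(2) p' q' by (simp add: h_def)
    also have "\<dots> \<le> lip_norm norm h * (q' - p')"
      using lip_norm_bound[OF nn h, of q' p'] \<open>p' < q'\<close> by simp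
    finally show ?thesis using \<open>p' < q'\<close> by simp
  qed
  obtain g where g: "g \<in> SNA norm \<union> Der norm" "lip_norm norm (\<lambda>x. h x - g x) < \<delta>"
    using dense h \<delta> unfolding dense_in_Lip0_def by blast
  have gL0: "g \<in> Lip0 norm" using g(1) by (auto simp: SNA_def Der_def)
  have hg: "norm ((h b - g b) - (h a - g a)) \<le> \<delta> * (b - a)" if "a \<le> b" for a b
  proof -
    have "norm ((h b - g b) - (h a - g a)) \<le> lip_norm norm (\<lambda>x. h x - g x) * (b - a)"
      using lip_norm_bound[OF nn Lip0_diff[OF nn h gL0], of b a] that by simp
    also have "\<dots> \<le> \<delta> * (b - a)" using g(2) that by (intro mult_right_mono) auto
    finally show ?thesis .
  qed
  define Lg where "Lg = lip_norm norm g"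
  have gL: "norm (g b - g a) \<le> Lg * (b - a)" if "a \<le> b" for a b
    using lip_norm_bound[OF nn gL0, of b a] that by (simp add: Lg_def)
  have gh: "norm (g b - g a) \<le> norm (h b - h a) + \<delta> * (b - a)" if "a \<le> b" for a b
    using norm_triangle_sub[of "g b - g a" "h b - h a"] hg[OF that]
      norm_minus_commute[of "g b - g a" "h b - h a"] by (simp add: algebra_simps)
  have hgn: "norm (h b - h a) \<le> norm (g b - g a) + \<delta> * (b - a)" if "a \<le> b" for a b
    using norm_triangle_sub[of "h b - h a" "g b - g a"] hg[OF that] by (simp add: algebra_simps)
  have Lg_le: "Lg \<le> L + \<delta>"
    unfolding Lg_def
  proof (rule lip_norm_le[OF nn])
    fix p q :: real assume "p < q"
    then show "norm (g q - g p) \<le> (L + \<delta>) * (q - p)" using gh[of p q] hL[of p q] by (simp add: algebra_simps)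
  qed
  have "lip_norm norm h \<le> Lg + \<delta>"
  proof (rule lip_norm_le[OF nn])
    fix p q :: real assume "p < q"
    then show "norm (h q - h p) \<le> (Lg + \<delta>) * (q - p)" using hgn[of p q] gL[of p q] by (simp add: algebra_simps)
  qed
  with Lh2 have Lg_ge: "L - 3 * \<delta> \<le> Lg" by simp
  show False
  proof (cases "g \<in> SNA norm")
    case True
    then obtain p' q' where "p' \<noteq> q'" "Lg = norm (g p' - g q') / norm (p' - q')"
      unfolding SNA_def Lg_def by blast
    then obtain p q where pq: "p < q" "Lg * (q - p) = norm (g q - g p)"
      by (cases p' q' rule: linorder_cases) (auto simp: norm_minus_commute)
    \<comment> \<open>On the flat piece \<open>h\<close> is constant, so \<open>g\<close> has speed
      at most \<open>\<delta>\<close> there and at most \<open>Lg\<close> elsewhere; average speed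
      \<open>Lg\<close> then forces \<open>Lg \<le> \<delta>\<close>.\<close>
    obtain c d where cd: "p < c" "c < d" "d < q" "\<theta> c = \<theta> d" using th(6)[OF pq(1)] by blast
    have "norm (g d - g c) \<le> \<delta> * (d - c)" using gh[of c d] cd by (simp add: h_def)
    moreover have "g q - g p = (g c - g p) + (g d - g c) + (g q - g d)" by simp
    then have "norm (g q - g p) \<le> norm (g c - g p) + norm (g d - g c) + norm (g q - g d)"
      by (metis norm_triangle_mono norm_triangle_ineq order_refl)
    moreover have "norm (g c - g p) \<le> Lg * (c - p)" "norm (g q - g d) \<le> Lg * (q - d)"
      using gL cd by auto
    ultimately have "Lg * (q - p) \<le> Lg * (c - p) + \<delta> * (d - c) + Lg * (q - d)" using pq(2) by linarith
    then have "Lg * (d - c) \<le> \<delta> * (d - c)" by (simp add: algebra_simps)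
    then have "Lg \<le> \<delta>" using cd(2) by simp
    then show False using Lg_ge L \<delta> by linarith
  next
    case False
    with g(1) obtain x e d where D: "norm e = 1" "has_directional_derivative norm g x e d" "norm d = Lg"
      unfolding Der_def Lg_def by blast
    define v where "v = e *\<^sub>R d"
    have v: "norm v = Lg" using D by (simp add: v_def)
    obtain \<rho> where \<rho>: "\<rho> > 0"
      "\<And>a b. x - \<rho> < a \<Longrightarrow> a \<le> x \<Longrightarrow> x \<le> b \<Longrightarrow> b < x + \<rho> \<Longrightarrow>
        norm (g b - g a - (b - a) *\<^sub>R v) \<le> \<delta> * (b - a)"
      using directional_derivative_real[OF D(2,1) \<delta>] unfolding v_def by metis
    have hv: "norm (h b - h a - (b - a) *\<^sub>R v) \<le> 2 * \<delta> * (b - a)"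
      if "x - \<rho> < a" "a \<le> x" "x \<le> b" "b < x + \<rho>" for a b
    proof -
      have "h b - h a - (b - a) *\<^sub>R v = ((h b - g b) - (h a - g a)) + (g b - g a - (b - a) *\<^sub>R v)" by simp
      also have "norm \<dots> \<le> \<delta> * (b - a) + \<delta> * (b - a)"
        using that by (intro order_trans[OF norm_triangle_ineq] add_mono hg \<rho>(2)) auto
      finally show ?thesis by simp
    qed
    have noflat: "h a \<noteq> h b" if "x - \<rho> < a" "a \<le> x" "x \<le> b" "b < x + \<rho>" "a < b" for a b
    proof
      assume "h a = h b"
      then have "(b - a) * Lg \<le> 2 * \<delta> * (b - a)" using hv[OF that(1-4)] that(5) v by simp
      then have "Lg \<le> 2 * \<delta>" using that(5) by (simp add: mult.commute[of _ "b - a"])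
      then show False using Lg_ge L \<delta> by linarith
    qed
    define s where "s = \<rho> / 2"
    have s: "s > 0" "s < \<rho>" using \<rho>(1) by (simp_all add: s_def)
    have sx: "x - \<rho> < x" "x - \<rho> < x - s" "x - s \<le> x" "x - s < x" "x \<le> x + s" "x < x + s"
        "x + s < x + \<rho>" "x < x + \<rho>"
      using s by linarith+
    have hr: "h x \<noteq> h (x + s)"
      by (rule noflat[OF sx(1) order_refl sx(5,7,6)])
    have hl: "h (x - s) \<noteq> h x"
      by (rule noflat[OF sx(2,3) order_refl sx(8,4)])
    \<comment> \<open>Outside this range \<open>f\<close> is constant, so \<open>h\<close> would be
      constant on one side of \<open>x\<close>, which a derivative of norm close to \<open>L\<close>
      forbids.\<close>
    have u: "0 \<le> \<theta> x" "\<theta> x < m"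
    proof -
      show "\<theta> x < m"
      proof (rule ccontr)
        assume "\<not> \<theta> x < m"
        then have "f (\<theta> x) = f m" "f (\<theta> (x + s)) = f m" using th_mono[of x "x + s"] s by (auto intro!: right)
        then show False using hr by (simp add: h_def)
      qed
      show "0 \<le> \<theta> x"
      proof (rule ccontr)
        assume "\<not> 0 \<le> \<theta> x"
        then have "f (\<theta> x) = f 0" "f (\<theta> (x - s)) = f 0" using th_mono[of "x - s" x] s by (auto intro!: left)
        then show False using hl by (simp add: h_def)
      qed
    qed
    have str: "\<theta> (x - s) < \<theta> x" "\<theta> x < \<theta> (x + s)"
      using hr hl th_mono[of "x - s" x] th_mono[of x "x + s"] s by (auto simp: h_def less_le)
    \<comment> \<open>Shorter intervals around \<open>\<theta> x\<close> lie in the image of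
      \<open>{x - s..x + s}\<close>, so they lift to intervals around \<open>x\<close>.\<close>
    define \<eta>0 where "\<eta>0 = min (\<theta> (x + s) - \<theta> x) (\<theta> x - \<theta> (x - s))"
    have "\<eta>0 > 0" using str by (simp add: \<eta>0_def)
    have close: "norm ((1 / (b - a)) *\<^sub>R (f b - f a) - v) \<le> 24 * \<delta>"
      if ab: "a \<le> \<theta> x" "\<theta> x < b" "b < a + \<eta>0" for a b
    proof -
      have "\<theta> (x - s) \<le> a" "b \<le> \<theta> (x + s)" using ab by (auto simp: \<eta>0_def)
      then obtain c d where c: "x - s \<le> c" "c \<le> x" "\<theta> c = a" and d: "x \<le> d" "d \<le> x + s" "\<theta> d = b"
        using ivt[of "x - s" a x] ivt[of x b "x + s"] ab s by fastforce
      have lt: "a < b" using ab by simp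
      have cd: "c \<le> d" "b - a \<le> d - c" using c d th(2)[of c d] by auto
      have 1: "norm (f b - f a - (d - c) *\<^sub>R v) \<le> 2 * \<delta> * (d - c)"
        using hv[of c d] c d s by (simp add: h_def)
      have "norm ((d - c) *\<^sub>R v) \<le> norm (f b - f a) + norm (f b - f a - (d - c) *\<^sub>R v)"
        using norm_triangle_sub[of "(d - c) *\<^sub>R v" "f b - f a"] by (simp add: norm_minus_commute)
      then have 2: "(d - c) * Lg \<le> L * (b - a) + 2 * \<delta> * (d - c)"
        using 1 fL[of a b] lt cd v by simp
      have "(d - c) * (L - 3 * \<delta>) \<le> (d - c) * Lg" using Lg_ge cd by (intro mult_left_mono) auto
      \<comment> \<open>\<open>f\<close> has speed at most \<open>L\<close> on the interval from
        \<open>a\<close> to \<open>b\<close>, while \<open>h\<close> nearly reaches speed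
        \<open>L\<close> on its lift, so the lift is hardly longer: \<open>\<theta>\<close> has
        slope close to 1 there.\<close>
      with 2 have 3: "L * ((d - c) - (b - a)) \<le> 5 * \<delta> * (d - c)" by (simp add: algebra_simps)
      have "25 * \<delta> * ((d - c) - (b - a)) \<le> L * ((d - c) - (b - a))"
        using L cd by (intro mult_right_mono) auto
      with 3 have "\<delta> * (25 * ((d - c) - (b - a))) \<le> \<delta> * (5 * (d - c))" by (simp add: algebra_simps)
      then have "25 * ((d - c) - (b - a)) \<le> 5 * (d - c)" using \<delta> by simp
      then have 4: "d - c \<le> 2 * (b - a)" using lt by simp
      have dec: "f b - f a - (b - a) *\<^sub>R v = (f b - f a - (d - c) *\<^sub>R v) + ((d - c) - (b - a)) *\<^sub>R v"
        by (simp add: algebra_simps)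
      have "norm (f b - f a - (b - a) *\<^sub>R v) \<le>
          norm (f b - f a - (d - c) *\<^sub>R v) + norm (((d - c) - (b - a)) *\<^sub>R v)"
        unfolding dec by (rule norm_triangle_ineq)
      also have "\<dots> \<le> 2 * \<delta> * (d - c) + ((d - c) - (b - a)) * Lg"
        using 1 v cd by simp
      \<comment> \<open>The crude bound \<open>Lg \<le> 2 * L\<close> makes fact 3 applicable once
        more, with a factor 2.\<close>
      also have "((d - c) - (b - a)) * Lg \<le> ((d - c) - (b - a)) * (2 * L)"
        using Lg_le L \<delta> cd by (intro mult_left_mono) auto
      also have "\<dots> \<le> 10 * \<delta> * (d - c)" using 3 by (simp add: algebra_simps)
      also have "2 * \<delta> * (d - c) + 10 * \<delta> * (d - c) = 12 * \<delta> * (d - c)" by simp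
      also have "\<dots> \<le> 12 * \<delta> * (2 * (b - a))" using 4 \<delta> by (intro mult_left_mono) auto
      finally have 5: "norm (f b - f a - (b - a) *\<^sub>R v) \<le> 24 * \<delta> * (b - a)" by (simp add: algebra_simps)
      have "(1 / (b - a)) *\<^sub>R (f b - f a) - v = (1 / (b - a)) *\<^sub>R (f b - f a - (b - a) *\<^sub>R v)"
        using lt by (simp add: scaleR_diff_right)
      then show ?thesis using 5 lt by (simp add: divide_le_eq)
    qed
    obtain a b a' b' where j: "a \<le> \<theta> x" "\<theta> x < b" "b < a + \<eta>0" "a' \<le> \<theta> x" "\<theta> x < b'" "b' < a' + \<eta>0"
      "\<epsilon> < norm ((1 / (b - a)) *\<^sub>R (f b - f a) - (1 / (b' - a')) *\<^sub>R (f b' - f a'))"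
      using jump[OF u \<open>\<eta>0 > 0\<close>] by blast
    have "norm ((1 / (b - a)) *\<^sub>R (f b - f a) - (1 / (b' - a')) *\<^sub>R (f b' - f a')) \<le>
       norm ((1 / (b - a)) *\<^sub>R (f b - f a) - v) + norm ((1 / (b' - a')) *\<^sub>R (f b' - f a') - v)"
      using norm_triangle_ineq4[of "(1 / (b - a)) *\<^sub>R (f b - f a) - v" "(1 / (b' - a')) *\<^sub>R (f b' - f a') - v"]
      by simp
    also have "\<dots> \<le> 24 * \<delta> + 24 * \<delta>" using j by (intro add_mono close)
    finally show False using j(7) \<epsilon> by (simp add: \<delta>_def)
  qed
qed

text \<open>A density exists once every non-null set contains a non-null subset where
  \<open>G\<close> is almost constant. If one set contains none, a subset with bounded averages
  satisfies the assumptions of \<open>bush\<close>.\<close>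

lemma RNP_of_dense:
  assumes dense: "dense_in_Lip0 norm (SNA norm \<union> Der norm :: (real \<Rightarrow> 'y::banach) set)"
  shows "has_RNP TYPE('w) TYPE('y)"
  unfolding has_RNP_def
proof (intro allI impI)
  fix M :: "'w measure" and G :: "'w set \<Rightarrow> 'y"
  assume fin: "finite_measure M" and vm: "vector_measure M G" and cw: "continuous_wrt M G"
    and V: "variation M G (space M) < \<infinity>"
  interpret continuous_vector_measure M G
    using fin vm cw by (simp add: continuous_vector_measure_def continuous_vector_measure_axioms_def)
  have loc: "\<exists>B\<in>sets M. B \<subseteq> A \<and> measure M B > 0 \<and>
      (\<exists>y. \<forall>E\<in>sets M. E \<subseteq> B \<longrightarrow> norm (G E - measure M E *\<^sub>R y) \<le> \<epsilon> * measure M E)"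
    if A: "A \<in> sets M" "measure M A > 0" and \<epsilon>: "\<epsilon> > 0" for A \<epsilon>
  proof (rule ccontr)
    assume neg: "\<not> ?thesis"
    obtain A' C where A': "A' \<in> sets M" "A' \<subseteq> A" "measure M A' > 0"
      "\<And>E. E \<in> sets M \<Longrightarrow> E \<subseteq> A' \<Longrightarrow> norm (G E) \<le> C * measure M E"
      using locally_bounded_average[OF V A] by blast
    interpret bush M G A' C \<epsilon>
    proof
      fix B y assume B: "B \<in> sets M" "B \<subseteq> A'" "measure M B > 0"
      with neg A'(2) show "\<exists>E\<in>sets M. E \<subseteq> B \<and> \<epsilon> * measure M E < norm (G E - measure M E *\<^sub>R y)"
        by (meson not_le order_trans)
    qed (use A' \<epsilon> in auto)
    show False
    proof (rule ex_nowhere_differentiable)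
      fix f :: "real \<Rightarrow> 'y"
      assume "C-lipschitz_on UNIV f" "f 0 = 0"
        "\<And>x. x \<le> 0 \<Longrightarrow> f x = f 0" "\<And>x. x \<ge> measure M A' \<Longrightarrow> f x = f (measure M A')"
        "\<And>x \<eta>. 0 \<le> x \<Longrightarrow> x < measure M A' \<Longrightarrow> \<eta> > 0 \<Longrightarrow>
          \<exists>a b a' b'. a \<le> x \<and> x < b \<and> b < a + \<eta> \<and> a' \<le> x \<and> x < b' \<and> b' < a' + \<eta> \<and>
            \<epsilon> < norm ((1 / (b - a)) *\<^sub>R (f b - f a) - (1 / (b' - a')) *\<^sub>R (f b' - f a'))"
      from not_dense_of_nowhere_differentiable[OF this(1,2) \<epsilon> A'(3) this(3,4,5)] dense
      show False by contradiction
    qed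
  qed
  have "\<exists>s. simple_function M s \<and>
    (\<forall>(I::'y set) E. finite I \<longrightarrow> disjoint_family_on E I \<longrightarrow> (\<forall>i\<in>I. E i \<in> sets M) \<longrightarrow>
      (\<Sum>i\<in>I. norm (G (E i) - sbi M (\<lambda>x. indicat_real (E i) x *\<^sub>R s x))) \<le> \<epsilon>)" if "\<epsilon> > 0" for \<epsilon>
  proof (rule approx_by_simple[OF V loc that, where 'i='y])
    fix s :: "'w \<Rightarrow> 'y"
    assume s: "simple_function M s" and
      le: "\<And>(I::'y set) E. finite I \<Longrightarrow> disjoint_family_on E I \<Longrightarrow> (\<And>i. i \<in> I \<Longrightarrow> E i \<in> sets M) \<Longrightarrow>
        (\<Sum>i\<in>I. norm (G (E i) - sbi M (\<lambda>x. indicat_real (E i) x *\<^sub>R s x))) \<le> \<epsilon>"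
    show ?thesis
      by (intro exI[of _ s] conjI allI impI s le) auto
  qed
  then show "\<exists>g. Bochner_integrable M g \<and>
      (\<forall>E\<in>sets M. has_Bochner_integral M (\<lambda>x. indicat_real E x *\<^sub>R g x) (G E))"
    by (rule density_of_approx)
qed

section \<open>The vector measure of a Lipschitz map\<close>

text \<open>Keeps measurability questions real-valued: only norms of such differences are ever
  integrated.\<close>

lemma strongly_measurable_norm_diff:
  assumes "strongly_measurable M g" "simple_function M s"
  shows "(\<lambda>x. norm (g x - s x)) \<in> borel_measurable M"
proof -
  obtain u where u: "\<And>i. simple_function M (u i)" "\<And>x. x \<in> space M \<Longrightarrow> (\<lambda>i. u i x) \<longlonglongrightarrow> g x"
    using assms(1) unfolding strongly_measurable_def by blast
  show ?thesis
  proof (rule borel_measurable_LIMSEQ_real)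
    show "(\<lambda>i. norm (u i x - s x)) \<longlonglongrightarrow> norm (g x - s x)" if "x \<in> space M" for x
      by (intro tendsto_intros u(2)[OF that])
    show "(\<lambda>x. norm (u i x - s x)) \<in> borel_measurable M" for i
      using simple_function_compose2[OF u(1) assms(2), of "\<lambda>a b. norm (a - b)"]
      by (rule borel_measurable_simple_function)
  qed
qed

text \<open>The range of \<open>g\<close> is separable: the countably many values of its simple
  approximants come within \<open>\<delta>\<close> of every value. Where \<open>g\<close> is within
  \<open>\<delta>\<close> of \<open>y j\<close>, its integrals inherit the bound.\<close>

lemma (in finite_measure) Bochner_density_countable_cover:
  fixes g :: "'a \<Rightarrow> 'b::real_normed_vector"
  assumes g: "strongly_measurable M g"
    and G: "\<And>E. E \<in> sets M \<Longrightarrow> has_Bochner_integral M (\<lambda>x. indicat_real E x *\<^sub>R g x) (G E)"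
    and \<delta>: "\<delta> > 0"
  obtains A :: "nat \<Rightarrow> 'a set" and y where "\<And>j. A j \<in> sets M" "(\<Union>j. A j) = space M"
    "\<And>j E. E \<in> sets M \<Longrightarrow> E \<subseteq> A j \<Longrightarrow> norm (G E - measure M E *\<^sub>R y j) \<le> \<delta> * measure M E"
proof -
  obtain s where s: "\<And>i. simple_function M (s i)" "\<And>x. x \<in> space M \<Longrightarrow> (\<lambda>i. s i x) \<longlonglongrightarrow> g x"
    using g unfolding strongly_measurable_def by blast
  \<comment> \<open>Adding 0 keeps \<open>V\<close> nonempty over an empty space, as the enumeration
    by \<open>from_nat_into\<close> requires.\<close>
  define V where "V = insert 0 (\<Union>i. s i ` space M)"
  have V: "countable V" "V \<noteq> {}"
    using simple_functionD(1)[OF s(1)] by (auto simp: V_def intro: countable_finite)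
  define y where "y = from_nat_into V"
  define A where "A j = {x\<in>space M. norm (g x - y j) \<le> \<delta>}" for j
  have Am: "A j \<in> sets M" for j
    using strongly_measurable_norm_diff[OF g, of "\<lambda>_. y j"] unfolding A_def by measurable
  have cover: "(\<Union>j. A j) = space M"
  proof (intro equalityI subsetI)
    fix x assume x: "x \<in> space M"
    then obtain i where i: "norm (s i x - g x) < \<delta>"
      using LIMSEQ_D[OF s(2) \<delta>] by blast
    have "s i x \<in> V" using x by (auto simp: V_def)
    then obtain j where "y j = s i x"
      unfolding y_def using from_nat_into_surj[OF V(1)] by blast
    then show "x \<in> (\<Union>j. A j)" using i x by (auto simp: A_def norm_minus_commute intro: exI[of _ j])
  qed (auto simp: A_def)
  have bnd: "norm (G E - measure M E *\<^sub>R y j) \<le> \<delta> * measure M E" if E: "E \<in> sets M" "E \<subseteq> A j" for E j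
  proof -
    let ?g = "\<lambda>x. indicat_real E x *\<^sub>R g x" and ?y = "\<lambda>x. indicat_real E x *\<^sub>R y j"
    obtain r where r: "\<And>i. simple_function M (r i)"
      "(\<lambda>i. \<integral>\<^sup>+x. ennreal (norm (?g x - r i x)) \<partial>M) \<longlonglongrightarrow> 0"
      "(\<lambda>i. sbi M (r i)) \<longlonglongrightarrow> G E" and sm: "strongly_measurable M ?g"
      using G[OF E(1)] unfolding has_Bochner_integral_def simple_bochner_integrable_iff by blast
    have sy: "simple_function M ?y" using E(1) by (intro simple_function_indicator_scaleR) auto
    have gy: "(\<integral>\<^sup>+x. ennreal (norm (?g x - ?y x)) \<partial>M) \<le> ennreal (\<delta> * measure M E)"
    proof -
      have "(\<integral>\<^sup>+x. ennreal (norm (?g x - ?y x)) \<partial>M) \<le> (\<integral>\<^sup>+x. ennreal \<delta> * indicator E x \<partial>M)"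
        using E(2) by (intro nn_integral_mono) (auto simp: A_def indicator_def intro!: ennreal_leI)
      also have "\<dots> = ennreal (\<delta> * measure M E)"
        using E(1) \<delta> by (simp add: nn_integral_cmult_indicator emeasure_eq_measure ennreal_mult)
      finally show ?thesis .
    qed
    \<comment> \<open>The integral is reached only through the approximants \<open>r i\<close>,
      whose L1 error disappears in the limit.\<close>
    have ub: "ennreal (norm (sbi M (r i) - measure M E *\<^sub>R y j)) \<le>
        (\<integral>\<^sup>+x. ennreal (norm (?g x - r i x)) \<partial>M) + ennreal (\<delta> * measure M E)" for i
    proof -
      have "ennreal (norm (sbi M (r i) - measure M E *\<^sub>R y j)) \<le> (\<integral>\<^sup>+x. ennreal (norm (r i x - ?y x)) \<partial>M)"
        using simple_bochner_integral_dist_le[OF r(1) sy] simple_bochner_integral_indicator[OF E(1), of "y j"]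
        by simp
      also have "\<dots> \<le> (\<integral>\<^sup>+x. ennreal (norm (?g x - r i x)) + ennreal (norm (?g x - ?y x)) \<partial>M)"
      proof (rule nn_integral_mono)
        fix x
        have "norm (r i x - ?y x) \<le> norm (?g x - r i x) + norm (?g x - ?y x)"
          using norm_triangle_ineq4[of "?g x - ?y x" "?g x - r i x"] by simp
        then show "ennreal (norm (r i x - ?y x)) \<le> ennreal (norm (?g x - r i x)) + ennreal (norm (?g x - ?y x))"
          by (simp flip: ennreal_plus add: ennreal_leI)
      qed
      also have "\<dots> = (\<integral>\<^sup>+x. ennreal (norm (?g x - r i x)) \<partial>M) + (\<integral>\<^sup>+x. ennreal (norm (?g x - ?y x)) \<partial>M)"
        using strongly_measurable_norm_diff[OF sm r(1)] strongly_measurable_norm_diff[OF sm sy]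
        by (intro nn_integral_add) auto
      finally show ?thesis using gy by (meson add_left_mono order_trans)
    qed
    have l1: "(\<lambda>i. ennreal (norm (sbi M (r i) - measure M E *\<^sub>R y j))) \<longlonglongrightarrow>
        ennreal (norm (G E - measure M E *\<^sub>R y j))"
      by (intro tendsto_ennrealI tendsto_intros r)
    have l2: "(\<lambda>i. (\<integral>\<^sup>+x. ennreal (norm (?g x - r i x)) \<partial>M) + ennreal (\<delta> * measure M E)) \<longlonglongrightarrow>
        0 + ennreal (\<delta> * measure M E)"
      by (intro tendsto_add r tendsto_const)
    have "ennreal (norm (G E - measure M E *\<^sub>R y j)) \<le> 0 + ennreal (\<delta> * measure M E)"
      by (rule LIMSEQ_le[OF l1 l2]) (intro exI[of _ 0] allI impI ub)
    then show ?thesis using \<delta> by simp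
  qed
  show ?thesis by (rule that[OF Am cover bnd])
qed

lemma (in finite_measure) variation_le:
  assumes "C \<ge> 0" and b: "\<And>E. E \<in> sets M \<Longrightarrow> norm (G E) \<le> C * measure M E"
  shows "variation M G (space M) \<le> ennreal (C * measure M (space M))"
  unfolding variation_def
proof (rule SUP_least, clarify)
  fix P assume P: "finite P" "P \<subseteq> sets M" "disjoint P" "\<Union>P = space M"
  have "(\<Sum>A\<in>P. norm (G A)) \<le> (\<Sum>A\<in>P. C * measure M A)"
    using P(2) by (intro sum_mono b) auto
  also have "\<dots> = C * measure M (\<Union>A\<in>P. A)"
    using P by (subst finite_measure_finite_Union)
      (auto simp: sum_distrib_left disjoint_def disjoint_family_on_def)
  also have "\<dots> = C * measure M (space M)" using P(4) by simp
  finally show "(\<Sum>A\<in>P. ennreal (norm (G A))) \<le> ennreal (C * measure M (space M))"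
    by (simp add: sum_ennreal ennreal_leI)
qed

text \<open>Made for countable unions in an induction over Borel sets, where finite unions
  approximate uniformly in the index.\<close>

lemma convergent_of_uniform_approx:
  fixes X :: "nat \<Rightarrow> 'y::banach"
  assumes "\<And>\<kappa>. \<kappa> > 0 \<Longrightarrow> \<exists>Y. convergent Y \<and> (\<forall>n. norm (X n - Y n) < \<kappa>)"
  shows "convergent X"
  unfolding Cauchy_convergent_iff[symmetric]
proof (rule CauchyI)
  fix e :: real assume "e > 0"
  then obtain Y where Y: "convergent Y" "\<And>n. norm (X n - Y n) < e / 3"
    using assms[of "e / 3"] by auto
  then obtain K where K: "\<And>m n. m \<ge> K \<Longrightarrow> n \<ge> K \<Longrightarrow> norm (Y m - Y n) < e / 3"
    using CauchyD[OF convergent_Cauchy[OF Y(1)], of "e / 3"] \<open>e > 0\<close> by auto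
  have "norm (X m - X n) < e" if "m \<ge> K" "n \<ge> K" for m n
  proof -
    have "X m - X n = ((X m - Y m) + (Y m - Y n)) - (X n - Y n)" by simp
    also have "norm \<dots> \<le> norm (X m - Y m) + norm (Y m - Y n) + norm (X n - Y n)"
      using norm_triangle_ineq4 norm_triangle_ineq by (meson add_right_mono order_trans)
    finally show ?thesis using Y(2)[of m] Y(2)[of n] K[OF that] by simp
  qed
  then show "\<exists>K. \<forall>m\<ge>K. \<forall>n\<ge>K. norm (X m - X n) < e" by blast
qed

text \<open>Lebesgue measure of an interval as a finite measure on the whole line: what lies outside
  is null, so Borel sets need not be cut down.\<close>

definition lborel_on :: "real \<Rightarrow> real \<Rightarrow> real measure" where
  "lborel_on p q = density lborel (indicator {p<..q})"

lemma sets_lborel_on [simp, measurable_cong]: "sets (lborel_on p q) = sets borel"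
  by (simp add: lborel_on_def)

lemma space_lborel_on [simp]: "space (lborel_on p q) = UNIV"
  by (simp add: lborel_on_def)

lemma emeasure_lborel_on: "E \<in> sets borel \<Longrightarrow> emeasure (lborel_on p q) E = emeasure lborel (E \<inter> {p<..q})"
  by (simp add: lborel_on_def emeasure_density indicator_inter_arith[symmetric] Int_commute)

lemma measure_lborel_on: "E \<in> sets borel \<Longrightarrow> measure (lborel_on p q) E = measure lborel (E \<inter> {p<..q})"
  by (simp add: measure_def emeasure_lborel_on)

lemma finite_measure_lborel_on: "finite_measure (lborel_on p q)"
proof
  have "emeasure lborel {p<..q} < \<infinity>" by (cases "p \<le> q") auto
  then show "emeasure (lborel_on p q) (space (lborel_on p q)) \<noteq> \<infinity>"
    by (simp add: emeasure_lborel_on)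
qed

lemma measure_lborel_on_Ioc:
  assumes "p \<le> a" "a \<le> b" "b \<le> q" shows "measure (lborel_on p q) {a<..b} = b - a"
proof -
  have "{a<..b} \<inter> {p<..q} = {a<..b}" using assms by auto
  then show ?thesis using assms by (simp add: measure_lborel_on)
qed

text \<open>\<open>Hn n E\<close> integrates over \<open>E\<close> the derivative of the linear
  interpolation of \<open>f\<close> on \<open>Suc n\<close> equal pieces. All these set functions
  obey one bound in terms of the measure and converge on initial intervals to increments of
  \<open>f\<close>, hence converge on every Borel set. \<open>K\<close> and \<open>b\<close> convert
  between the two norms.\<close>

lemma lipschitz_vector_measure:
  fixes f :: "real \<Rightarrow> 'y::banach"
  assumes N: "is_norm N" and K: "K > 0" "\<And>y. norm y \<le> K * N y" and b: "\<And>y. N y \<le> b * norm y"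
    and f: "\<And>a b. a \<le> b \<Longrightarrow> N (f b - f a) \<le> L * (b - a)" and L: "L \<ge> 0" and pq: "p < q"
  obtains H where "continuous_vector_measure (lborel_on p q) H"
    "\<And>E. E \<in> sets borel \<Longrightarrow> N (H E) \<le> L * measure (lborel_on p q) E"
    "\<And>a b. p \<le> a \<Longrightarrow> a \<le> b \<Longrightarrow> b \<le> q \<Longrightarrow> H {a<..b} = f b - f a"
proof -
  define R where "R = lborel_on p q"
  interpret R: finite_measure R unfolding R_def by (rule finite_measure_lborel_on)
  have Rs [simp]: "sets R = sets borel" "space R = UNIV" by (simp_all add: R_def)
  have RI: "measure R {a<..b} = b - a" if "p \<le> a" "a \<le> b" "b \<le> q" for a b
    unfolding R_def by (rule measure_lborel_on_Ioc[OF that])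
  have Rout: "measure R (E \<inter> {p<..q}) = measure R E" if "E \<in> sets borel" for E
    using that by (simp add: R_def measure_lborel_on Int_assoc)
  define h where "h n = (q - p) / real (Suc n)" for n
  have h: "h n > 0" for n using pq by (simp add: h_def)
  define t where "t n k = p + real k * h n" for n k :: nat
  have tq: "t n (Suc n) = q" for n by (simp add: t_def h_def)
  have tS: "t n (Suc k) = t n k + h n" for n k by (simp add: t_def algebra_simps)
  have t0: "t n 0 = p" for n by (simp add: t_def)
  have tmono: "t n j \<le> t n k" if "j \<le> k" for n j k
    using that h[of n] by (simp add: t_def mult_right_mono)
  have tp: "p \<le> t n k" for n k using tmono[of 0 k n] by (simp add: t_def)
  define I where "I n k = {t n k<..t n (Suc k)}" for n k
  have Isub: "I n k \<subseteq> {p<..q}" if "k < Suc n" for n k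
    using tp[of n k] tmono[of "Suc k" "Suc n" n] that unfolding I_def tq by auto
  define D where "D n k = (1 / h n) *\<^sub>R (f (t n (Suc k)) - f (t n k))" for n k
  define Hn where "Hn n E = (\<Sum>k<Suc n. measure R (E \<inter> I n k) *\<^sub>R D n k)" for n E
  have ND: "N (D n k) \<le> L" for n k
    using f[of "t n k" "t n (Suc k)"] h[of n] by (simp add: D_def is_norm_scaleR[OF N] tS divide_le_eq)
  have part: "(\<Sum>k<j. measure R (E \<inter> I n k)) = measure R (E \<inter> {p<..t n j})" if E: "E \<in> sets borel" for E n j
  proof (induction j)
    case (Suc j)
    have "E \<inter> {p<..t n (Suc j)} = (E \<inter> {p<..t n j}) \<union> (E \<inter> I n j)"
      using tp[of n j] tmono[of j "Suc j" n] by (auto simp: I_def)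
    moreover have "measure R ((E \<inter> {p<..t n j}) \<union> (E \<inter> I n j)) = measure R (E \<inter> {p<..t n j}) + measure R (E \<inter> I n j)"
      using E by (intro R.finite_measure_Union) (auto simp: I_def)
    ultimately show ?case using Suc by simp
  qed (simp add: t_def)
  have N_sum: "N (\<Sum>i\<in>S. x i) \<le> (\<Sum>i\<in>S. N (x i))" if "finite S" for S and x :: "nat \<Rightarrow> 'y"
    using that
  proof (induction S rule: finite_induct)
    case (insert i S)
    then show ?case using is_norm_triangle[OF N, of "x i" "\<Sum>i\<in>S. x i"] by simp
  qed (simp add: is_norm_zero[OF N])
  have NHn: "N (Hn n E) \<le> L * measure R E" if E: "E \<in> sets borel" for n E
  proof -
    have "N (Hn n E) \<le> (\<Sum>k<Suc n. N (measure R (E \<inter> I n k) *\<^sub>R D n k))"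
      unfolding Hn_def by (rule N_sum) simp
    also have "\<dots> \<le> (\<Sum>k<Suc n. L * measure R (E \<inter> I n k))"
    proof (rule sum_mono)
      fix k
      show "N (measure R (E \<inter> I n k) *\<^sub>R D n k) \<le> L * measure R (E \<inter> I n k)"
        using mult_left_mono[OF ND[of n k], of "measure R (E \<inter> I n k)"]
        by (simp add: is_norm_scaleR[OF N] mult.commute)
    qed
    also have "\<dots> = L * measure R (E \<inter> {p<..t n (Suc n)})"
      unfolding sum_distrib_left[symmetric] part[OF E] ..
    also have "\<dots> = L * measure R E" by (simp only: tq Rout[OF E])
    finally show ?thesis .
  qed
  have nHn: "norm (Hn n E) \<le> K * L * measure R E" if E: "E \<in> sets borel" for n E
    by (rule order_trans[OF K(2)]) (simp add: mult.assoc NHn[OF E] K(1))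
  have Hn_Un: "Hn n (A \<union> B) = Hn n A + Hn n B" if "A \<in> sets borel" "B \<in> sets borel" "A \<inter> B = {}" for n A B
  proof -
    have "measure R ((A \<union> B) \<inter> I n k) = measure R (A \<inter> I n k) + measure R (B \<inter> I n k)" for k
      using that by (subst R.finite_measure_Union[symmetric]) (auto simp: I_def Int_Un_distrib2)
    then show ?thesis by (simp add: Hn_def scaleR_left_distrib sum.distrib)
  qed
  have Hn_Diff: "Hn n (A - B) = Hn n A - Hn n B" if "A \<in> sets borel" "B \<in> sets borel" "B \<subseteq> A" for n A B
    using Hn_Un[of "A - B" B n] that by (simp add: Un_absorb2 Int_commute)
  have Hn_empty: "Hn n {} = 0" for n by (simp add: Hn_def)
  have Hn_UN: "Hn n (\<Union>i<m. A i) = (\<Sum>i<m. Hn n (A i))"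
    if Ab: "\<And>i. A i \<in> sets borel" and dis: "disjoint_family A" for n m and A :: "nat \<Rightarrow> real set"
  proof (induction m)
    case (Suc m)
    have "A i \<inter> A m = {}" if "i < m" for i
      using disjoint_family_onD[OF dis UNIV_I UNIV_I, of i m] that by simp
    then have "(\<Union>i<m. A i) \<inter> A m = {}" by auto
    then show ?case using Suc Hn_Un[of "\<Union>i<m. A i" "A m" n] Ab by (simp add: lessThan_Suc Un_commute)
  qed (simp add: Hn_empty)
  \<comment> \<open>At grid points the interpolation is exact; between the last one and
    \<open>x\<close> both sides change by at most \<open>K * L * h n\<close>.\<close>
  have Hn_Ioc: "(\<lambda>n. Hn n {p<..x}) \<longlonglongrightarrow> f x - f p" if x: "p \<le> x" "x \<le> q" for x
  proof (rule LIM_zero_cancel, rule Lim_null_comparison)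
    have "norm (Hn n {p<..x} - (f x - f p)) \<le> 2 * K * L * h n" for n
    proof -
      define j where "j = nat \<lfloor>(x - p) / h n\<rfloor>"
      have fl: "of_int \<lfloor>(x - p) / h n\<rfloor> = real j" using x h[of n] by (simp add: j_def)
      have jx: "t n j \<le> x" "x < t n j + h n"
        using of_int_floor_le[of "(x - p) / h n"] real_of_int_floor_add_one_gt[of "(x - p) / h n"] h[of n]
        unfolding fl t_def by (simp_all add: field_simps)
      \<comment> \<open>The value \<open>j = Suc n\<close> does occur, namely for
        \<open>x = q\<close>.\<close>
      have jn: "j \<le> Suc n"
      proof -
        have "(x - p) / h n \<le> real (Suc n)" using x h[of n] tq[of n] by (simp add: t_def divide_le_eq)
        then have "real j \<le> real (Suc n)" using of_int_floor_le[of "(x - p) / h n"] unfolding fl by linarith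
        then show ?thesis by simp
      qed
      have cell: "measure R ({p<..t n j} \<inter> I n k) = (if k < j then h n else 0)" if "k < Suc n" for k
      proof (cases "k < j")
        case True
        then have "{p<..t n j} \<inter> I n k = I n k" using tmono[of "Suc k" j n] tp[of n k] by (auto simp: I_def)
        then show ?thesis using True RI[of "t n k" "t n (Suc k)"] tp tmono[of "Suc k" "Suc n" n] that h[of n]
          by (simp add: I_def tq tS)
      next
        case False
        then have "{p<..t n j} \<inter> I n k = {}" using tmono[of j k n] by (auto simp: I_def)
        then show ?thesis using False by simp
      qed
      have "Hn n {p<..t n j} = (\<Sum>k<Suc n. if k < j then f (t n (Suc k)) - f (t n k) else 0)"
        unfolding Hn_def using h[of n] by (intro sum.cong refl) (auto simp: cell D_def)
      also have "\<dots> = (\<Sum>k<j. f (t n (Suc k)) - f (t n k))"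
        using jn by (intro sum.mono_neutral_cong_right) auto
      also have "\<dots> = f (t n j) - f p"
        using sum_lessThan_telescope[of "\<lambda>k. f (t n k)" j] t0 by simp
      finally have Hj: "Hn n {p<..t n j} = f (t n j) - f p" .
      have "{p<..x} = {p<..t n j} \<union> {t n j<..x}" using jx tp[of n j] by auto
      moreover have "Hn n ({p<..t n j} \<union> {t n j<..x}) = Hn n {p<..t n j} + Hn n {t n j<..x}"
        by (rule Hn_Un) auto
      ultimately have "Hn n {p<..x} - (f x - f p) = Hn n {t n j<..x} - (f x - f (t n j))"
        using Hj by simp
      also have "norm \<dots> \<le> norm (Hn n {t n j<..x}) + norm (f x - f (t n j))" by (rule norm_triangle_ineq4)
      also have "norm (Hn n {t n j<..x}) \<le> K * L * (x - t n j)"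
        using nHn[of "{t n j<..x}" n] RI[of "t n j" x] tp jx x by simp
      also have "norm (f x - f (t n j)) \<le> K * L * (x - t n j)"
        by (rule order_trans[OF K(2)]) (simp add: mult.assoc f[OF jx(1)] K(1))
      also have "K * L * (x - t n j) + K * L * (x - t n j) \<le> 2 * K * L * h n"
        using mult_left_mono[of "x - t n j" "h n" "K * L"] jx K(1) L by (simp add: mult.assoc)
      finally show ?thesis by simp
    qed
    then show "\<forall>\<^sub>F n in sequentially. norm (Hn n {p<..x} - (f x - f p)) \<le> 2 * K * L * h n" by simp
    have "(\<lambda>n. 2 * K * L * (q - p) * (1 / real (Suc n))) \<longlonglongrightarrow> 2 * K * L * (q - p) * 0"
      by (intro tendsto_mult tendsto_const LIMSEQ_inverse_real_of_nat[unfolded inverse_eq_divide])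
    then show "(\<lambda>n. 2 * K * L * h n) \<longlonglongrightarrow> 0" by (simp add: h_def)
  qed
  have tail: "(\<lambda>m. measure R ((\<Union>i. A i) - (\<Union>i<m. A i))) \<longlonglongrightarrow> 0"
    if A: "\<And>i. A i \<in> sets borel" "disjoint_family A" for A :: "nat \<Rightarrow> real set"
  proof -
    have "(\<lambda>m. \<Sum>i<m. measure R (A i)) \<longlonglongrightarrow> measure R (\<Union>i. A i)"
      using R.finite_measure_UNION[of A] A unfolding sums_def by auto
    then have "(\<lambda>m. measure R (\<Union>i. A i) - (\<Sum>i<m. measure R (A i))) \<longlonglongrightarrow> measure R (\<Union>i. A i) - measure R (\<Union>i. A i)"
      by (intro tendsto_intros)
    moreover have "measure R ((\<Union>i. A i) - (\<Union>i<m. A i)) = measure R (\<Union>i. A i) - (\<Sum>i<m. measure R (A i))" for m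
    proof -
      have "measure R (\<Union>i<m. A i) = (\<Sum>i<m. measure R (A i))"
        using A by (intro R.finite_measure_finite_Union) (auto simp: disjoint_family_on_def)
      moreover have "measure R ((\<Union>i. A i) - (\<Union>i<m. A i)) = measure R (\<Union>i. A i) - measure R (\<Union>i<m. A i)"
        using A by (intro R.finite_measure_Diff) auto
      ultimately show ?thesis by simp
    qed
    ultimately show ?thesis by simp
  qed
  \<comment> \<open>Dynkin's argument from the half-lines. In the union case the common bound makes
    the tails small uniformly in \<open>n\<close>.\<close>
  have conv: "convergent (\<lambda>n. Hn n E)" if "E \<in> sets borel" for E
  proof -
    have borel: "sets borel = sigma_sets UNIV (range (\<lambda>a::real. {..a}))"
      by (subst borel_eq_atMost) (rule sets_measure_of, simp)
    have stable: "Int_stable (range (\<lambda>a::real. {..a}))" by (auto simp: Int_stable_def)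
    have pw: "range (\<lambda>a::real. {..a}) \<subseteq> Pow UNIV" by simp
    have E: "E \<in> sigma_sets UNIV (range (\<lambda>a::real. {..a}))" using that by (simp add: borel)
    from stable pw E show ?thesis
    proof (induction rule: sigma_sets_induct_disjoint)
      case (basic A)
      then obtain x where A: "A = {..x}" by blast
      \<comment> \<open>Only the part inside \<open>{p<..q}\<close> is seen, so the half-line acts
        like an initial interval.\<close>
      define y where "y = max p (min q x)"
      have "{p<..y} \<inter> {p<..q} = A \<inter> {p<..q}" using pq by (auto simp: A y_def)
      then have "Hn n A = Hn n {p<..y}" for n
      proof -
        have "A \<inter> I n k = {p<..y} \<inter> I n k" if "k < Suc n" for k
          using \<open>{p<..y} \<inter> {p<..q} = A \<inter> {p<..q}\<close> Isub[OF that] by blast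
        then show ?thesis unfolding Hn_def by (intro sum.cong) auto
      qed
      then show ?case using Hn_Ioc[of y] pq by (auto simp: convergent_def y_def)
    next
      case empty
      show ?case by (simp add: Hn_empty convergent_const)
    next
      case (compl A)
      have U: "(\<lambda>n. Hn n UNIV) = (\<lambda>n. Hn n {p<..q})"
      proof
        fix n
        have "UNIV \<inter> I n k = {p<..q} \<inter> I n k" if "k < Suc n" for k
          using Isub[OF that] by blast
        then show "Hn n UNIV = Hn n {p<..q}" unfolding Hn_def by (intro sum.cong) auto
      qed
      have "convergent (\<lambda>n. Hn n UNIV)" unfolding U using Hn_Ioc[of q] pq by (auto simp: convergent_def)
      moreover have "Hn n (UNIV - A) = Hn n UNIV - Hn n A" for n
        using compl(1) unfolding borel[symmetric] by (intro Hn_Diff) auto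
      ultimately show ?case using compl(2) by (simp add: convergent_diff)
    next
      case (union A)
      then have Ab: "\<And>i. A i \<in> sets borel" by (auto simp: borel)
      show ?case
      proof (rule convergent_of_uniform_approx)
        fix \<kappa> :: real assume "\<kappa> > 0"
        have "(\<lambda>m. K * L * measure R ((\<Union>i. A i) - (\<Union>i<m. A i))) \<longlonglongrightarrow> K * L * 0"
          by (intro tendsto_mult tendsto_const tail[OF Ab union(1)])
        then have "\<forall>\<^sub>F m in sequentially. K * L * measure R ((\<Union>i. A i) - (\<Union>i<m. A i)) < \<kappa>"
          by (rule order_tendstoD(2)) (simp add: \<open>\<kappa> > 0\<close>)
        from eventually_happens'[OF sequentially_bot this]
        obtain m where m: "K * L * measure R ((\<Union>i. A i) - (\<Union>i<m. A i)) < \<kappa>" by blast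
        have "norm (Hn n (\<Union>i. A i) - (\<Sum>i<m. Hn n (A i))) < \<kappa>" for n
        proof -
          have "Hn n (\<Union>i. A i) - (\<Sum>i<m. Hn n (A i)) = Hn n ((\<Union>i. A i) - (\<Union>i<m. A i))"
            unfolding Hn_UN[OF Ab union(1), symmetric] using Ab by (intro Hn_Diff[symmetric]) auto
          then show ?thesis using nHn[of "(\<Union>i. A i) - (\<Union>i<m. A i)" n] Ab m by auto
        qed
        moreover have "convergent (\<lambda>n. \<Sum>i<m. Hn n (A i))" using union(3) by (intro convergent_sum)
        ultimately show "\<exists>Y. convergent Y \<and> (\<forall>n. norm (Hn n (\<Union>i. A i) - Y n) < \<kappa>)" by blast
      qed
    qed
  qed
  define H where "H E = lim (\<lambda>n. Hn n E)" for E
  have Hlim: "(\<lambda>n. Hn n E) \<longlonglongrightarrow> H E" if "E \<in> sets borel" for E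
    using conv[OF that] by (simp add: H_def convergent_LIMSEQ_iff)
  have nH: "norm (H E) \<le> K * L * measure R E" if "E \<in> sets borel" for E
    using nHn[OF that] by (intro LIMSEQ_le_const2[OF tendsto_norm[OF Hlim[OF that]]]) auto
  have H_Diff: "H (A - B) = H A - H B" if "A \<in> sets borel" "B \<in> sets borel" "B \<subseteq> A" for A B
  proof (rule LIMSEQ_unique)
    show "(\<lambda>n. Hn n (A - B)) \<longlonglongrightarrow> H (A - B)" using that by (intro Hlim) auto
    show "(\<lambda>n. Hn n (A - B)) \<longlonglongrightarrow> H A - H B"
      unfolding Hn_Diff[OF that] using that by (intro tendsto_intros Hlim)
  qed
  have vm: "vector_measure R H"
    unfolding vector_measure_def
  proof (intro allI impI)
    fix A :: "nat \<Rightarrow> real set" assume "range A \<subseteq> sets R" and dis: "disjoint_family A"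
    then have Ab: "\<And>i. A i \<in> sets borel" by auto
    show "(\<lambda>i. H (A i)) sums H (\<Union>i. A i)"
      unfolding sums_def
    proof (rule LIM_zero_cancel, rule Lim_null_comparison)
      have "norm ((\<Sum>i<m. H (A i)) - H (\<Union>i. A i)) \<le> K * L * measure R ((\<Union>i. A i) - (\<Union>i<m. A i))" for m
      proof -
        have "(\<lambda>n. \<Sum>i<m. Hn n (A i)) \<longlonglongrightarrow> (\<Sum>i<m. H (A i))" using Ab by (intro tendsto_sum Hlim)
        moreover have "(\<lambda>n. \<Sum>i<m. Hn n (A i)) \<longlonglongrightarrow> H (\<Union>i<m. A i)"
          unfolding Hn_UN[OF Ab dis, symmetric] using Ab by (intro Hlim) auto
        ultimately have "(\<Sum>i<m. H (A i)) = H (\<Union>i<m. A i)" by (rule LIMSEQ_unique)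
        moreover have "H ((\<Union>i. A i) - (\<Union>i<m. A i)) = H (\<Union>i. A i) - H (\<Union>i<m. A i)"
          using Ab by (intro H_Diff) auto
        ultimately have "norm ((\<Sum>i<m. H (A i)) - H (\<Union>i. A i)) = norm (H ((\<Union>i. A i) - (\<Union>i<m. A i)))"
          by (simp add: norm_minus_commute)
        then show ?thesis using nH[of "(\<Union>i. A i) - (\<Union>i<m. A i)"] Ab by auto
      qed
      then show "\<forall>\<^sub>F m in sequentially. norm ((\<Sum>i<m. H (A i)) - H (\<Union>i. A i)) \<le>
          K * L * measure R ((\<Union>i. A i) - (\<Union>i<m. A i))" by simp
      have "(\<lambda>m. K * L * measure R ((\<Union>i. A i) - (\<Union>i<m. A i))) \<longlonglongrightarrow> K * L * 0"
        by (intro tendsto_mult tendsto_const tail[OF Ab dis])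
      then show "(\<lambda>m. K * L * measure R ((\<Union>i. A i) - (\<Union>i<m. A i))) \<longlonglongrightarrow> 0" by simp
    qed
  qed
  have cw: "continuous_wrt R H"
    unfolding continuous_wrt_def
  proof (intro allI impI)
    fix e :: real assume e: "e > 0"
    have KL: "K * L + 1 > 0" using K(1) L by (simp add: add_nonneg_pos)
    show "\<exists>\<delta>>0. \<forall>E\<in>sets R. measure R E < \<delta> \<longrightarrow> norm (H E) < e"
    proof (intro exI[of _ "e / (K * L + 1)"] conjI ballI impI)
      show "e / (K * L + 1) > 0" using e KL by simp
      fix E assume E: "E \<in> sets R" "measure R E < e / (K * L + 1)"
      have "norm (H E) \<le> K * L * measure R E" using nH E(1) by simp
      also have "\<dots> \<le> (K * L + 1) * measure R E" by (simp add: algebra_simps)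
      also have "\<dots> < e" using E(2) KL by (simp add: less_divide_eq mult.commute)
      finally show "norm (H E) < e" .
    qed
  qed
  interpret H: continuous_vector_measure R H using vm cw by unfold_locales
  show ?thesis
  proof (rule that[of H, folded R_def])
    show "continuous_vector_measure R H" by (rule H.continuous_vector_measure_axioms)
    show "H {a<..b} = f b - f a" if ab: "p \<le> a" "a \<le> b" "b \<le> q" for a b
    proof -
      have Hx: "H {p<..x} = f x - f p" if "p \<le> x" "x \<le> q" for x
        using LIMSEQ_unique[OF Hlim Hn_Ioc[OF that]] by simp
      have "{a<..b} = {p<..b} - {p<..a}" using ab by auto
      moreover have "{p<..a} \<subseteq> {p<..b}" using ab by auto
      ultimately show ?thesis using H_Diff[of "{p<..b}" "{p<..a}"] Hx[of a] Hx[of b] ab by simp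
    qed
    fix E :: "real set" assume E: "E \<in> sets borel"
    \<comment> \<open>\<open>N\<close> is continuous because it is dominated by
      \<open>b * norm\<close>, so its bound survives the limit.\<close>
    have "(\<lambda>n. L * measure R E + b * norm (H E - Hn n E)) \<longlonglongrightarrow> L * measure R E + b * norm (H E - H E)"
      by (intro tendsto_intros Hlim[OF E])
    moreover have "N (H E) \<le> L * measure R E + b * norm (H E - Hn n E)" for n
      using is_norm_triangle_sub[OF N, of "H E" "Hn n E"] NHn[OF E, of n] b[of "H E - Hn n E"] by linarith
    ultimately have "N (H E) \<le> L * measure R E + b * norm (H E - H E)"
      by (intro LIMSEQ_le_const) auto
    then show "N (H E) \<le> L * measure R E" by simp
  qed
qed

section \<open>Density from the Radon-Nikodym property\<close>

text \<open>The interval is transported into \<open>'w\<close> along an injection of the reals, and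
  the sets found there are pulled back.\<close>

lemma RNP_countable_cover:
  fixes H :: "real set \<Rightarrow> 'y::banach"
  assumes rnp: "has_RNP TYPE('w) TYPE('y)" and big: "(UNIV :: real set) \<lesssim> (UNIV :: 'w set)"
    and H: "continuous_vector_measure (lborel_on p q) H"
    and C: "C \<ge> 0" "\<And>E. E \<in> sets borel \<Longrightarrow> norm (H E) \<le> C * measure (lborel_on p q) E"
    and \<delta>: "\<delta> > 0"
  obtains A :: "nat \<Rightarrow> real set" and y where "\<And>j. A j \<in> sets borel" "(\<Union>j. A j) = UNIV"
    "\<And>j E. E \<in> sets borel \<Longrightarrow> E \<subseteq> A j \<Longrightarrow>
       norm (H E - measure (lborel_on p q) E *\<^sub>R y j) \<le> \<delta> * measure (lborel_on p q) E"
proof -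
  define R where "R = lborel_on p q"
  interpret H: continuous_vector_measure R H unfolding R_def by (rule H)
  have Rs [simp]: "sets R = sets borel" "space R = UNIV" by (simp_all add: R_def)
  obtain \<phi> :: "real \<Rightarrow> 'w" where \<phi>: "inj \<phi>" using big by (auto simp: lepoll_def)
  define M where "M = embed_measure R \<phi>"
  have \<phi>m: "\<phi> \<in> measurable R M" unfolding M_def by (rule measurable_embed_measure2[OF \<phi>])
  have pre: "\<phi> -` E \<in> sets borel" if "E \<in> sets M" for E
    using measurable_sets[OF \<phi>m that] by simp
  have img: "\<phi> ` E \<in> sets M" "\<phi> -` (\<phi> ` E) = E" if "E \<in> sets borel" for E
    using that \<phi> unfolding M_def by (auto simp: in_sets_embed_measure inj_vimage_image_eq)
  have em: "emeasure M E = emeasure R (\<phi> -` E)" if "E \<in> sets M" for E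
    using emeasure_embed_measure[OF \<phi> that[unfolded M_def]] by (simp add: M_def)
  have mM: "measure M E = measure R (\<phi> -` E)" if "E \<in> sets M" for E
    by (simp add: measure_def em[OF that])
  interpret M: finite_measure M
    by (rule finite_measureI) (simp add: em[OF sets.top])
  define G where "G E = H (\<phi> -` E)" for E
  have vm: "vector_measure M G"
    unfolding vector_measure_def G_def
  proof (intro allI impI)
    fix A :: "nat \<Rightarrow> 'w set" assume "range A \<subseteq> sets M" "disjoint_family A"
    then have "(\<lambda>n. H (\<phi> -` A n)) sums H (\<Union>n. \<phi> -` A n)"
      using pre by (intro H.sums_UN) (fastforce simp: disjoint_family_on_def)+
    then show "(\<lambda>n. H (\<phi> -` A n)) sums H (\<phi> -` (\<Union>n. A n))" by (simp add: vimage_UN)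
  qed
  have cw: "continuous_wrt M G"
    unfolding continuous_wrt_def
  proof (intro allI impI)
    fix e :: real assume "e > 0"
    then obtain d where "d > 0" "\<forall>E\<in>sets R. measure R E < d \<longrightarrow> norm (H E) < e"
      using H.cont unfolding continuous_wrt_def by blast
    then show "\<exists>d>0. \<forall>E\<in>sets M. measure M E < d \<longrightarrow> norm (G E) < e"
      using pre mM by (intro exI[of _ d]) (simp add: G_def)
  qed
  have "variation M G (space M) \<le> ennreal (C * measure M (space M))"
    using C pre mM by (intro M.variation_le) (simp_all add: G_def R_def)
  then have "variation M G (space M) < \<infinity>" by (simp add: order_le_less_trans)
  then obtain g where g: "Bochner_integrable M g"
    "\<And>E. E \<in> sets M \<Longrightarrow> has_Bochner_integral M (\<lambda>x. indicat_real E x *\<^sub>R g x) (G E)"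
    using rnp vm cw M.finite_measure_axioms unfolding has_RNP_def by blast
  have "strongly_measurable M g"
    using g(1) by (auto simp: Bochner_integrable_def has_Bochner_integral_def)
  then obtain A y where A: "\<And>j::nat. A j \<in> sets M" "(\<Union>j. A j) = space M"
    "\<And>j E. E \<in> sets M \<Longrightarrow> E \<subseteq> A j \<Longrightarrow> norm (G E - measure M E *\<^sub>R y j) \<le> \<delta> * measure M E"
    using M.Bochner_density_countable_cover[OF _ g(2) \<delta>] by metis
  show ?thesis
  proof (rule that[of "\<lambda>j. \<phi> -` A j" y])
    show "\<phi> -` A j \<in> sets borel" for j by (rule pre[OF A(1)])
    have "space M = range \<phi>" by (simp add: M_def space_embed_measure)
    then show "(\<Union>j. \<phi> -` A j) = UNIV" using A(2) by (auto simp flip: vimage_UN)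
    fix j E assume E: "E \<in> sets borel" "E \<subseteq> \<phi> -` A j"
    then have "\<phi> ` E \<subseteq> A j" by auto
    from A(3)[OF img(1)[OF E(1)] this]
    show "norm (H E - measure (lborel_on p q) E *\<^sub>R y j) \<le> \<delta> * measure (lborel_on p q) E"
      by (simp add: G_def mM[OF img(1)[OF E(1)]] img(2)[OF E(1)] flip: R_def)
  qed
qed

text \<open>The modified map \<open>k\<close> follows \<open>f\<close> off \<open>S\<close> and
  moves with velocity \<open>v\<close> on \<open>S\<close>, in both cases at rate at most
  \<open>L\<close>; near a density point of \<open>S\<close> only the second part counts.\<close>

lemma dense_of_RNP:
  fixes N :: "'y::banach \<Rightarrow> real"
  assumes rnp: "has_RNP TYPE('w) TYPE('y)" and big: "(UNIV :: real set) \<lesssim> (UNIV :: 'w set)"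
    and ren: "renorming N"
  shows "dense_in_Lip0 N (SNA N \<union> Der N :: (real \<Rightarrow> 'y) set)"
  unfolding dense_in_Lip0_def
proof (intro conjI ballI allI impI)
  show "SNA N \<union> Der N \<subseteq> (Lip0 N :: (real \<Rightarrow> 'y) set)" by (auto simp: SNA_def Der_def)
  fix f :: "real \<Rightarrow> 'y" and \<epsilon> :: real
  assume f: "f \<in> Lip0 N" and \<epsilon>: "\<epsilon> > 0"
  have N: "is_norm N" using ren by (simp add: renorming_def)
  obtain a b where ab: "a > 0" "b > 0" "\<And>y. a * norm y \<le> N y" "\<And>y. N y \<le> b * norm y"
    using ren unfolding renorming_def by blast
  define L where "L = lip_norm N f"
  have L0: "L \<ge> 0" unfolding L_def by (rule lip_norm_nonneg[OF N f])
  have fL: "N (f d - f c) \<le> L * (d - c)" if "c \<le> d" for c d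
    using lip_norm_bound[OF N f, of d c] that by (simp add: L_def)
  show "\<exists>g\<in>SNA N \<union> Der N. lip_norm N (\<lambda>x. f x - g x) < \<epsilon>"
  proof (cases "L = 0")
    \<comment> \<open>A constant map attains its norm 0 at any pair of points.\<close>
    case True
    have "N (f 1 - f 0) = 0" using fL[of 0 1] True is_norm_nonneg[OF N, of "f 1 - f 0"] by simp
    then have "f \<in> SNA N"
      using f True unfolding SNA_def L_def mem_Collect_eq
      by (intro conjI exI[of _ "1::real"] exI[of _ "0::real"]) auto
    moreover have "lip_norm N (\<lambda>x. f x - f x) \<le> 0"
      by (rule lip_norm_le[OF N]) (simp add: is_norm_zero[OF N])
    ultimately show ?thesis using \<epsilon> by (intro bexI[of _ f]) auto
  next
    case False
    with L0 have L: "L > 0" by simp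
    \<comment> \<open>\<open>f\<close> will be moved by at most \<open>3 * \<kappa>\<close>, which
      must be below \<open>\<epsilon>\<close>, and \<open>L - 2 * \<kappa>\<close> has to stay
      positive.\<close>
    define \<kappa> where "\<kappa> = min \<epsilon> L / 4"
    have \<kappa>: "\<kappa> > 0" "4 * \<kappa> \<le> \<epsilon>" "4 * \<kappa> \<le> L" using \<epsilon> L by (auto simp: \<kappa>_def)
    obtain p q where pq: "p < q" "(L - \<kappa>) * (q - p) < N (f q - f p)"
      using lip_norm_gt[OF N, of "L - \<kappa>" f] \<kappa> by (auto simp: L_def)
    define R where "R = lborel_on p q"
    have Kb: "norm y \<le> (1 / a) * N y" for y using ab(3)[of y] ab(1) by (simp add: field_simps)
    obtain H where H: "continuous_vector_measure R H"
      "\<And>E. E \<in> sets borel \<Longrightarrow> N (H E) \<le> L * measure R E"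
      "\<And>c d. p \<le> c \<Longrightarrow> c \<le> d \<Longrightarrow> d \<le> q \<Longrightarrow> H {c<..d} = f d - f c"
      using lipschitz_vector_measure[OF N _ Kb ab(4) fL L0 pq(1)] ab(1) unfolding R_def by auto
    interpret H: continuous_vector_measure R H by (rule H(1))
    have Rs [simp]: "sets R = sets borel" "space R = UNIV" by (simp_all add: R_def)
    have RI: "measure R {c<..d} = d - c" if "p \<le> c" "c \<le> d" "d \<le> q" for c d
      unfolding R_def by (rule measure_lborel_on_Ioc[OF that])
    have Hn: "norm (H E) \<le> (L / a) * measure R E" if "E \<in> sets borel" for E
      using ab(3)[of "H E"] H(2)[OF that] ab(1) by (simp add: field_simps)
    \<comment> \<open>Accuracy \<open>\<kappa> / b\<close> in the original norm is accuracy
      \<open>\<kappa>\<close> for \<open>N\<close>.\<close>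
    have "\<kappa> / b > 0" "L / a \<ge> 0" using \<kappa> ab L by auto
    then obtain A y where A: "\<And>j::nat. A j \<in> sets borel" "(\<Union>j. A j) = UNIV"
      "\<And>j E. E \<in> sets borel \<Longrightarrow> E \<subseteq> A j \<Longrightarrow> norm (H E - measure R E *\<^sub>R y j) \<le> \<kappa> / b * measure R E"
      using RNP_countable_cover[OF rnp big H(1)[unfolded R_def] _ Hn[unfolded R_def]] unfolding R_def by metis
    have NA: "N (H E - measure R E *\<^sub>R y j) \<le> \<kappa> * measure R E" if "E \<in> sets borel" "E \<subseteq> A j" for E j
    proof -
      have "N (H E - measure R E *\<^sub>R y j) \<le> b * (\<kappa> / b * measure R E)"
        using ab(2) A(3)[OF that] by (intro order_trans[OF ab(4)] mult_left_mono) auto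
      then show ?thesis using ab(2) by simp
    qed
    \<comment> \<open>Otherwise, summing over a disjoint refinement of the cover would give
      \<open>N (f q - f p) \<le> (L - \<kappa>) * (q - p)\<close>, contrary to the choice of
      \<open>p\<close> and \<open>q\<close>.\<close>
    obtain j where j: "measure R (A j) > 0" "N (y j) > L - 2 * \<kappa>"
    proof (rule ccontr)
      assume "\<not> thesis"
      with that have neg: "measure R (A j) = 0 \<or> N (y j) \<le> L - 2 * \<kappa>" for j
        by (meson not_le measure_nonneg zero_less_measure_iff)
      define D where "D = disjointed A"
      have D: "D j \<in> sets borel" "D j \<subseteq> A j" for j
        using A(1) sets.range_disjointed_sets[of A borel] disjointed_subset[of A j] by (auto simp: D_def)
      have dD: "disjoint_family D" unfolding D_def by (rule disjoint_family_disjointed)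
      have UD: "(\<Union>j. D j) = UNIV" unfolding D_def UN_disjointed_eq by (rule A(2))
      have ND: "N (H (D j)) \<le> (L - \<kappa>) * measure R (D j)" for j
      proof (cases "measure R (A j) = 0")
        case True
        then have "measure R (D j) = 0"
          using H.finite_measure_mono[OF D(2), of j] A(1) by (simp add: measure_le_0_iff)
        then show ?thesis using H(2)[OF D(1)[of j]] is_norm_nonneg[OF N, of "H (D j)"] by simp
      next
        case False
        then have "N (y j) \<le> L - 2 * \<kappa>" using neg by blast
        from mult_left_mono[OF this, of "measure R (D j)"]
        have "N (measure R (D j) *\<^sub>R y j) \<le> (L - 2 * \<kappa>) * measure R (D j)"
          by (simp add: is_norm_scaleR[OF N] mult.commute)
        then show ?thesis
          using is_norm_triangle_sub[OF N, of "H (D j)" "measure R (D j) *\<^sub>R y j"] NA[OF D, of j]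
          by (simp add: algebra_simps)
      qed
      have sR: "(\<lambda>j. measure R (D j)) sums measure R UNIV"
        using H.finite_measure_UNION[of D] D dD by (auto simp: UD)
      have RU: "measure R UNIV = q - p"
        using pq by (simp add: R_def measure_lborel_on)
      have "(\<lambda>j. H (D j)) sums H UNIV" using H.sums_UN[of D] D dD by (auto simp: UD)
      then have lim: "(\<lambda>n. \<Sum>j<n. H (D j)) \<longlonglongrightarrow> H UNIV" by (simp add: sums_def)
      have part: "N (\<Sum>j<n. H (D j)) \<le> (L - \<kappa>) * (q - p)" for n
      proof -
        have "N (\<Sum>j<n. H (D j)) \<le> (\<Sum>j<n. (L - \<kappa>) * measure R (D j))"
        proof (induction n)
          case (Suc n)
          then show ?case
            using is_norm_triangle[OF N, of "\<Sum>j<n. H (D j)" "H (D n)"] ND[of n] by simp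
        qed (simp add: is_norm_zero[OF N])
        also have "\<dots> \<le> (L - \<kappa>) * measure R UNIV"
          unfolding sum_distrib_left[symmetric] using \<kappa> sum_le_suminf[of "\<lambda>j. measure R (D j)" "{..<n}"] sR
          by (intro mult_left_mono) (auto simp: sums_iff)
        finally show ?thesis by (simp add: RU)
      qed
      have "(\<lambda>n. (L - \<kappa>) * (q - p) + b * norm (H UNIV - (\<Sum>j<n. H (D j)))) \<longlonglongrightarrow>
          (L - \<kappa>) * (q - p) + b * norm (H UNIV - H UNIV)"
        by (intro tendsto_intros lim)
      moreover have "N (H UNIV) \<le> (L - \<kappa>) * (q - p) + b * norm (H UNIV - (\<Sum>j<n. H (D j)))" for n
        using is_norm_triangle_sub[OF N, of "H UNIV" "\<Sum>j<n. H (D j)"] part[of n]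
          ab(4)[of "H UNIV - (\<Sum>j<n. H (D j))"] by linarith
      ultimately have HU: "N (H UNIV) \<le> (L - \<kappa>) * (q - p) + b * norm (H UNIV - H UNIV)"
        by (intro LIMSEQ_le_const) auto
      have "measure R (UNIV - {p<..q}) = 0" by (simp add: R_def measure_lborel_on Int_commute)
      then have "H (UNIV - {p<..q}) = 0" by (intro H.G_null) auto
      then have "H UNIV = H {p<..q}" using H.G_Diff[of UNIV "{p<..q}"] by simp
      then have "H UNIV = f q - f p" using H(3)[of p q] pq by simp
      then show False using HU pq(2) by simp
    qed
    define S where "S = A j \<inter> {p<..q}"
    define w where "w = y j"
    have Sb: "S \<in> sets borel" using A(1) by (simp add: S_def)
    have RS: "measure R (E \<inter> S) = measure lborel (E \<inter> S)" if "E \<in> sets borel" for E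
    proof -
      have "(E \<inter> S) \<inter> {p<..q} = E \<inter> S" by (auto simp: S_def)
      then show ?thesis using that Sb by (simp add: R_def measure_lborel_on)
    qed
    have S0: "measure R S > 0"
    proof -
      have "measure R S = measure R (A j)"
        using A(1) by (simp add: S_def R_def measure_lborel_on Int_assoc)
      then show ?thesis using j(1) by simp
    qed
    have NS: "N (H E - measure R E *\<^sub>R w) \<le> \<kappa> * measure R E" if "E \<in> sets borel" "E \<subseteq> S" for E
      unfolding w_def using that by (intro NA) (auto simp: S_def)
    have w1: "N w > L - 2 * \<kappa>" using j(2) by (simp add: w_def)
    have w0: "N w > 0" using w1 \<kappa> by linarith
    have w2: "N w \<le> L + \<kappa>"
    proof -
      have "N (measure R S *\<^sub>R w) \<le> N (H S) + N (H S - measure R S *\<^sub>R w)"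
        using is_norm_triangle_sub[OF N, of "measure R S *\<^sub>R w" "H S"] is_norm_commute[OF N] by simp
      also have "\<dots> \<le> L * measure R S + \<kappa> * measure R S"
        using H(2)[OF Sb] NS[OF Sb] by (intro add_mono) auto
      finally have "measure R S * N w \<le> measure R S * (L + \<kappa>)"
        by (simp add: is_norm_scaleR[OF N] algebra_simps)
      then show ?thesis using S0 by simp
    qed
    define v where "v = (L / N w) *\<^sub>R w"
    have v: "N v = L" using w0 L by (simp add: v_def is_norm_scaleR[OF N])
    have wv: "N (w - v) \<le> 2 * \<kappa>"
    proof -
      have "w - v = (1 - L / N w) *\<^sub>R w" by (simp add: v_def scaleR_diff_left)
      then have "N (w - v) = \<bar>1 - L / N w\<bar> * \<bar>N w\<bar>" using w0 by (simp add: is_norm_scaleR[OF N])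
      also have "\<dots> = \<bar>N w - L\<bar>" unfolding abs_mult[symmetric] using w0 by (simp add: left_diff_distrib)
      finally show ?thesis using w1 w2 \<kappa> by simp
    qed
    have NSv: "N (H E - measure R E *\<^sub>R v) \<le> 3 * \<kappa> * measure R E" if E: "E \<in> sets borel" "E \<subseteq> S" for E
    proof -
      have dec: "H E - measure R E *\<^sub>R v = (H E - measure R E *\<^sub>R w) + measure R E *\<^sub>R (w - v)"
        by (simp add: scaleR_diff_right)
      have "N (H E - measure R E *\<^sub>R v) \<le> N (H E - measure R E *\<^sub>R w) + N (measure R E *\<^sub>R (w - v))"
        unfolding dec by (rule is_norm_triangle[OF N])
      also have "N (measure R E *\<^sub>R (w - v)) = measure R E * N (w - v)"
        by (simp add: is_norm_scaleR[OF N])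
      finally have "N (H E - measure R E *\<^sub>R v) \<le> N (H E - measure R E *\<^sub>R w) + measure R E * N (w - v)" .
      then show ?thesis using NS[OF E] mult_left_mono[OF wv, of "measure R E"] by (simp add: algebra_simps)
    qed
    text \<open>Replace the derivative of \<open>f\<close> by the constant \<open>v\<close> on \<open>S\<close>.\<close>
    define r where "r x = H ({..x} \<inter> S) - measure R ({..x} \<inter> S) *\<^sub>R v" for x
    define k where "k x = f x - (r x - r 0)" for x
    have split: "{..d} \<inter> S = ({..c} \<inter> S) \<union> ({c<..d} \<inter> S)" if "c \<le> d" for c d using that by auto
    have r: "r d - r c = H ({c<..d} \<inter> S) - measure R ({c<..d} \<inter> S) *\<^sub>R v" if "c \<le> d" for c d
    proof -
      have "H ({..d} \<inter> S) = H ({..c} \<inter> S) + H ({c<..d} \<inter> S)"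
        unfolding split[OF that] using Sb by (intro H.G_Un) auto
      moreover have "measure R ({..d} \<inter> S) = measure R ({..c} \<inter> S) + measure R ({c<..d} \<inter> S)"
        unfolding split[OF that] using Sb by (intro H.finite_measure_Union) auto
      ultimately show ?thesis by (simp add: r_def algebra_simps)
    qed
    have RScd: "measure R ({c<..d} \<inter> S) \<le> d - c" if "c \<le> d" for c d
    proof -
      have "measure lborel ({c<..d} \<inter> S) \<le> measure lborel {c<..d}"
        using Sb that by (intro measure_mono_fmeasurable) (auto simp: fmeasurable_def)
      then show ?thesis using that by (simp add: RS)
    qed
    \<comment> \<open>\<open>H\<close> sees only \<open>{p<..q}\<close>: the part of the interval
      inside is estimated by the bound for \<open>H\<close>, the parts outside by the one for
      \<open>f\<close>.\<close>
    have rest: "N (f d - f c - H ({c<..d} \<inter> S)) \<le> L * ((d - c) - measure R ({c<..d} \<inter> S))" if cd: "c \<le> d" for c d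
    proof -
      define c' d' where "c' = max c p" and "d' = min d q"
      show ?thesis
      proof (cases "c' \<le> d'")
        case False
        then have "{c<..d} \<inter> S = {}" by (auto simp: c'_def d'_def S_def)
        then show ?thesis using fL[OF cd] by simp
      next
        case True
        have o: "c \<le> c'" "d' \<le> d" "p \<le> c'" "d' \<le> q" by (auto simp: c'_def d'_def)
        have eq: "{c<..d} \<inter> S = {c'<..d'} \<inter> S" by (auto simp: c'_def d'_def S_def)
        have sub: "H ({c'<..d'} - {c'<..d'} \<inter> S) = f d' - f c' - H ({c'<..d'} \<inter> S)"
          using H.G_Diff[of "{c'<..d'}" "{c'<..d'} \<inter> S"] Sb H(3)[OF o(3) True o(4)] by simp
        have "measure R ({c'<..d'} - {c'<..d'} \<inter> S) = (d' - c') - measure R ({c'<..d'} \<inter> S)"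
          using H.finite_measure_Diff[of "{c'<..d'}" "{c'<..d'} \<inter> S"] Sb RI[OF o(3) True o(4)] by simp
        then have mid: "N (f d' - f c' - H ({c'<..d'} \<inter> S)) \<le> L * ((d' - c') - measure R ({c'<..d'} \<inter> S))"
          using H(2)[of "{c'<..d'} - {c'<..d'} \<inter> S"] Sb sub by simp
        have "f d - f c - H ({c<..d} \<inter> S) =
            (f d - f d') + (f c' - f c) + (f d' - f c' - H ({c'<..d'} \<inter> S))" by (simp add: eq)
        also have "N \<dots> \<le> N (f d - f d') + N (f c' - f c) + N (f d' - f c' - H ({c'<..d'} \<inter> S))"
          using is_norm_triangle[OF N] by (meson add_right_mono order_trans)
        also have "\<dots> \<le> L * (d - d') + L * (c' - c) + L * ((d' - c') - measure R ({c'<..d'} \<inter> S))"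
          using o by (intro add_mono fL mid)
        also have "\<dots> = L * ((d - c) - measure R ({c<..d} \<inter> S))" by (simp add: eq algebra_simps)
        finally show ?thesis .
      qed
    qed
    have k_diff: "k d - k c = (f d - f c - H ({c<..d} \<inter> S)) + measure R ({c<..d} \<inter> S) *\<^sub>R v" if "c \<le> d" for c d
      using r[OF that] by (simp add: k_def algebra_simps)
    have kL: "N (k d - k c) \<le> L * (d - c)" if "c \<le> d" for c d
    proof -
      have "N (k d - k c) \<le> L * ((d - c) - measure R ({c<..d} \<inter> S)) + measure R ({c<..d} \<inter> S) * L"
        unfolding k_diff[OF that]
        using rest[OF that] by (intro order_trans[OF is_norm_triangle[OF N]] add_mono) (auto simp: is_norm_scaleR[OF N] v)
      then show ?thesis by (simp add: algebra_simps)
    qed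
    \<comment> \<open>The deviation from velocity \<open>v\<close> stems from the complement of
      \<open>S\<close>: the increment of \<open>f\<close> there and the missing multiple of
      \<open>v\<close>, each at rate \<open>L\<close>.\<close>
    have kv: "N (k d - k c - (d - c) *\<^sub>R v) \<le> 2 * L * ((d - c) - measure R ({c<..d} \<inter> S))" if "c \<le> d" for c d
    proof -
      have "k d - k c - (d - c) *\<^sub>R v =
          (f d - f c - H ({c<..d} \<inter> S)) - ((d - c) - measure R ({c<..d} \<inter> S)) *\<^sub>R v"
        unfolding k_diff[OF that] by (simp add: algebra_simps)
      also have "N \<dots> \<le> N (f d - f c - H ({c<..d} \<inter> S)) + N (((d - c) - measure R ({c<..d} \<inter> S)) *\<^sub>R v)"
        by (rule is_norm_triangle_diff[OF N])
      also have "\<dots> \<le> L * ((d - c) - measure R ({c<..d} \<inter> S)) + ((d - c) - measure R ({c<..d} \<inter> S)) * L"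
        using rest[OF that] RScd[OF that] by (intro add_mono) (auto simp: is_norm_scaleR[OF N] v)
      finally show ?thesis by (simp add: algebra_simps)
    qed
    have k0: "k 0 = 0" using f by (simp add: k_def Lip0_def)
    have kLip: "k \<in> Lip0 N" using kL k0 by (intro Lip0_I[OF N, where K=L]) auto
    have close: "lip_norm N (\<lambda>x. f x - k x) \<le> 3 * \<kappa>"
    proof (rule lip_norm_le[OF N])
      fix c d :: real assume cd: "c < d"
      have "(f d - k d) - (f c - k c) = r d - r c" by (simp add: k_def)
      also have "N \<dots> \<le> 3 * \<kappa> * measure R ({c<..d} \<inter> S)"
        unfolding r[OF less_imp_le[OF cd]] using Sb by (intro NSv) auto
      also have "\<dots> \<le> 3 * \<kappa> * (d - c)" using RScd[of c d] cd \<kappa> by (intro mult_left_mono) auto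
      finally show "N ((f d - k d) - (f c - k c)) \<le> 3 * \<kappa> * (d - c)" .
    qed
    have Slm: "S \<in> lmeasurable"
      by (rule fmeasurableI2[of "cbox p q"]) (use Sb in \<open>auto simp: S_def\<close>)
    have "measure lebesgue S > 0" using S0 RS[of UNIV] Sb by (simp add: measure_completion)
    then obtain x where x: "x \<in> S" "\<And>\<eta>. \<eta> > 0 \<Longrightarrow> \<exists>r0>0. \<forall>r. 0 < r \<and> r < r0 \<longrightarrow>
       measure lebesgue (cball x r - S) \<le> \<eta> * measure lebesgue (cball x r)"
      using density_point[OF Slm] by blast
    have dens: "(d - c) - measure R ({c<..d} \<inter> S) \<le> measure lebesgue (cball x t - S)"
      if "c \<le> d" "{c<..d} \<subseteq> cball x t" for c d t
    proof -
      have "{c<..d} - S = {c<..d} - {c<..d} \<inter> S" by auto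
      moreover have "measure lborel ({c<..d} - {c<..d} \<inter> S) = measure lborel {c<..d} - measure lborel ({c<..d} \<inter> S)"
        using Sb that(1) by (intro measure_Diff) auto
      ultimately have "(d - c) - measure R ({c<..d} \<inter> S) = measure lebesgue ({c<..d} - S)"
        using that(1) Sb by (simp add: RS measure_completion)
      also have "\<dots> \<le> measure lebesgue (cball x t - S)"
        using Sb that(2) Slm by (intro measure_mono_fmeasurable) (auto intro: fmeasurable.Diff)
      finally show ?thesis .
    qed
    have quot: "\<exists>r0>0. \<forall>t. t \<noteq> 0 \<and> \<bar>t\<bar> < r0 \<longrightarrow> N ((1 / t) *\<^sub>R (k (x + t) - k x) - v) \<le> e" if e: "e > 0" for e
    proof -
      \<comment> \<open>Of the factor 4, one 2 comes from the bound \<open>2 * L\<close> and the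
        other from the length of the ball.\<close>
      define \<eta> where "\<eta> = e / (4 * L)"
      have "\<eta> > 0" using e L by (simp add: \<eta>_def)
      then obtain r0 where r0: "r0 > 0" "\<And>r. 0 < r \<Longrightarrow> r < r0 \<Longrightarrow>
          measure lebesgue (cball x r - S) \<le> \<eta> * measure lebesgue (cball x r)" using x(2) by blast
      have "N ((1 / t) *\<^sub>R (k (x + t) - k x) - v) \<le> e" if t: "t \<noteq> 0" "\<bar>t\<bar> < r0" for t
      proof -
        \<comment> \<open>Ordered endpoints treat both signs of \<open>t\<close> at once, as the
          two-sided limit requires.\<close>
        define c d where "c = min x (x + t)" and "d = max x (x + t)"
        have cd: "c \<le> d" "d - c = \<bar>t\<bar>" "{c<..d} \<subseteq> cball x \<bar>t\<bar>"
          by (auto simp: c_def d_def dist_real_def)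
        have "(1 / t) *\<^sub>R (k (x + t) - k x) - v = (1 / \<bar>t\<bar>) *\<^sub>R (k d - k c - (d - c) *\<^sub>R v)"
          using t(1) unfolding cd(2) by (cases "t > 0") (auto simp: c_def d_def scaleR_diff_right scaleR_add_right)
        then have "N ((1 / t) *\<^sub>R (k (x + t) - k x) - v) = (1 / \<bar>t\<bar>) * N (k d - k c - (d - c) *\<^sub>R v)"
          by (simp add: is_norm_scaleR[OF N])
        also have "\<dots> \<le> (1 / \<bar>t\<bar>) * (2 * L * (\<eta> * (2 * \<bar>t\<bar>)))"
        proof (intro mult_left_mono order_trans[OF kv[OF cd(1)]])
          have "measure lebesgue (cball x \<bar>t\<bar>) = 2 * \<bar>t\<bar>" by (simp add: cball_eq_atLeastAtMost)
          then show "(d - c) - measure R ({c<..d} \<inter> S) \<le> \<eta> * (2 * \<bar>t\<bar>)"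
            using dens[OF cd(1,3)] r0(2)[of "\<bar>t\<bar>"] t by simp
        qed (use L in auto)
        also have "\<dots> = e" using t(1) L by (simp add: \<eta>_def)
        finally show ?thesis .
      qed
      then show ?thesis using r0(1) by blast
    qed
    have "lip_norm N k = L"
    proof (rule antisym)
      show "lip_norm N k \<le> L" by (rule lip_norm_le[OF N]) (rule kL, simp)
      show "L \<le> lip_norm N k"
      proof (rule field_le_epsilon)
        fix e :: real assume "e > 0"
        then obtain r0 where r0: "r0 > 0"
          "\<And>t. t \<noteq> 0 \<Longrightarrow> \<bar>t\<bar> < r0 \<Longrightarrow> N ((1 / t) *\<^sub>R (k (x + t) - k x) - v) \<le> e" using quot by blast
        define t where "t = r0 / 2"
        have t: "t > 0" "\<bar>t\<bar> < r0" using r0 by (auto simp: t_def)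
        have "L \<le> N ((1 / t) *\<^sub>R (k (x + t) - k x)) + N ((1 / t) *\<^sub>R (k (x + t) - k x) - v)"
          using is_norm_triangle_sub[OF N, of v "(1 / t) *\<^sub>R (k (x + t) - k x)"]
            is_norm_commute[OF N, of v] v by simp
        also have "N ((1 / t) *\<^sub>R (k (x + t) - k x)) \<le> lip_norm N k"
          using lip_norm_bound[OF N kLip, of "x + t" x] t by (simp add: is_norm_scaleR[OF N] divide_le_eq)
        also have "N ((1 / t) *\<^sub>R (k (x + t) - k x) - v) \<le> e" using r0(2) t by simp
        finally show "L \<le> lip_norm N k + e" by simp
      qed
    qed
    moreover have "has_directional_derivative N k x 1 v"
      unfolding has_directional_derivative_def tendsto_iff eventually_at
    proof (intro allI impI)
      fix e :: real assume "e > 0"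
      then obtain r0 where "r0 > 0"
        "\<forall>t. t \<noteq> 0 \<and> \<bar>t\<bar> < r0 \<longrightarrow> N ((1 / t) *\<^sub>R (k (x + t) - k x) - v) \<le> e / 2"
        using quot[of "e / 2"] by auto
      then show "\<exists>d>0. \<forall>t\<in>UNIV. t \<noteq> 0 \<and> dist t 0 < d \<longrightarrow>
          dist (N ((1 / t) *\<^sub>R (k (x + t *\<^sub>R 1) - k x) - v)) 0 < e"
        using \<open>e > 0\<close> is_norm_nonneg[OF N] by (intro exI[of _ r0]) (fastforce simp: dist_real_def)
    qed
    ultimately have "k \<in> Der N"
      using kLip v unfolding Der_def mem_Collect_eq
      by (intro conjI exI[of _ x] exI[of _ "1::real"] exI[of _ v]) auto
    then show ?thesis using close \<kappa> by (intro bexI[of _ k]) auto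
  qed
qed

theorem corollary2p14:
  assumes nontrivial: "\<exists>y::'y::banach. y \<noteq> 0"
    and big: "(UNIV :: real set) \<lesssim> (UNIV :: 'w set)"
  shows "has_RNP TYPE('w) TYPE('y) \<longleftrightarrow>
    (\<forall>N :: 'y \<Rightarrow> real. renorming N \<longrightarrow>
       dense_in_Lip0 N (SNA N \<union> Der N :: (real \<Rightarrow> 'y) set))"
  using dense_of_RNP[OF _ big, where 'y='y] RNP_of_dense[where 'y='y and 'w='w] renorming_norm by blast

end
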